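(* Suppose $M$ is compact, the Euler class $\chi(\mathcal E)$ is non-zero, and $\sigma$ is a non-trivial (i.e. not identically zero) section of $\mathcal E$. Then for each $p\in\mathbb R$ there exists at most one $q\in\mathbb R$ such that $\sigma$ is a $(p,q)$-harmonic section of $\mathcal E$. Moreover, if $\sigma$ is a $(p,q)$-harmonic section of $\mathcal E$, then: (a) if $-4\le p\le -1$ then $q<-1-p$; (b) if $-1\le p\le 1$ then $q<0$; (c) if $1<p\le 2$ and $\|\sigma\|_\infty\le 1/\sqrt{p-1}$ then $q<0$; (d) if $2\le p$ and $\|\sigma\|_\infty\le 1/\sqrt{p-1}$ then $q<1-p/2$.
   Context: Setting: $(M,g)$ is a smooth, oriented, connected Riemannian manifold without boundary, and $\pi\colon\mathcal E\to M$ is a smooth oriented real vector bundle with a fibre metric $\langle\,,\rangle$ and a connection $\nabla$ for which the fibre metric is holonomy-invariant, i.e. $\nabla\langle\,,\rangle=0$. All sections are smooth. For a section $\sigma$, put $F=\tfrac12|\sigma|^2\colon M\to\mathbb R$, let $\nabla F$ be its gradient, $|\nabla\sigma|^2=\sum_i|\nabla_{E_i}\sigma|^2$ for a local orthonormal tangent frame $\{E_i\}$, and $\|\sigma\|_\infty=\sup_{x\in M}|\sigma(x)|$. For $p,q\in\mathbb R$ define a symmetric 2-tensor on the total space $\mathcal E$ by $h_{p,q}(A,B)=g(d\pi(A),d\pi(B))+(1+|e|^2)^{-p}\big(\langle KA,KB\rangle+q\langle KA,e\rangle\langle KB,e\rangle\big)$ for $A,B\in T_e\mathcal E$, where $K\colon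 T\mathcal E\to\mathcal E$ is the connection map of $\nabla$. The vertical $(p,q)$-energy of $\sigma$ on compact $M$ (half the integral of the $h_{p,q}$-square norm of the vertical part of $d\sigma$) is $$E^v_{p,q}(\sigma)=\frac12\int_M\frac{1}{(1+|\sigma|^2)^p}\big(|\nabla\sigma|^2+q|\nabla F|^2\big)\,\mathrm{vol}(g).$$ $\sigma$ is a $(p,q)$-harmonic section of $\mathcal E$ if $\frac{d}{dt}\big|_{t=0}E^v_{p,q}(\sigma_t)=0$ for every smooth variation $\sigma_t$ of $\sigma_0=\sigma$ through sections of $\mathcal E$. *)

theory Defs
  imports "HOL-Analysis.Analysis" "HOL-Homology.Homology"
begin

section \<open>Smooth maps between open subsets of normed spaces\<close>

text \<open>Only used on open sets of finite-dimensional spaces, where continuity of all iterated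
  directional derivatives is the usual notion of being \<open>k\<close> times continuously differentiable.\<close>

primrec Ck_on ::
  "nat \<Rightarrow> ('a::real_normed_vector \<Rightarrow> 'b::real_normed_vector) \<Rightarrow> 'a set \<Rightarrow> bool" where
  "Ck_on 0 f S \<longleftrightarrow> continuous_on S f"
| "Ck_on (Suc k) f S \<longleftrightarrow>
     (\<forall>x\<in>S. f differentiable at x) \<and> (\<forall>v. Ck_on k (\<lambda>x. frechet_derivative f (at x) v) S)"

definition smooth_on ::
  "('a::real_normed_vector \<Rightarrow> 'b::real_normed_vector) \<Rightarrow> 'a set \<Rightarrow> bool" where
  "smooth_on f S \<longleftrightarrow> (\<forall>k. Ck_on k f S)"


section \<open>Oriented Riemannian manifolds\<close>

text \<open>The manifold is the whole of a (Hausdorff, second countable) type \<open>'m\<close>. A chart is a pair of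
  an open domain and a coordinate map, only relevant on that domain. A tangent vector at a point
  is a family of coordinate vectors, one for each chart around the point, which transform by the
  derivatives of the coordinate changes; at all other charts the family is set to zero.\<close>

type_synonym ('m, 'n) chart = "'m set \<times> ('m \<Rightarrow> real^'n)"
type_synonym ('m, 'n) tvec = "('m, 'n) chart \<Rightarrow> real^'n"

record ('m, 'n) riem_manifold =
  atlas :: "('m, 'n) chart set"
  metric :: "'m \<Rightarrow> ('m, 'n) tvec \<Rightarrow> ('m, 'n) tvec \<Rightarrow> real"

definition chart_inv :: "('m, 'n::finite) chart \<Rightarrow> real^'n \<Rightarrow> 'm" where
  "chart_inv c = inv_into (fst c) (snd c)"

definition coord_change_deriv ::
  "('m, 'n::finite) chart \<Rightarrow> ('m, 'n) chart \<Rightarrow> 'm \<Rightarrow> real^'n \<Rightarrow> real^'n" where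
  "coord_change_deriv c d x = frechet_derivative (snd d \<circ> chart_inv c) (at (snd c x))"

definition oriented_smooth_atlas ::
  "('m::topological_space, 'n::finite) chart set \<Rightarrow> bool" where
  "oriented_smooth_atlas A \<longleftrightarrow>
     (\<forall>c\<in>A. open (fst c) \<and> open (snd c ` fst c) \<and>
        homeomorphism (fst c) (snd c ` fst c) (snd c) (chart_inv c)) \<and>
     (\<Union>c\<in>A. fst c) = UNIV \<and>
     (\<forall>c\<in>A. \<forall>d\<in>A. smooth_on (snd d \<circ> chart_inv c) (snd c ` (fst c \<inter> fst d)) \<and>
        (\<forall>x\<in>fst c \<inter> fst d. det (matrix (coord_change_deriv c d x)) > 0))"

definition tangent_space ::
  "('m, 'n::finite, 'z) riem_manifold_scheme \<Rightarrow> 'm \<Rightarrow> ('m, 'n) tvec set" where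
  "tangent_space M x = {v.
     (\<forall>c. \<not> (c \<in> atlas M \<and> x \<in> fst c) \<longrightarrow> v c = 0) \<and>
     (\<forall>c\<in>atlas M. \<forall>d\<in>atlas M. x \<in> fst c \<inter> fst d \<longrightarrow> v d = coord_change_deriv c d x (v c))}"

definition tvec_zero :: "('m, 'n::finite) tvec" where
  "tvec_zero = (\<lambda>c. 0)"

definition tvec_comb ::
  "real \<Rightarrow> ('m, 'n::finite) tvec \<Rightarrow> real \<Rightarrow> ('m, 'n) tvec \<Rightarrow> ('m, 'n) tvec" where
  "tvec_comb a v b w = (\<lambda>c. a *\<^sub>R v c + b *\<^sub>R w c)"

text \<open>The tangent vector at \<open>x\<close> whose coordinates in the chart \<open>c\<close> are \<open>\<xi>\<close>.\<close>

definition coord_vec ::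
  "('m, 'n::finite, 'z) riem_manifold_scheme \<Rightarrow> ('m, 'n) chart \<Rightarrow> 'm \<Rightarrow> real^'n \<Rightarrow> ('m, 'n) tvec" where
  "coord_vec M c x \<xi> =
     (\<lambda>d. if d \<in> atlas M \<and> x \<in> fst d then coord_change_deriv c d x \<xi> else 0)"

definition chart_at :: "('m, 'n::finite, 'z) riem_manifold_scheme \<Rightarrow> 'm \<Rightarrow> ('m, 'n) chart" where
  "chart_at M x = (SOME c. c \<in> atlas M \<and> x \<in> fst c)"

definition smooth_fun ::
  "('m, 'n::finite, 'z) riem_manifold_scheme \<Rightarrow> ('m \<Rightarrow> real) \<Rightarrow> bool" where
  "smooth_fun M f \<longleftrightarrow> (\<forall>c\<in>atlas M. smooth_on (f \<circ> chart_inv c) (snd c ` fst c))"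

text \<open>The derivative of \<open>f\<close> at \<open>x\<close> along the tangent vector \<open>v\<close>.\<close>

definition dir_deriv ::
  "('m, 'n::finite, 'z) riem_manifold_scheme \<Rightarrow> ('m \<Rightarrow> real) \<Rightarrow> 'm \<Rightarrow> ('m, 'n) tvec \<Rightarrow> real" where
  "dir_deriv M f x v = (let c = chart_at M x in
     frechet_derivative (f \<circ> chart_inv c) (at (snd c x)) (v c))"

definition riemannian_metric ::
  "('m, 'n::finite, 'z) riem_manifold_scheme \<Rightarrow> bool" where
  "riemannian_metric M \<longleftrightarrow>
     (\<forall>x. \<forall>u\<in>tangent_space M x. \<forall>v\<in>tangent_space M x. \<forall>w\<in>tangent_space M x.
        metric M x v w = metric M x w v \<and>
        (v \<noteq> tvec_zero \<longrightarrow> metric M x v v > 0) \<and>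
        (\<forall>a b. metric M x (tvec_comb a u b v) w = a * metric M x u w + b * metric M x v w)) \<and>
     (\<forall>c\<in>atlas M. \<forall>\<xi> \<eta>. smooth_on
        (\<lambda>y. let x = chart_inv c y in metric M x (coord_vec M c x \<xi>) (coord_vec M c x \<eta>))
        (snd c ` fst c))"

definition oriented_riemannian_manifold ::
  "('m::{t2_space,second_countable_topology}, 'n::finite, 'z) riem_manifold_scheme \<Rightarrow> bool" where
  "oriented_riemannian_manifold M \<longleftrightarrow> oriented_smooth_atlas (atlas M) \<and> riemannian_metric M"

definition gram_matrix ::
  "('m, 'n::finite, 'z) riem_manifold_scheme \<Rightarrow> ('m, 'n) chart \<Rightarrow> 'm \<Rightarrow> real^'n^'n" where
  "gram_matrix M c x =
     (\<chi> i j. metric M x (coord_vec M c x (axis i 1)) (coord_vec M c x (axis j 1)))"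

text \<open>The measure of the Riemannian volume form, which is the unique Borel measure given by
  \<open>sqrt (det g\<^sub>i\<^sub>j) dy\<close> in every chart.\<close>

definition is_riemannian_volume ::
  "('m::topological_space, 'n::finite, 'z) riem_manifold_scheme \<Rightarrow> 'm measure \<Rightarrow> bool" where
  "is_riemannian_volume M vol \<longleftrightarrow> sets vol = sets borel \<and>
     (\<forall>c\<in>atlas M. \<forall>B\<in>sets borel. B \<subseteq> fst c \<longrightarrow>
        emeasure vol B =
          (\<integral>\<^sup>+y. ennreal (sqrt (det (gram_matrix M c (chart_inv c y)))) * indicator (snd c ` B) y
             \<partial>lborel))"

definition orthonormal_frame ::
  "('m, 'n::finite, 'z) riem_manifold_scheme \<Rightarrow> 'm \<Rightarrow> ('n \<Rightarrow> ('m, 'n) tvec) \<Rightarrow> bool" where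
  "orthonormal_frame M x e \<longleftrightarrow> (\<forall>i. e i \<in> tangent_space M x) \<and>
     (\<forall>i j. metric M x (e i) (e j) = (if i = j then 1 else 0))"

definition gradient ::
  "('m, 'n::finite, 'z) riem_manifold_scheme \<Rightarrow> ('m \<Rightarrow> real) \<Rightarrow> 'm \<Rightarrow> ('m, 'n) tvec" where
  "gradient M f x = (THE v. v \<in> tangent_space M x \<and>
     (\<forall>w\<in>tangent_space M x. metric M x v w = dir_deriv M f x w))"


section \<open>Oriented vector bundles with metric connection\<close>

text \<open>A trivialisation over an open set \<open>U\<close> is a pair of \<open>U\<close> and a map \<open>\<Phi>\<close> such that
  \<open>e \<mapsto> (proj E e, \<Phi> e)\<close> is a homeomorphism of the part of the total space \<open>'e\<close> over \<open>U\<close> onto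
  \<open>U \<times> real^'r\<close>. In \<open>conn E x v \<sigma>\<close>, the vector \<open>v\<close> is a tangent vector at \<open>x\<close> and the result is
  the covariant derivative of the section \<open>\<sigma>\<close> along \<open>v\<close>.\<close>

record ('m, 'n, 'e, 'r) metric_bundle = "('m, 'n) riem_manifold" +
  proj :: "'e \<Rightarrow> 'm"
  trivs :: "('m set \<times> ('e \<Rightarrow> real^'r)) set"
  fibre_metric :: "'e \<Rightarrow> 'e \<Rightarrow> real"
  conn :: "'m \<Rightarrow> ('m, 'n) tvec \<Rightarrow> ('m \<Rightarrow> 'e) \<Rightarrow> 'e"

definition triv_map ::
  "('m, 'n::finite, 'e, 'r::finite) metric_bundle \<Rightarrow> 'm set \<times> ('e \<Rightarrow> real^'r) \<Rightarrow> 'e \<Rightarrow> 'm \<times> (real^'r)" where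
  "triv_map E b e = (proj E e, snd b e)"

definition triv_inv ::
  "('m, 'n::finite, 'e, 'r::finite) metric_bundle \<Rightarrow> 'm set \<times> ('e \<Rightarrow> real^'r) \<Rightarrow> 'm \<Rightarrow> real^'r \<Rightarrow> 'e" where
  "triv_inv E b x \<xi> = inv_into (proj E -` fst b) (triv_map E b) (x, \<xi>)"

definition oriented_vector_bundle ::
  "('m::topological_space, 'n::finite, 'e::topological_space, 'r::finite) metric_bundle \<Rightarrow> bool"
where
  "oriented_vector_bundle E \<longleftrightarrow>
     continuous_on UNIV (proj E) \<and>
     (\<forall>b\<in>trivs E. open (fst b) \<and>
        homeomorphism (proj E -` fst b) (fst b \<times> UNIV) (triv_map E b) (\<lambda>(x, \<xi>). triv_inv E b x \<xi>)) \<and>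
     (\<Union>b\<in>trivs E. fst b) = UNIV \<and>
     (\<forall>b\<in>trivs E. \<forall>b'\<in>trivs E. \<exists>G :: 'm \<Rightarrow> real^'r^'r.
        (\<forall>e. proj E e \<in> fst b \<inter> fst b' \<longrightarrow> snd b' e = G (proj E e) *v snd b e) \<and>
        (\<forall>x\<in>fst b \<inter> fst b'. det (G x) > 0) \<and>
        (\<forall>c\<in>atlas E. smooth_on (G \<circ> chart_inv c) (snd c ` (fst c \<inter> fst b \<inter> fst b'))))"

text \<open>The vector space structure of the fibres, transported from \<open>real^'r\<close>. It does not depend
  on the chosen trivialisation, as the transition maps are linear.\<close>

definition triv_at :: "('m, 'n::finite, 'e, 'r::finite) metric_bundle \<Rightarrow> 'm \<Rightarrow> 'm set \<times> ('e \<Rightarrow> real^'r)"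
where
  "triv_at E x = (SOME b. b \<in> trivs E \<and> x \<in> fst b)"

definition fibre_zero :: "('m, 'n::finite, 'e, 'r::finite) metric_bundle \<Rightarrow> 'm \<Rightarrow> 'e" where
  "fibre_zero E x = triv_inv E (triv_at E x) x 0"

text \<open>The linear combination of two elements of the same fibre.\<close>

definition fibre_comb ::
  "('m, 'n::finite, 'e, 'r::finite) metric_bundle \<Rightarrow> real \<Rightarrow> 'e \<Rightarrow> real \<Rightarrow> 'e \<Rightarrow> 'e" where
  "fibre_comb E a e b e' = (let t = triv_at E (proj E e) in
     triv_inv E t (proj E e) (a *\<^sub>R snd t e + b *\<^sub>R snd t e'))"

definition smooth_fibre_metric ::
  "('m, 'n::finite, 'e, 'r::finite) metric_bundle \<Rightarrow> bool" where
  "smooth_fibre_metric E \<longleftrightarrow>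
     (\<forall>e e' e''. proj E e = proj E e' \<and> proj E e' = proj E e'' \<longrightarrow>
        fibre_metric E e e' = fibre_metric E e' e \<and>
        (e \<noteq> fibre_zero E (proj E e) \<longrightarrow> fibre_metric E e e > 0) \<and>
        (\<forall>a b. fibre_metric E (fibre_comb E a e b e') e'' =
           a * fibre_metric E e e'' + b * fibre_metric E e' e'')) \<and>
     (\<forall>c\<in>atlas E. \<forall>b\<in>trivs E. \<forall>\<xi> \<eta>. smooth_on
        (\<lambda>y. let x = chart_inv c y in fibre_metric E (triv_inv E b x \<xi>) (triv_inv E b x \<eta>))
        (snd c ` (fst c \<inter> fst b)))"

definition smooth_section ::
  "('m, 'n::finite, 'e, 'r::finite) metric_bundle \<Rightarrow> ('m \<Rightarrow> 'e) \<Rightarrow> bool" where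
  "smooth_section E \<sigma> \<longleftrightarrow> (\<forall>x. proj E (\<sigma> x) = x) \<and>
     (\<forall>c\<in>atlas E. \<forall>b\<in>trivs E.
        smooth_on (snd b \<circ> \<sigma> \<circ> chart_inv c) (snd c ` (fst c \<inter> fst b)))"

definition connection :: "('m, 'n::finite, 'e, 'r::finite) metric_bundle \<Rightarrow> bool" where
  "connection E \<longleftrightarrow>
     (\<forall>x. \<forall>v\<in>tangent_space E x. \<forall>w\<in>tangent_space E x. \<forall>\<sigma> \<tau>.
        smooth_section E \<sigma> \<and> smooth_section E \<tau> \<longrightarrow>
          proj E (conn E x v \<sigma>) = x \<and>
          (\<forall>a b. conn E x (tvec_comb a v b w) \<sigma> =
             fibre_comb E a (conn E x v \<sigma>) b (conn E x w \<sigma>)) \<and>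
          conn E x v (\<lambda>z. fibre_comb E 1 (\<sigma> z) 1 (\<tau> z)) =
             fibre_comb E 1 (conn E x v \<sigma>) 1 (conn E x v \<tau>) \<and>
          (\<forall>f. smooth_fun E f \<longrightarrow>
             conn E x v (\<lambda>z. fibre_comb E (f z) (\<sigma> z) 0 (\<sigma> z)) =
               fibre_comb E (dir_deriv E f x v) (\<sigma> x) (f x) (conn E x v \<sigma>))) \<and>
     (\<forall>\<sigma>. smooth_section E \<sigma> \<longrightarrow>
        (\<forall>c\<in>atlas E. \<forall>b\<in>trivs E. \<forall>\<xi>. smooth_on
           (\<lambda>y. let x = chart_inv c y in snd b (conn E x (coord_vec E c x \<xi>) \<sigma>))
           (snd c ` (fst c \<inter> fst b))))"

definition metric_compatible :: "('m, 'n::finite, 'e, 'r::finite) metric_bundle \<Rightarrow> bool" where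
  "metric_compatible E \<longleftrightarrow>
     (\<forall>\<sigma> \<tau> x. \<forall>v\<in>tangent_space E x. smooth_section E \<sigma> \<and> smooth_section E \<tau> \<longrightarrow>
        dir_deriv E (\<lambda>z. fibre_metric E (\<sigma> z) (\<tau> z)) x v =
          fibre_metric E (conn E x v \<sigma>) (\<tau> x) + fibre_metric E (\<sigma> x) (conn E x v \<tau>))"

definition oriented_riemannian_vector_bundle ::
  "('m::{t2_space,second_countable_topology}, 'n::finite, 'e::topological_space, 'r::finite)
     metric_bundle \<Rightarrow> bool" where
  "oriented_riemannian_vector_bundle E \<longleftrightarrow>
     oriented_riemannian_manifold E \<and> oriented_vector_bundle E \<and>
     smooth_fibre_metric E \<and> connection E \<and> metric_compatible E"


section \<open>The Euler class\<close>

text \<open>Singular cohomology with integer coefficients of a pair. A cochain is given by its values on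
  singular simplices; it is zero on all other functions and on the simplices of the subspace.\<close>

type_synonym 'a cochain = "((nat \<Rightarrow> real) \<Rightarrow> 'a) \<Rightarrow> int"

definition cochain_eval :: "'a cochain \<Rightarrow> 'a chain \<Rightarrow> int" where
  "cochain_eval \<phi> a = (\<Sum>s\<in>Poly_Mapping.keys a. poly_mapping.lookup a s * \<phi> s)"

definition cochains :: "nat \<Rightarrow> 'a topology \<Rightarrow> 'a set \<Rightarrow> 'a cochain set" where
  "cochains p X S = {\<phi>. \<forall>s.
     \<not> singular_simplex p X s \<or> singular_simplex p (subtopology X S) s \<longrightarrow> \<phi> s = 0}"

definition cochain_coboundary :: "nat \<Rightarrow> 'a topology \<Rightarrow> 'a cochain \<Rightarrow> 'a cochain" where
  "cochain_coboundary p X \<phi> = (\<lambda>s.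
     if singular_simplex (Suc p) X s
     then cochain_eval \<phi> (chain_boundary (Suc p) (frag_of s)) else 0)"

definition cocycles :: "nat \<Rightarrow> 'a topology \<Rightarrow> 'a set \<Rightarrow> 'a cochain set" where
  "cocycles p X S = {\<phi> \<in> cochains p X S. cochain_coboundary p X \<phi> = (\<lambda>s. 0)}"

definition coboundaries :: "nat \<Rightarrow> 'a topology \<Rightarrow> 'a set \<Rightarrow> 'a cochain set" where
  "coboundaries p X S = (case p of
     0 \<Rightarrow> {\<lambda>s. 0} | Suc k \<Rightarrow> cochain_coboundary k X ` cochains k X S)"

definition cocycle_group :: "nat \<Rightarrow> 'a topology \<Rightarrow> 'a set \<Rightarrow> 'a cochain monoid" where
  "cocycle_group p X S = \<lparr>carrier = cocycles p X S,
     monoid.mult = (\<lambda>\<phi> \<psi> s. \<phi> s + \<psi> s), one = (\<lambda>s. 0)\<rparr>"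

definition relative_cohomology_group ::
  "nat \<Rightarrow> 'a topology \<Rightarrow> 'a set \<Rightarrow> 'a cochain set monoid" where
  "relative_cohomology_group p X S = cocycle_group p X S Mod coboundaries p X S"

abbreviation cohomology_group :: "nat \<Rightarrow> 'a topology \<Rightarrow> 'a cochain set monoid" where
  "cohomology_group p X \<equiv> relative_cohomology_group p X {}"

definition cohomology_class ::
  "nat \<Rightarrow> 'a topology \<Rightarrow> 'a set \<Rightarrow> 'a cochain \<Rightarrow> 'a cochain set" where
  "cohomology_class p X S \<phi> = coboundaries p X S #>\<^bsub>cocycle_group p X S\<^esub> \<phi>"

definition cochain_pullback ::
  "nat \<Rightarrow> 'a topology \<Rightarrow> ('a \<Rightarrow> 'b) \<Rightarrow> 'b cochain \<Rightarrow> 'a cochain" where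
  "cochain_pullback p X f \<phi> = (\<lambda>s. if singular_simplex p X s then \<phi> (simplex_map p f s) else 0)"

definition nonzero_part :: "('m, 'n::finite, 'e, 'r::finite) metric_bundle \<Rightarrow> 'e set" where
  "nonzero_part E = {e. e \<noteq> fibre_zero E (proj E e)}"

definition fibre_simplex ::
  "('m, 'n::finite, 'e, 'r::finite) metric_bundle \<Rightarrow> 'm set \<times> ('e \<Rightarrow> real^'r) \<Rightarrow> 'm \<Rightarrow>
   (nat \<Rightarrow> real^'r) \<Rightarrow> (nat \<Rightarrow> real) \<Rightarrow> 'e" where
  "fibre_simplex E b x v =
     (\<lambda>t\<in>standard_simplex CARD('r). triv_inv E b x (\<Sum>j\<le>CARD('r). t j *\<^sub>R v j))"

text \<open>A cocycle representing the Thom class (Milnor and Stasheff, Characteristic Classes,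
  Sections 9 and 10): a relative cocycle of degree \<open>r\<close> of the total space modulo the complement of
  the zero section whose restriction to every fibre is the generator preferred by the orientation.
  That generator takes the value 1 on the linearly embedded simplices in the fibre which have
  barycentre 0 and whose edge vectors at the initial vertex form a positive basis. The enumeration
  \<open>to_nat_on UNIV\<close> of the index type \<open>'r\<close> fixes the standard orientation of \<open>real^'r\<close>; another
  enumeration changes the Thom class at most by a sign.\<close>

definition thom_cocycle ::
  "('m, 'n::finite, 'e::topological_space, 'r::finite) metric_bundle \<Rightarrow> 'e cochain \<Rightarrow> bool" where
  "thom_cocycle E u \<longleftrightarrow>
     u \<in> cocycles CARD('r) euclidean (nonzero_part E) \<and>
     (\<forall>b\<in>trivs E. \<forall>x\<in>fst b. \<forall>v :: nat \<Rightarrow> real^'r.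
        (\<Sum>j\<le>CARD('r). v j) = 0 \<and>
        det (\<chi> i k. (v (Suc (to_nat_on UNIV k)) - v 0) $ i) > 0 \<longrightarrow>
          u (fibre_simplex E b x v) = 1)"

text \<open>The Euler class is the pullback of the Thom class by the zero section. By the Thom
  isomorphism theorem there is exactly one such class.\<close>

definition is_euler_class ::
  "('m::topological_space, 'n::finite, 'e::topological_space, 'r::finite) metric_bundle \<Rightarrow>
   'm cochain set \<Rightarrow> bool" where
  "is_euler_class E \<chi>E \<longleftrightarrow> (\<exists>u. thom_cocycle E u \<and>
     \<chi>E = cohomology_class CARD('r) euclidean {}
       (cochain_pullback CARD('r) euclidean (fibre_zero E) u))"


section \<open>Harmonic sections\<close>

definition half_norm_sq :: "('m, 'n::finite, 'e, 'r::finite) metric_bundle \<Rightarrow> ('m \<Rightarrow> 'e) \<Rightarrow> 'm \<Rightarrow> real" where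
  "half_norm_sq E \<sigma> x = fibre_metric E (\<sigma> x) (\<sigma> x) / 2"

text \<open>The square norm of the covariant derivative, computed in an orthonormal frame; it does not
  depend on the frame.\<close>

definition conn_norm_sq ::
  "('m, 'n::finite, 'e, 'r::finite) metric_bundle \<Rightarrow> ('m \<Rightarrow> 'e) \<Rightarrow> 'm \<Rightarrow> real" where
  "conn_norm_sq E \<sigma> x = (let e = (SOME e. orthonormal_frame E x e) in
     \<Sum>i\<in>UNIV. fibre_metric E (conn E x (e i) \<sigma>) (conn E x (e i) \<sigma>))"

definition grad_norm_sq ::
  "('m, 'n::finite, 'z) riem_manifold_scheme \<Rightarrow> ('m \<Rightarrow> real) \<Rightarrow> 'm \<Rightarrow> real" where
  "grad_norm_sq M f x = metric M x (gradient M f x) (gradient M f x)"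

definition vertical_energy ::
  "('m, 'n::finite, 'e, 'r::finite) metric_bundle \<Rightarrow> 'm measure \<Rightarrow> real \<Rightarrow> real \<Rightarrow> ('m \<Rightarrow> 'e) \<Rightarrow> real" where
  "vertical_energy E vol p q \<sigma> = 1 / 2 * (LINT x|vol.
     1 / (1 + fibre_metric E (\<sigma> x) (\<sigma> x)) powr p *
       (conn_norm_sq E \<sigma> x + q * grad_norm_sq E (half_norm_sq E \<sigma>) x))"

definition smooth_variation ::
  "('m, 'n::finite, 'e, 'r::finite) metric_bundle \<Rightarrow> ('m \<Rightarrow> 'e) \<Rightarrow> (real \<Rightarrow> 'm \<Rightarrow> 'e) \<Rightarrow> bool" where
  "smooth_variation E \<sigma> s \<longleftrightarrow> s 0 = \<sigma> \<and>
     (\<exists>\<epsilon>>0. (\<forall>t\<in>{-\<epsilon><..<\<epsilon>}. \<forall>x. proj E (s t x) = x) \<and>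
        (\<forall>c\<in>atlas E. \<forall>b\<in>trivs E. smooth_on
           (\<lambda>(t, y). snd b (s t (chart_inv c y)))
           ({-\<epsilon><..<\<epsilon>} \<times> snd c ` (fst c \<inter> fst b))))"

definition harmonic_section ::
  "('m, 'n::finite, 'e, 'r::finite) metric_bundle \<Rightarrow> 'm measure \<Rightarrow> real \<Rightarrow> real \<Rightarrow>
   ('m \<Rightarrow> 'e) \<Rightarrow> bool" where
  "harmonic_section E vol p q \<sigma> \<longleftrightarrow> smooth_section E \<sigma> \<and>
     (\<forall>s. smooth_variation E \<sigma> s \<longrightarrow>
        ((\<lambda>t. vertical_energy E vol p q (s t)) has_real_derivative 0) (at 0))"

definition section_sup_norm :: "('m, 'n::finite, 'e, 'r::finite) metric_bundle \<Rightarrow> ('m \<Rightarrow> 'e) \<Rightarrow> real" where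
  "section_sup_norm E \<sigma> = (SUP x. sqrt (fibre_metric E (\<sigma> x) (\<sigma> x)))"

end

theory Submission
  imports Defs
begin

text \<open>
  Put \<open>u = |\<sigma>|\<^sup>2\<close>. The variation \<open>(1 + t (1 + u)\<^sup>a) \<sigma>\<close> turns harmonicity into
  the integral identity
  \<open>\<integral> (1 + u)\<^bsup>a - p - 1\<^esup> (|\<nabla>\<sigma>|\<^sup>2 (1 + (1 - p) u) + |\<nabla>F|\<^sup>2 (2 a + 2 q + q (2 + 2 a - p) u)) = 0\<close>,
  valid for every real \<open>a\<close>. If the coefficient of \<open>|\<nabla>\<sigma>|\<^sup>2\<close> is nonnegative and that
  of \<open>|\<nabla>F|\<^sup>2\<close> positive, then \<open>\<nabla>F = 0\<close>. For \<open>p \<le> 1\<close> and \<open>q \<ge> 0\<close> this happens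
  with \<open>a = 1\<close>, so that \<open>q < 0\<close>, which also covers (a); under the bound on \<open>\<sigma>\<close> in (c) and (d) it
  happens with \<open>a = p / 2\<close> when the asserted inequality for \<open>q\<close> fails. With \<open>a = p / 2\<close> the
  coefficient of \<open>q |\<nabla>F|\<^sup>2\<close> is \<open>2 (1 + u)\<close>, so subtracting the identities for two different
  values of \<open>q\<close> gives \<open>\<nabla>F = 0\<close> as well. But \<open>\<nabla>F = 0\<close> makes \<open>|\<sigma>|\<close> a constant, which is nonzero
  since \<open>\<sigma>\<close> is non-trivial; the homotopy \<open>t \<sigma>\<close> from the zero section to the nowhere
  vanishing \<open>\<sigma>\<close> then shows that the Euler class is zero.
\<close>

section \<open>Homotopy invariance of singular cohomology\<close>

text \<open>The variation is inserted into the energy itself. Multiplying \<sigma> by a function of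
  \<open>u\<close> produces, by the product rule and metric compatibility, only the two densities of
  \<nabla>\<sigma> and \<nabla>F with coefficients in \<open>u\<close>; so differentiation under the
  integral replaces the Euler-Lagrange equation and the divergence theorem. The free exponent
  \<open>a\<close> moves weight onto the gradient term and leaves \<open>1 + (1 - p) u\<close>
  untouched. For \<open>p > 1\<close> that coefficient is nonnegative exactly where
  \<open>|\<sigma>| \<le> 1 / sqrt (p - 1)\<close>, the origin of the bound in (c) and (d).

  A vanishing integral controls its integrand only almost everywhere. Reaching every point takes
  continuity of both densities, although the frames defining them are chosen pointwise, and positive
  volume of nonempty open sets.

  The Thom cocycle vanishes as a cochain on simplices off the zero section, so a nowhere zero
  section pulls it back to the zero cochain; what is missing is a chain homotopy between the two
  ends of the homotopy.\<close>

lemma cochain_eval_0 [simp]: "cochain_eval u 0 = 0"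
  by (simp add: cochain_eval_def)

lemma cochain_eval_of [simp]: "cochain_eval u (frag_of s) = u s"
  by (simp add: cochain_eval_def)

text \<open>Adding chains may cancel simplices, so the key sets of summands and sum differ. Summing
  over one common finite set makes evaluation visibly additive.\<close>

lemma cochain_eval_superset:
  assumes "finite S" "Poly_Mapping.keys a \<subseteq> S"
  shows "cochain_eval u a = (\<Sum>s\<in>S. poly_mapping.lookup a s * u s)"
  unfolding cochain_eval_def
  by (rule sum.mono_neutral_left) (use assms in \<open>auto simp: in_keys_iff\<close>)

lemma cochain_eval_add: "cochain_eval u (a + b) = cochain_eval u a + cochain_eval u b"
proof -
  let ?S = "Poly_Mapping.keys a \<union> Poly_Mapping.keys b"
  show ?thesis
    using keys_add[of a b]
    by (simp add: cochain_eval_superset[of ?S] lookup_add algebra_simps sum.distrib)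
qed

lemma cochain_eval_cmul: "cochain_eval u (frag_cmul k a) = k * cochain_eval u a"
  using cochain_eval_superset[OF _ keys_cmul, of a u k]
  by (simp add: cochain_eval_def sum_distrib_left mult.assoc)

lemma cochain_eval_uminus: "cochain_eval u (- a) = - cochain_eval u a"
  using cochain_eval_cmul[of u "-1" a] by simp

lemma cochain_eval_diff: "cochain_eval u (a - b) = cochain_eval u a - cochain_eval u b"
  using cochain_eval_add[of u a "- b"] by (simp add: cochain_eval_uminus)

lemma cochain_eval_add_cochain:
  "cochain_eval (\<lambda>s. u s + v s) a = cochain_eval u a + cochain_eval v a"
  by (simp add: cochain_eval_def algebra_simps sum.distrib)

lemma cochain_eval_uminus_cochain: "cochain_eval (\<lambda>s. - u s) a = - cochain_eval u a"
  by (simp add: cochain_eval_def sum_negf)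

text \<open>The coboundary is given by its values on single simplices; induction over the free
  abelian group carries its vanishing to all chains.\<close>

lemma coboundary_eval:
  assumes "cochain_coboundary p X u = (\<lambda>s. 0)" "singular_chain (Suc p) X c"
  shows "cochain_eval u (chain_boundary (Suc p) c) = 0"
  using assms(2) unfolding singular_chain_def
proof (induction c rule: frag_induction)
  case (one s)
  then show ?case using fun_cong[OF assms(1), of s] by (simp add: cochain_coboundary_def)
next
  case (diff a b)
  then show ?case by (simp add: chain_boundary_diff cochain_eval_diff)
qed simp

lemma chain_map_comp: "chain_map p (h \<circ> g) c = chain_map p h (chain_map p g c)"
  by (simp add: chain_map_compose)

text \<open>The contraction makes a cycle homologous to its image in a one-point space, where every
  cycle of positive degree bounds. A point is a cycle of degree 0 that bounds nothing, hence
  \<open>1 \<le> p\<close>.\<close>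

lemma contractible_cycle_imp_boundary:
  assumes X: "contractible_space X" and c: "singular_relcycle p X {} c" and p: "1 \<le> p"
  shows "singular_relboundary p X {} c"
proof -
  obtain a where hom: "homotopic_with (\<lambda>h. h \<in> {} \<rightarrow> {}) X X id (\<lambda>x. a)"
    using X by (auto simp: contractible_space_def)
  have cont: "continuous_map X X (\<lambda>x. a)"
    using homotopic_with_imp_continuous_maps[OF hom] by blast
  show ?thesis
  \<comment> \<open>In the empty space the centre \<open>a\<close> need not be a point of
    \<open>X\<close>, but there the only chain is 0.\<close>
  proof (cases "topspace X = {}")
    case True
    with c show ?thesis by (auto simp: singular_cycle singular_chain_empty)
  next
    case False
    then have a: "a \<in> topspace X" using cont by (auto simp: continuous_map_def)
    have "homologous_rel p X {} (chain_map p id c) (chain_map p (\<lambda>x. a) c)"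
      by (rule homotopic_imp_homologous_rel_chain_maps[OF hom c])
    moreover have "singular_relcycle p (subtopology X {a}) {} (chain_map p (\<lambda>x. a) c)"
      by (rule singular_relcycle_chain_map[OF c]) (use a in \<open>auto simp: continuous_map_in_subtopology\<close>)
    then have "singular_relboundary p (subtopology X {a}) {} (chain_map p (\<lambda>x. a) c)"
      using singular_boundary_eq_cycle_singleton[of "subtopology X {a}" a p] a p by auto
    then have "singular_relboundary p X {} (chain_map p (\<lambda>x. a) c)"
      by (auto simp: singular_boundary singular_chain_subtopology)
    ultimately have "singular_relboundary p X {} (chain_map p id c)"
      using singular_relboundary_add[of p X "{}" "chain_map p id c - chain_map p (\<lambda>x. a) c" "chain_map p (\<lambda>x. a) c"]
      by (simp add: homologous_rel_def)
    then show ?thesis using c using chain_map_ident[of p X c] by (simp add: singular_cycle)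
  qed
qed

section \<open>The prism operator, built on the universal simplices\<close>

text \<open>The universal simplex: every singular simplex \<open>m\<close> is the image of this one
  under \<open>m\<close> itself. The restriction is there because singular simplices are extensional
  functions.\<close>

definition id_simplex :: "nat \<Rightarrow> (nat \<Rightarrow> real) \<Rightarrow> nat \<Rightarrow> real" where
  "id_simplex q = restrict id (standard_simplex q)"

definition simplex_top :: "nat \<Rightarrow> (nat \<Rightarrow> real) topology" where
  "simplex_top q = subtopology (powertop_real UNIV) (standard_simplex q)"

text \<open>Time is the first coordinate, in agreement with \<open>homotopic_with\<close>.\<close>

definition cylinder :: "'a topology \<Rightarrow> (real \<times> 'a) topology" where
  "cylinder X = prod_topology (top_of_set {0..1::real}) X"

text \<open>Acyclic models: a natural chain homotopy between the two ends of a cylinder is determined by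
  its values \<open>P q\<close> on the identity simplices, and since cylinders over simplices are
  contractible, these can be found by recursion on \<open>q\<close>. Homology classes alone would not do here,
  since an integral cocycle that vanishes on all cycles need not be a coboundary.\<close>

definition prism_extend ::
  "nat \<Rightarrow> (nat \<Rightarrow> (real \<times> (nat \<Rightarrow> real)) chain) \<Rightarrow> 'a chain \<Rightarrow> (real \<times> 'a) chain" where
  "prism_extend q P = frag_extend (\<lambda>m. chain_map (Suc q) (map_prod id m) (P q))"

definition prism_faces ::
  "nat \<Rightarrow> (nat \<Rightarrow> (real \<times> (nat \<Rightarrow> real)) chain) \<Rightarrow> 'a chain \<Rightarrow> (real \<times> 'a) chain" where
  "prism_faces q P c = (if q = 0 then 0 else prism_extend (q - 1) P (chain_boundary q c))"

text \<open>The chain homotopy equation, boundary of prism = top - bottom - walls, demanded on the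
  universal simplex only. It involves just \<open>P q\<close> and \<open>P (q - 1)\<close>, which
  makes a recursion on \<open>q\<close> possible.\<close>

definition prism_step :: "nat \<Rightarrow> (nat \<Rightarrow> (real \<times> (nat \<Rightarrow> real)) chain) \<Rightarrow> bool" where
  "prism_step q P \<longleftrightarrow> singular_chain (Suc q) (cylinder (simplex_top q)) (P q) \<and>
     chain_boundary (Suc q) (P q) =
       chain_map q (Pair 1) (frag_of (id_simplex q)) - chain_map q (Pair 0) (frag_of (id_simplex q)) -
       prism_faces q P (frag_of (id_simplex q))"

lemma singular_id_simplex: "singular_simplex q (simplex_top q) (id_simplex q)"
  by (auto simp: singular_simplex_def id_simplex_def simplex_top_def continuous_map_in_subtopology
      intro: continuous_map_eq[OF continuous_map_from_subtopology[OF continuous_map_id]])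

lemma continuous_map_Pair_cylinder:
  "t \<in> {0..1} \<Longrightarrow> continuous_map X (cylinder X) (Pair t)"
  by (simp add: cylinder_def continuous_map_pairwise o_def)

lemma continuous_map_cylinder:
  "continuous_map X Y m \<Longrightarrow> continuous_map (cylinder X) (cylinder Y) (map_prod id m)"
  unfolding cylinder_def
  by (auto simp: continuous_map_pairwise o_def map_prod_def split_def
      intro: continuous_map_fst continuous_map_compose[OF continuous_map_snd, unfolded o_def])

lemma singular_simplex_continuous: "singular_simplex q X s \<Longrightarrow> continuous_map (simplex_top q) X s"
  by (simp add: singular_simplex_def simplex_top_def)

lemma prism_extend_chain:
  assumes "prism_step q P" "singular_chain q X c"
  shows "singular_chain (Suc q) (cylinder X) (prism_extend q P c)"
  unfolding prism_extend_def
proof (rule singular_chain_extend)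
  fix m assume "m \<in> Poly_Mapping.keys c"
  then have "singular_simplex q X m" using assms(2) by (auto simp: singular_chain_def)
  then show "singular_chain (Suc q) (cylinder X) (chain_map (Suc q) (map_prod id m) (P q))"
    using assms(1) unfolding prism_step_def
    by (meson singular_chain_chain_map continuous_map_cylinder singular_simplex_continuous)
qed

lemma prism_extend_chain_map:
  assumes "prism_step q P" "singular_chain q X c"
  shows "prism_extend q P (chain_map q f c) = chain_map (Suc q) (map_prod id f) (prism_extend q P c)"
  using assms(2) unfolding singular_chain_def
proof (induction c rule: frag_induction)
  case (one m)
  have "chain_map (Suc q) (map_prod id (simplex_map q f m)) (P q) =
        chain_map (Suc q) (map_prod id f \<circ> map_prod id m) (P q)"
  \<comment> \<open>\<open>simplex_map q f m\<close> is a composition restricted to the standard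
    simplex, so the two maps are compared on the cylinder only.\<close>
  proof (rule chain_map_eq)
    show "singular_chain (Suc q) (cylinder (simplex_top q)) (P q)"
      using assms(1) by (simp add: prism_step_def)
  qed (auto simp: cylinder_def simplex_top_def simplex_map_def)
  then show ?case by (simp only: prism_extend_def chain_map_of frag_extend_of chain_map_comp)
next
  case (diff a b)
  then show ?case by (simp add: prism_extend_def chain_map_diff frag_extend_diff)
qed (simp add: prism_extend_def)

lemma simplex_map_id_simplex: "singular_simplex q X m \<Longrightarrow> simplex_map q m (id_simplex q) = m"
  by (auto simp: simplex_map_def id_simplex_def singular_simplex_def fun_eq_iff extensional_def restrict_def)

lemma chain_boundary_simplex:
  assumes "singular_simplex q X m"
  shows "chain_boundary q (frag_of m) = chain_map (q-1) m (chain_boundary q (frag_of (id_simplex q)))"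
proof -
  have "frag_of m = chain_map q m (frag_of (id_simplex q))"
    by (simp add: simplex_map_id_simplex[OF assms])
  then show ?thesis
    using chain_boundary_chain_map[of q "simplex_top q" "frag_of (id_simplex q)" m]
    by (simp add: singular_chain_of singular_id_simplex)
qed

text \<open>For a simplex \<open>m\<close> the equation is the image of the universal one under
  \<open>map_prod id m\<close>: both ends and the walls are natural in \<open>m\<close>. Linearity
  does the rest.\<close>

lemma prism_boundary:
  assumes "\<And>i. i \<le> q \<Longrightarrow> prism_step i P" "singular_chain q X c"
  shows "chain_boundary (Suc q) (prism_extend q P c) =
     chain_map q (Pair 1) c - chain_map q (Pair 0) c - prism_faces q P c"
  using assms(2) unfolding singular_chain_def
proof (induction c rule: frag_induction)
  case (one m)
  then have m: "singular_simplex q X m" by simp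
  have st: "prism_step q P" using assms(1) by simp
  have e: "chain_map q (Pair t) (frag_of m) =
     chain_map q (map_prod id m) (chain_map q (Pair t) (frag_of (id_simplex q)))" for t :: real
  proof -
    have "chain_map q (Pair t) (frag_of m) = chain_map q (Pair t) (chain_map q m (frag_of (id_simplex q)))"
      by (simp add: simplex_map_id_simplex[OF m])
    also have "\<dots> = chain_map q (Pair t \<circ> m) (frag_of (id_simplex q))"
      by (simp only: chain_map_comp)
    also have "Pair t \<circ> m = map_prod id m \<circ> Pair t" by (simp add: fun_eq_iff)
    finally show ?thesis unfolding chain_map_comp .
  qed
  have f: "prism_faces q P (frag_of m) =
     chain_map q (map_prod id m) (prism_faces q P (frag_of (id_simplex q)))"
  proof (cases "q = 0")
    case False
    have "singular_chain (q - 1) (simplex_top q) (chain_boundary q (frag_of (id_simplex q)))"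
      using singular_chain_boundary[of q "simplex_top q" "frag_of (id_simplex q)"]
      by (simp add: singular_chain_of singular_id_simplex)
    from prism_extend_chain_map[OF assms(1) this, of m] show ?thesis
      using False chain_boundary_simplex[OF m] by (simp add: prism_faces_def)
  qed (simp add: prism_faces_def)
  have "chain_boundary (Suc q) (prism_extend q P (frag_of m)) =
        chain_map q (map_prod id m) (chain_boundary (Suc q) (P q))"
    using st chain_boundary_chain_map[of "Suc q" "cylinder (simplex_top q)" "P q" "map_prod id m"]
    by (simp add: prism_extend_def prism_step_def)
  also have "\<dots> = chain_map q (Pair 1) (frag_of m) - chain_map q (Pair 0) (frag_of m) - prism_faces q P (frag_of m)"
    using st by (simp only: prism_step_def chain_map_diff e f)
  finally show ?case .
next
  case (diff a b)
  then show ?case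
    by (simp add: prism_extend_def prism_faces_def chain_map_diff frag_extend_diff chain_boundary_diff)
qed (simp_all add: prism_extend_def prism_faces_def)

lemma contractible_simplex_top: "contractible_space (simplex_top q)"
proof -
  \<comment> \<open>\<open>?a\<close> is the initial vertex of the simplex; \<open>?h\<close> runs
    to it along straight lines, which convexity keeps inside.\<close>
  let ?a = "\<lambda>j. if j = 0 then 1 else (0::real)"
  let ?h = "\<lambda>(t, x) i. (1 - t) * x i + t * ?a i"
  have "homotopic_with (\<lambda>h. True) (simplex_top q) (simplex_top q) id (\<lambda>x. ?a)"
    unfolding homotopic_with_def
  proof (intro exI conjI allI ballI)
    show "continuous_map (prod_topology (top_of_set {0..1::real}) (simplex_top q)) (simplex_top q) ?h"
      unfolding simplex_top_def continuous_map_in_subtopology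
    proof
      have 1: "continuous_map (prod_topology (top_of_set {0..1::real}) (simplex_top q)) euclideanreal fst"
        using continuous_map_fst[of "top_of_set {0..1::real}" "simplex_top q"]
        by (simp add: continuous_map_in_subtopology)
      have 2: "continuous_map (prod_topology (top_of_set {0..1::real}) (simplex_top q)) euclideanreal (\<lambda>z. snd z i)" for i
        using continuous_map_snd[of "top_of_set {0..1::real}" "simplex_top q"]
        by (simp add: simplex_top_def continuous_map_in_subtopology continuous_map_componentwise_UNIV)
      have "continuous_map (prod_topology (top_of_set {0..1::real}) (simplex_top q)) euclideanreal
             (\<lambda>z. (1 - fst z) * snd z i + fst z * ?a i)" for i
        by (intro continuous_map_add continuous_map_real_mult continuous_map_diff 1 2) auto
      then show "continuous_map (prod_topology (top_of_set {0..1::real}) (subtopology (powertop_real UNIV) (standard_simplex q))) (powertop_real UNIV) ?h"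
        by (simp add: simplex_top_def continuous_map_componentwise_UNIV split_def)
      show "?h \<in> topspace (prod_topology (top_of_set {0..1::real}) (subtopology (powertop_real UNIV) (standard_simplex q))) \<rightarrow> standard_simplex q"
        using convex_standard_simplex[of _ q ?a] by auto
    qed
  qed auto
  then show ?thesis unfolding contractible_space_def by blast
qed

lemma contractible_cylinder: "contractible_space X \<Longrightarrow> contractible_space (cylinder X)"
  by (simp add: cylinder_def contractible_space_prod_topology convex_imp_contractible)

text \<open>The right-hand side of the equation in degree \<open>q\<close> is a cycle by the
  equation one degree lower, and a cycle of positive degree in the contractible cylinder bounds. Any
  chain with that boundary serves as the next value of \<open>P\<close>.\<close>

lemma prism_exists: "\<exists>P. \<forall>q. prism_step q P"
proof -
  have step: "\<exists>x. prism_step q (P(q := x))" if P: "\<And>i. i < q \<Longrightarrow> prism_step i P" for q P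
  proof -
    let ?i = "frag_of (id_simplex q)" and ?X = "simplex_top q"
    let ?Y = "cylinder (simplex_top q)"
    let ?z = "chain_map q (Pair 1) ?i - chain_map q (Pair 0) ?i - prism_faces q P ?i"
    have i: "singular_chain q ?X ?i" by (simp add: singular_chain_of singular_id_simplex)
    have bi: "singular_chain (q - 1) ?X (chain_boundary q ?i)"
      using singular_chain_boundary[OF i] by simp
    have c1: "singular_chain q ?Y (chain_map q (Pair 1) ?i)" "singular_chain q ?Y (chain_map q (Pair 0) ?i)"
      by (rule singular_chain_chain_map[OF i], simp add: continuous_map_Pair_cylinder)+
    have "singular_relboundary q ?Y {} ?z"
    proof (cases "q = 0")
      case True
      \<comment> \<open>Degree 0 has no walls, and contractibility alone is not enough for a 0-cycle
        to bound. The two ends are homologous because one slides into the other; time runs as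
        \<open>1 - t\<close> since the slide starts at the top.\<close>
      have "homotopic_with (\<lambda>h. h \<in> {} \<rightarrow> {}) ?X ?Y (Pair 1) (Pair 0)"
        unfolding homotopic_with_def
      proof (intro exI conjI allI ballI)
        let ?h = "\<lambda>(t, x). (1 - t, x)"
        have 1: "continuous_map (prod_topology (top_of_set {0..1::real}) ?X) euclideanreal fst"
          using continuous_map_fst[of "top_of_set {0..1::real}" ?X]
          by (simp add: continuous_map_in_subtopology)
        have "continuous_map (prod_topology (top_of_set {0..1::real}) ?X) euclideanreal (\<lambda>z. 1 - fst z)"
          by (intro continuous_map_diff 1) auto
        then have "continuous_map (prod_topology (top_of_set {0..1::real}) ?X) (top_of_set {0..1::real}) (\<lambda>z. 1 - fst z)"
          by (auto simp: continuous_map_in_subtopology)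
        then show "continuous_map (prod_topology (top_of_set {0..1::real}) ?X) ?Y ?h"
          by (simp add: cylinder_def continuous_map_pairwise o_def split_def continuous_map_snd)
      qed auto
      moreover have "singular_relcycle q ?X {} ?i" using True i by (simp add: singular_cycle chain_boundary_def)
      ultimately have "homologous_rel q ?Y {} (chain_map q (Pair 1) ?i) (chain_map q (Pair 0) ?i)"
        by (rule homotopic_imp_homologous_rel_chain_maps)
      then show ?thesis using True by (simp add: homologous_rel_def prism_faces_def)
    next
      case False
      then obtain k where k: "q = Suc k" by (cases q) auto
      have Pk: "prism_step k P" using P k by simp
      have faces: "prism_faces q P ?i = prism_extend k P (chain_boundary q ?i)"
        by (simp add: prism_faces_def k)
      have c3: "singular_chain q ?Y (prism_faces q P ?i)"
        using prism_extend_chain[OF Pk, of ?X "chain_boundary q ?i"] bi unfolding faces by (simp add: k)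
      \<comment> \<open>The walls over the boundary of a boundary vanish, so the boundary of the
        walls is the difference of the two ends over the boundary, which cancels against the
        boundaries of top and bottom.\<close>
      have "prism_faces k P (chain_boundary q ?i) = 0"
        using chain_boundary_boundary[OF i] k by (cases k) (auto simp: prism_faces_def prism_extend_def)
      then have "chain_boundary q (prism_faces q P ?i) =
        chain_map k (Pair 1) (chain_boundary q ?i) - chain_map k (Pair 0) (chain_boundary q ?i)"
        using prism_boundary[of k P ?X "chain_boundary q ?i"] P bi unfolding faces by (simp add: k)
      moreover have "chain_boundary q (chain_map q (Pair t) ?i) = chain_map k (Pair t) (chain_boundary q ?i)" for t :: real
        using chain_boundary_chain_map[OF i, of "Pair t"] k by simp
      ultimately have "chain_boundary q ?z = 0"
        by (simp add: chain_boundary_diff)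
      then have "singular_relcycle q ?Y {} ?z"
        using c1 c3 by (simp add: singular_cycle singular_chain_diff)
      then show ?thesis
        using contractible_cycle_imp_boundary contractible_cylinder[OF contractible_simplex_top] False
        by (metis One_nat_def Suc_leI bot_nat_0.not_eq_extremum)
    qed
    then obtain x where "singular_chain (Suc q) ?Y x" "chain_boundary (Suc q) x = ?z"
      by (auto simp: singular_boundary)
    moreover have "prism_faces q (P(q := x)) ?i = prism_faces q P ?i"
      by (auto simp: prism_faces_def prism_extend_def)
    ultimately show ?thesis by (auto simp: prism_step_def)
  qed
  have cong: "prism_step q P = prism_step q P'" if "\<And>i. i \<le> q \<Longrightarrow> P i = P' i" for q P P'
    using that by (simp add: prism_step_def prism_faces_def prism_extend_def)
  \<comment> \<open>The recursion passes \<open>cut P less_than q\<close>, which is arbitrary from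
    \<open>q\<close> on. This is harmless: the value at \<open>q\<close> is overwritten, and
    \<open>prism_step q\<close> reads no value beyond \<open>q\<close>.\<close>
  define F where "F = (\<lambda>(f :: nat \<Rightarrow> (real \<times> (nat \<Rightarrow> real)) chain) q. SOME x. prism_step q (f(q := x)))"
  define P where "P = wfrec less_than F"
  have "prism_step q P" for q
  proof (induction q rule: less_induct)
    case (less q)
    have "P q = F (cut P less_than q) q" unfolding P_def by (rule wfrec) simp
    moreover have "\<exists>x. prism_step q ((cut P less_than q)(q := x))"
    proof (rule step)
      fix i assume "i < q"
      then show "prism_step i (cut P less_than q)"
        using less cong[of i P "cut P less_than q"] by (simp add: cut_def)
    qed
    ultimately have "prism_step q ((cut P less_than q)(q := P q))"
      unfolding F_def by (metis (mono_tags, lifting) someI_ex)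
    then show ?case using cong[of q P "(cut P less_than q)(q := P q)"] by (auto simp: cut_def)
  qed
  then show ?thesis by blast
qed

section \<open>Homotopic maps and relative cocycles\<close>

text \<open>The cocycle \<open>u\<close> vanishes on the boundary of the image under
  \<open>h\<close> of the prism over \<open>s\<close>, so its values on \<open>g s\<close>,
  \<open>f s\<close> and the walls are related. The value on \<open>g s\<close> is 0 because that
  simplex lies in \<open>S\<close>, and the walls express the value on \<open>f s\<close> through
  the boundary of \<open>s\<close>.\<close>

lemma cochain_pullback_homotopic:
  assumes hom: "homotopic_with (\<lambda>h. True) X Y f g"
    and u: "u \<in> cocycles (Suc k) Y S"
    and g: "g ` topspace X \<subseteq> S"
  shows "cochain_pullback (Suc k) X f u \<in> coboundaries (Suc k) X {}"
proof -
  obtain h where conth: "continuous_map (prod_topology (top_of_set {0..1::real}) X) Y h"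
    and h0: "\<And>x. h (0, x) = f x" and h1: "\<And>x. h (1, x) = g x"
    using hom by (fastforce simp: homotopic_with_def)
  have h: "continuous_map (cylinder X) Y h" using conth by (simp add: cylinder_def)
  have contg: "continuous_map X Y g" using homotopic_with_imp_continuous_maps[OF hom] by blast
  obtain P where P: "\<And>q. prism_step q P" using prism_exists by blast
  \<comment> \<open>The minus sign compensates the two negative terms \<open>f s\<close> and walls
    in the boundary of the prism.\<close>
  define \<psi> where "\<psi> = (\<lambda>s. if singular_simplex k X s
     then - cochain_eval u (chain_map (Suc k) h (prism_extend k P (frag_of s))) else 0)"
  have psi: "cochain_eval \<psi> c = - cochain_eval u (chain_map (Suc k) h (prism_extend k P c))"
    if "singular_chain k X c" for c
    using that unfolding singular_chain_def
  proof (induction c rule: frag_induction)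
    case (diff a b)
    then show ?case by (simp add: prism_extend_def frag_extend_diff chain_map_diff cochain_eval_diff)
  qed (simp_all add: \<psi>_def prism_extend_def)
  have eq: "u (simplex_map (Suc k) f s) = cochain_eval \<psi> (chain_boundary (Suc k) (frag_of s))"
    if s: "singular_simplex (Suc k) X s" for s
  proof -
    have sc: "singular_chain (Suc k) X (frag_of s)" using s by (simp add: singular_chain_of)
    have bsc: "singular_chain k X (chain_boundary (Suc k) (frag_of s))"
      using singular_chain_boundary[OF sc] by simp
    define C where "C = prism_extend (Suc k) P (frag_of s)"
    have C: "singular_chain (Suc (Suc k)) (cylinder X) C"
      unfolding C_def by (rule prism_extend_chain[OF P sc])
    have "cochain_eval u (chain_boundary (Suc (Suc k)) (chain_map (Suc (Suc k)) h C)) = 0"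
    proof (rule coboundary_eval)
      show "cochain_coboundary (Suc k) Y u = (\<lambda>s. 0)" using u by (simp add: cocycles_def)
      show "singular_chain (Suc (Suc k)) Y (chain_map (Suc (Suc k)) h C)"
        by (rule singular_chain_chain_map[OF C h])
    qed
    moreover have "chain_boundary (Suc (Suc k)) (chain_map (Suc (Suc k)) h C) =
        chain_map (Suc k) (h \<circ> Pair 1) (frag_of s) - chain_map (Suc k) (h \<circ> Pair 0) (frag_of s) -
        chain_map (Suc k) h (prism_extend k P (chain_boundary (Suc k) (frag_of s)))"
      using chain_boundary_chain_map[OF C, of h] prism_boundary[OF P sc]
      by (simp add: C_def chain_map_diff chain_map_comp prism_faces_def del: chain_map_of)
    moreover have "h \<circ> Pair 1 = g" "h \<circ> Pair 0 = f" by (auto simp: h0 h1)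
    moreover have "u (simplex_map (Suc k) g s) = 0"
    proof -
      have "singular_simplex (Suc k) (subtopology Y S) (simplex_map (Suc k) g s)"
        using s contg g by (auto intro!: singular_simplex_simplex_map[of _ X] simp: continuous_map_in_subtopology image_subset_iff)
      then show ?thesis using u by (auto simp: cocycles_def cochains_def)
    qed
    ultimately show ?thesis using psi[OF bsc] by (simp add: cochain_eval_diff)
  qed
  have "\<psi> \<in> cochains k X {}"
    by (auto simp: cochains_def \<psi>_def singular_simplex_empty)
  moreover have "cochain_pullback (Suc k) X f u = cochain_coboundary k X \<psi>"
    using eq by (auto simp: fun_eq_iff cochain_pullback_def cochain_coboundary_def)
  ultimately show ?thesis by (auto simp: coboundaries_def)
qed

text \<open>The neutral element of a quotient group is the subgroup itself, so the claim is that the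
  coboundaries coincide with their translate by \<open>c\<close>. Closure under sums and negatives
  gives both inclusions.\<close>

lemma cohomology_class_coboundary:
  assumes "c \<in> coboundaries (Suc k) X S"
  shows "cohomology_class (Suc k) X S c = \<one>\<^bsub>relative_cohomology_group (Suc k) X S\<^esub>"
proof -
  have add: "cochain_coboundary k X (\<lambda>s. \<phi> s + \<psi> s) = (\<lambda>s. cochain_coboundary k X \<phi> s + cochain_coboundary k X \<psi> s)"
    and min: "cochain_coboundary k X (\<lambda>s. - \<phi> s) = (\<lambda>s. - cochain_coboundary k X \<phi> s)" for \<phi> \<psi>
    by (auto simp: cochain_coboundary_def cochain_eval_add_cochain cochain_eval_uminus_cochain)
  have closed: "(\<lambda>s. a s + b s) \<in> coboundaries (Suc k) X S" "(\<lambda>s. - a s) \<in> coboundaries (Suc k) X S"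
    if ab: "a \<in> coboundaries (Suc k) X S" "b \<in> coboundaries (Suc k) X S" for a b
  proof -
    obtain \<phi> \<psi> where *: "\<phi> \<in> cochains k X S" "a = cochain_coboundary k X \<phi>"
      "\<psi> \<in> cochains k X S" "b = cochain_coboundary k X \<psi>"
      using ab by (auto simp: coboundaries_def)
    have "(\<lambda>s. \<phi> s + \<psi> s) \<in> cochains k X S" "(\<lambda>s. - \<phi> s) \<in> cochains k X S"
      using * by (auto simp: cochains_def)
    then show "(\<lambda>s. a s + b s) \<in> coboundaries (Suc k) X S" "(\<lambda>s. - a s) \<in> coboundaries (Suc k) X S"
      by (auto simp: coboundaries_def * simp flip: add min)
  qed
  have "h \<in> coboundaries (Suc k) X S \<longleftrightarrow> (\<exists>a\<in>coboundaries (Suc k) X S. h = (\<lambda>s. a s + c s))" for h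
  proof
    assume h: "h \<in> coboundaries (Suc k) X S"
    have "(\<lambda>s. h s + - c s) \<in> coboundaries (Suc k) X S" by (rule closed(1)[OF h closed(2)[OF assms h]])
    then show "\<exists>a\<in>coboundaries (Suc k) X S. h = (\<lambda>s. a s + c s)"
      by (intro bexI[of _ "\<lambda>s. h s + - c s"]) auto
  next
    assume "\<exists>a\<in>coboundaries (Suc k) X S. h = (\<lambda>s. a s + c s)"
    then show "h \<in> coboundaries (Suc k) X S" using closed(1)[OF _ assms] by auto
  qed
  then have "coboundaries (Suc k) X S = (\<Union>a\<in>coboundaries (Suc k) X S. {\<lambda>s. a s + c s})"
    by blast
  then show ?thesis
    by (simp add: cohomology_class_def relative_cohomology_group_def FactGroup_def r_coset_def cocycle_group_def)
qed

section \<open>Smooth functions\<close>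

text \<open>Openness of \<open>S\<close> matters because the derivative at a point sees a whole
  neighbourhood, while \<open>f\<close> and \<open>g\<close> agree on \<open>S\<close> only.\<close>

lemma Ck_on_cong:
  assumes "open S" "\<And>x. x \<in> S \<Longrightarrow> f x = g x" "Ck_on k f S"
  shows "Ck_on k g S"
  using assms(2,3)
proof (induction k arbitrary: f g)
  case 0
  then show ?case by (simp cong: continuous_on_cong)
next
  case (Suc k)
  have D: "(g has_derivative frechet_derivative f (at x)) (at x)" if "x \<in> S" for x
  proof -
    have "(f has_derivative frechet_derivative f (at x)) (at x)"
      using Suc.prems(2) that by (simp add: frechet_derivative_works)
    then show ?thesis
      by (rule has_derivative_transform_within_open[OF _ \<open>open S\<close> that]) (simp add: Suc.prems(1))
  qed
  then have "frechet_derivative f (at x) = frechet_derivative g (at x)" if "x \<in> S" for x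
    using that frechet_derivative_at by blast
  then have "Ck_on k (\<lambda>x. frechet_derivative g (at x) v) S" for v
    using Suc.IH[of "\<lambda>x. frechet_derivative f (at x) v" "\<lambda>x. frechet_derivative g (at x) v"] Suc.prems(2) by simp
  then show ?case using D by (auto simp: differentiable_def)
qed

lemma Ck_on_subset: "Ck_on k f S \<Longrightarrow> T \<subseteq> S \<Longrightarrow> Ck_on k f T"
proof (induction k arbitrary: f)
  case 0
  then show ?case by (simp add: continuous_on_subset)
next
  case (Suc k)
  then have "Ck_on k (\<lambda>x. frechet_derivative f (at x) v) T" for v by simp
  with Suc.prems show ?case by auto
qed

lemma Ck_on_UN:
  assumes "\<And>i. i \<in> I \<Longrightarrow> open (S i)" "\<And>i. i \<in> I \<Longrightarrow> Ck_on k f (S i)"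
  shows "Ck_on k f (\<Union>i\<in>I. S i)"
  using assms(2)
proof (induction k arbitrary: f)
  case 0
  then show ?case using assms(1) by (simp add: continuous_on_open_UN)
next
  case (Suc k)
  then show ?case by simp
qed

text \<open>Replaces the chosen \<open>frechet_derivative\<close> by an explicit derivative
  \<open>D\<close>; this is the induction step of the closure properties below.\<close>

lemma Ck_on_SucI:
  assumes "open S" "\<And>x. x \<in> S \<Longrightarrow> (f has_derivative D x) (at x)"
    and "\<And>v. Ck_on k (\<lambda>x. D x v) S"
  shows "Ck_on (Suc k) f S"
proof -
  have "frechet_derivative f (at x) = D x" if "x \<in> S" for x
    using assms(2)[OF that] frechet_derivative_at by metis
  then have "Ck_on k (\<lambda>x. frechet_derivative f (at x) v) S" for v
    by (intro Ck_on_cong[OF assms(1) _ assms(3)]) simp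
  then show ?thesis using assms(2) by (auto simp: differentiable_def)
qed

lemma Ck_on_Suc_has_derivative:
  "Ck_on (Suc k) f S \<Longrightarrow> x \<in> S \<Longrightarrow> (f has_derivative frechet_derivative f (at x)) (at x)"
  by (simp add: frechet_derivative_works)

text \<open>The recursive definition mentions continuity at its last stage only. In the product rule
  the undifferentiated factor has to be lowered by one order.\<close>

lemma Ck_on_Suc_imp: "Ck_on (Suc k) f S \<Longrightarrow> Ck_on k f S"
proof (induction k arbitrary: f)
  case 0
  then show ?case
    by (auto intro!: continuous_at_imp_continuous_on differentiable_imp_continuous_within)
next
  case (Suc k)
  have "Ck_on k (\<lambda>x. frechet_derivative f (at x) v) S" for v
    by (rule Suc.IH) (use Suc.prems in simp)
  then show ?case using Suc.prems by simp
qed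

lemma Ck_on_const: "open S \<Longrightarrow> Ck_on k (\<lambda>x. c) S"
proof (induction k arbitrary: c)
  case (Suc k)
  show ?case by (rule Ck_on_SucI[OF Suc.prems has_derivative_const Suc.IH[OF Suc.prems]])
qed simp

lemma Ck_on_bounded_linear: "bounded_linear L \<Longrightarrow> open S \<Longrightarrow> Ck_on k L S"
proof (cases k)
  case 0
  assume "bounded_linear L"
  then show ?thesis using 0 by (simp add: linear_continuous_on)
next
  case (Suc j)
  assume "bounded_linear L" "open S"
  then show ?thesis unfolding Suc
    by (intro Ck_on_SucI[of _ _ "\<lambda>x. L"] Ck_on_const bounded_linear_imp_has_derivative)
qed

lemma Ck_on_add: "open S \<Longrightarrow> Ck_on k f S \<Longrightarrow> Ck_on k g S \<Longrightarrow> Ck_on k (\<lambda>x. f x + g x) S"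
proof (induction k arbitrary: f g)
  case (Suc k)
  show ?case
  proof (rule Ck_on_SucI[OF Suc.prems(1)])
    fix x assume "x \<in> S"
    then show "((\<lambda>x. f x + g x) has_derivative
      (\<lambda>v. frechet_derivative f (at x) v + frechet_derivative g (at x) v)) (at x)"
      using Suc.prems by (intro has_derivative_add Ck_on_Suc_has_derivative)
  next
    fix v
    show "Ck_on k (\<lambda>x. frechet_derivative f (at x) v + frechet_derivative g (at x) v) S"
      using Suc.prems by (intro Suc.IH) auto
  qed
qed (auto intro: continuous_on_add)

lemma Ck_on_sum: "open S \<Longrightarrow> (\<And>i. i \<in> I \<Longrightarrow> Ck_on k (f i) S) \<Longrightarrow> Ck_on k (\<lambda>x. \<Sum>i\<in>I. f i x) S"
  by (induction I rule: infinite_finite_induct) (auto intro: Ck_on_const Ck_on_add)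

lemma Ck_on_bilinear:
  assumes "bounded_bilinear B" "open S"
  shows "Ck_on k f S \<Longrightarrow> Ck_on k g S \<Longrightarrow> Ck_on k (\<lambda>x. B (f x) (g x)) S"
proof (induction k arbitrary: f g)
  case 0
  then show ?case by (simp add: bounded_bilinear.continuous_on[OF assms(1)])
next
  case (Suc k)
  show ?case
  proof (rule Ck_on_SucI[OF assms(2)])
    fix x assume x: "x \<in> S"
    show "((\<lambda>x. B (f x) (g x)) has_derivative
      (\<lambda>v. B (f x) (frechet_derivative g (at x) v) + B (frechet_derivative f (at x) v) (g x))) (at x)"
      by (rule bounded_bilinear.FDERIV[OF assms(1)]) (rule Ck_on_Suc_has_derivative[OF Suc.prems(1) x] Ck_on_Suc_has_derivative[OF Suc.prems(2) x])+
  next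
    fix v
    show "Ck_on k (\<lambda>x. B (f x) (frechet_derivative g (at x) v) + B (frechet_derivative f (at x) v) (g x)) S"
      by (intro Ck_on_add[OF assms(2)] Suc.IH) (use Suc.prems Ck_on_Suc_imp[OF Suc.prems(1)] Ck_on_Suc_imp[OF Suc.prems(2)] in \<open>auto\<close>)
  qed
qed

lemma Ck_on_comp_linear:
  assumes "bounded_linear L" "open S"
  shows "Ck_on k f S \<Longrightarrow> Ck_on k (\<lambda>x. f (L x)) (L -` S)"
proof (induction k arbitrary: f)
  case 0
  then show ?case using linear_continuous_on[OF assms(1)]
    by (auto intro!: continuous_on_compose2[of S f])
next
  case (Suc k)
  have op: "open (L -` S)"
    using assms linear_continuous_on[OF assms(1), of UNIV] by (simp add: open_vimage)
  show ?case
  proof (rule Ck_on_SucI[OF op])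
    fix x assume "x \<in> L -` S"
    then show "((\<lambda>x. f (L x)) has_derivative (\<lambda>v. frechet_derivative f (at (L x)) (L v))) (at x)"
      using has_derivative_compose[OF bounded_linear_imp_has_derivative[OF assms(1), of "at x"]]
        Ck_on_Suc_has_derivative[OF Suc.prems] by blast
  next
    fix v
    show "Ck_on k (\<lambda>x. frechet_derivative f (at (L x)) (L v)) (L -` S)"
      using Suc.IH[of "\<lambda>x. frechet_derivative f (at x) (L v)"] Suc.prems by simp
  qed
qed

text \<open>The induction runs over all exponents at once, since differentiating turns
  \<open>a\<close> into \<open>a - 1\<close>.\<close>

lemma Ck_on_powr:
  fixes f :: "'a::real_normed_vector \<Rightarrow> real"
  assumes "open S" "\<And>x. x \<in> S \<Longrightarrow> f x > 0"
  shows "Ck_on k f S \<Longrightarrow> Ck_on k (\<lambda>x. f x powr a) S"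
proof (induction k arbitrary: a)
  case 0
  have "f x \<noteq> 0" if "x \<in> S" for x using assms(2)[OF that] by simp
  with 0 show ?case by (auto intro!: continuous_on_powr continuous_on_const)
next
  case (Suc k)
  show ?case
  proof (rule Ck_on_SucI[OF assms(1)])
    fix x assume x: "x \<in> S"
    have "((\<lambda>z. z powr a) has_derivative (*) (a * f x powr (a - 1))) (at (f x))"
      using has_real_derivative_powr[OF assms(2)[OF x], of a] by (simp add: has_field_derivative_def)
    from has_derivative_compose[OF Ck_on_Suc_has_derivative[OF Suc.prems x] this]
    show "((\<lambda>x. f x powr a) has_derivative (\<lambda>v. (a * f x powr (a - 1)) * frechet_derivative f (at x) v)) (at x)" .
  next
    fix v
    show "Ck_on k (\<lambda>x. (a * f x powr (a - 1)) * frechet_derivative f (at x) v) S"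
      using Suc.prems Ck_on_Suc_imp[OF Suc.prems]
      by (intro Ck_on_bilinear[OF bounded_bilinear_mult assms(1)] Ck_on_const Suc.IH assms) auto
  qed
qed

lemma smooth_on_cong: "open S \<Longrightarrow> smooth_on f S \<Longrightarrow> (\<And>x. x \<in> S \<Longrightarrow> f x = g x) \<Longrightarrow> smooth_on g S"
  unfolding smooth_on_def by (intro allI) (rule Ck_on_cong[of S f], auto)

lemma smooth_on_subset: "smooth_on f S \<Longrightarrow> T \<subseteq> S \<Longrightarrow> smooth_on f T"
  unfolding smooth_on_def by (rule allI, rule Ck_on_subset[of _ f S]) auto

lemma smooth_on_UN:
  "(\<And>i. i \<in> I \<Longrightarrow> open (S i)) \<Longrightarrow> (\<And>i. i \<in> I \<Longrightarrow> smooth_on f (S i)) \<Longrightarrow> smooth_on f (\<Union>i\<in>I. S i)"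
  unfolding smooth_on_def by (intro allI Ck_on_UN) auto

lemma smooth_on_const: "open S \<Longrightarrow> smooth_on (\<lambda>x. c) S"
  unfolding smooth_on_def by (intro allI Ck_on_const) auto

lemma smooth_on_bounded_linear: "bounded_linear L \<Longrightarrow> open S \<Longrightarrow> smooth_on L S"
  unfolding smooth_on_def by (intro allI Ck_on_bounded_linear) auto

lemma smooth_on_add: "open S \<Longrightarrow> smooth_on f S \<Longrightarrow> smooth_on g S \<Longrightarrow> smooth_on (\<lambda>x. f x + g x) S"
  unfolding smooth_on_def by (intro allI Ck_on_add) auto

lemma smooth_on_sum:
  "open S \<Longrightarrow> (\<And>i. i \<in> I \<Longrightarrow> smooth_on (f i) S) \<Longrightarrow> smooth_on (\<lambda>x. \<Sum>i\<in>I. f i x) S"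
  unfolding smooth_on_def by (intro allI Ck_on_sum) auto

lemma smooth_on_bilinear:
  "bounded_bilinear B \<Longrightarrow> open S \<Longrightarrow> smooth_on f S \<Longrightarrow> smooth_on g S \<Longrightarrow> smooth_on (\<lambda>x. B (f x) (g x)) S"
  unfolding smooth_on_def by (rule allI, rule Ck_on_bilinear) auto

lemmas smooth_on_mult = smooth_on_bilinear[OF bounded_bilinear_mult]
lemmas smooth_on_scaleR = smooth_on_bilinear[OF bounded_bilinear_scaleR]

lemma smooth_on_comp_linear:
  "bounded_linear L \<Longrightarrow> open S \<Longrightarrow> smooth_on f S \<Longrightarrow> smooth_on (\<lambda>x. f (L x)) (L -` S)"
  unfolding smooth_on_def by (rule allI, rule Ck_on_comp_linear) auto

lemma smooth_on_powr:
  fixes f :: "'a::real_normed_vector \<Rightarrow> real"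
  shows "open S \<Longrightarrow> (\<And>x. x \<in> S \<Longrightarrow> f x > 0) \<Longrightarrow> smooth_on f S \<Longrightarrow> smooth_on (\<lambda>x. f x powr a) S"
  unfolding smooth_on_def by (rule allI, rule Ck_on_powr) auto

lemma smooth_on_imp_continuous_on: "smooth_on f S \<Longrightarrow> continuous_on S f"
  using Ck_on.simps(1)[of f S] by (simp only: smooth_on_def)

lemma smooth_on_has_derivative:
  "smooth_on f S \<Longrightarrow> x \<in> S \<Longrightarrow> (f has_derivative frechet_derivative f (at x)) (at x)"
  by (rule Ck_on_Suc_has_derivative[of 0]) (simp_all only: smooth_on_def)

lemma smooth_on_component:
  fixes f :: "'a::real_normed_vector \<Rightarrow> real^'n"
  assumes "open S" "smooth_on f S"
  shows "smooth_on (\<lambda>x. f x $ i) S"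
proof -
  \<comment> \<open>Taking a component is made bilinear by an auxiliary scalar, which is then set to
    the constant 1; the product rule thus also covers linear maps applied on the outside.\<close>
  have "bounded_bilinear (\<lambda>(a::real) (x::real^'n). (a *\<^sub>R x) $ i)"
    using bounded_bilinear.comp[OF bounded_bilinear_mult bounded_linear_ident bounded_linear_vec_nth, of i]
    by simp
  from smooth_on_bilinear[OF this assms(1) smooth_on_const[OF assms(1), of 1] assms(2)]
  show ?thesis by simp
qed

section \<open>Inner products in coordinates\<close>

lemma linearI_combination:
  assumes "\<And>a b \<xi> \<eta>. f (a *\<^sub>R \<xi> + b *\<^sub>R \<eta>) = a *\<^sub>R f \<xi> + b *\<^sub>R f \<eta>"
  shows "linear f"
proof (rule linearI)
  show "f (\<xi> + \<eta>) = f \<xi> + f \<eta>" for \<xi> \<eta> using assms[of 1 \<xi> 1 \<eta>] by simp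
  show "f (a *\<^sub>R \<xi>) = a *\<^sub>R f \<xi>" for a \<xi> using assms[of a \<xi> 0 \<xi>] by simp
qed

lemma bilinear_expand:
  fixes B :: "real^'n \<Rightarrow> real^'m \<Rightarrow> real"
  assumes "bilinear B"
  shows "B x y = (\<Sum>i\<in>UNIV. \<Sum>j\<in>UNIV. x $ i * y $ j * B (axis i 1) (axis j 1))"
proof -
  have "B x y = B (\<Sum>i\<in>UNIV. x $ i *\<^sub>R axis i 1) (\<Sum>j\<in>UNIV. y $ j *\<^sub>R axis j 1)"
    using basis_expansion[of x] basis_expansion[of y] by (simp add: scalar_mult_eq_scaleR)
  also have "\<dots> = (\<Sum>(i, j)\<in>UNIV \<times> UNIV. B (x $ i *\<^sub>R axis i 1) (y $ j *\<^sub>R axis j 1))"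
    by (rule bilinear_sum[OF assms])
  finally show ?thesis
    by (simp add: bilinear_lmul[OF assms] bilinear_rmul[OF assms] sum.cartesian_product algebra_simps)
qed

section \<open>Inverse matrices with continuous entries\<close>

text \<open>Inverse matrix by Cramer's rule: as quotients of determinants, its entries inherit
  continuity from those of \<open>A\<close>.\<close>

definition cramer_inv :: "real^'n^'n \<Rightarrow> real^'n^'n" where
  "cramer_inv A = (\<chi> k l. det (\<chi> i j. if j = k then axis l 1 $ i else A $ i $ j) / det A)"

lemma cramer_inv_unique:
  assumes "A ** Q = mat 1"
  shows "cramer_inv A = Q"
proof -
  have "det A * det Q = 1" using arg_cong[OF assms, of det] by (simp add: det_mul)
  then have A: "det A \<noteq> 0" by auto
  have "cramer_inv A $ k $ l = Q $ k $ l" for k l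
  proof -
    have "A *v (Q *v axis l 1) = axis l 1" by (simp add: matrix_vector_mul_assoc assms)
    then have "Q *v axis l 1 = (\<chi> k. det (\<chi> i j. if j = k then axis l 1 $ i else A $ i $ j) / det A)"
      using cramer[OF A] by blast
    then show ?thesis
      by (simp add: cramer_inv_def matrix_vector_mult_basis column_def vec_eq_iff)
  qed
  then show ?thesis by (simp add: vec_eq_iff)
qed

lemma continuous_on_det:
  fixes A :: "'a::topological_space \<Rightarrow> real^'n^'n"
  assumes "\<And>i j. continuous_on S (\<lambda>x. A x $ i $ j)"
  shows "continuous_on S (\<lambda>x. det (A x))"
  unfolding det_def by (intro continuous_intros assms)

lemma continuous_on_cramer_inv:
  fixes A :: "'a::topological_space \<Rightarrow> real^'n^'n"
  assumes "\<And>i j. continuous_on S (\<lambda>x. A x $ i $ j)" "\<And>x. x \<in> S \<Longrightarrow> det (A x) \<noteq> 0"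
  shows "continuous_on S (\<lambda>x. cramer_inv (A x) $ k $ l)"
proof -
  have "continuous_on S (\<lambda>x. det (\<chi> i j. if j = k then axis l 1 $ i else A x $ i $ j))"
  proof (rule continuous_on_det)
    fix i j
    show "continuous_on S (\<lambda>x. (\<chi> i j. if j = k then axis l 1 $ i else A x $ i $ j) $ i $ j)"
      using assms(1) by (cases "j = k") auto
  qed
  then show ?thesis
    using assms by (auto simp: cramer_inv_def intro!: continuous_on_divide continuous_on_det)
qed

section \<open>Orthonormal frames and traces for a positive definite form\<close>

locale pos_form =
  fixes g :: "real^'n \<Rightarrow> real^'n \<Rightarrow> real"
  assumes bil: "bilinear g" and sym: "g x y = g y x" and pos: "x \<noteq> 0 \<Longrightarrow> g x x > 0"
begin

text \<open>The index type is left free so that Gram-Schmidt can run over initial segments of the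
  natural numbers before the result is reindexed by \<open>'n\<close>.\<close>

definition ortho :: "('i \<Rightarrow> real^'n) \<Rightarrow> 'i set \<Rightarrow> bool" where
  "ortho e I \<longleftrightarrow> (\<forall>i\<in>I. \<forall>j\<in>I. g (e i) (e j) = (if i = j then 1 else 0))"

lemma g_sum_right: "g w (\<Sum>i\<in>I. c i *\<^sub>R e i) = (\<Sum>i\<in>I. c i * g w (e i))"
proof -
  have "linear (g w)" using bil by (simp add: bilinear_def)
  then show ?thesis by (simp add: linear_sum linear_scale)
qed

lemma g_sum_left: "g (\<Sum>i\<in>I. c i *\<^sub>R e i) w = (\<Sum>i\<in>I. c i * g (e i) w)"
  using g_sum_right by (metis (no_types, lifting) sum.cong sym)

lemma ortho_expand_span:
  assumes "ortho e I" "finite I" "w \<in> span (e ` I)"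
  shows "w = (\<Sum>i\<in>I. g w (e i) *\<^sub>R e i)"
  using assms(3)
proof (induction rule: span_induct_alt)
  case base
  then show ?case using bilinear_lzero[OF bil] by simp
next
  case (step c x y)
  then obtain k where k: "k \<in> I" "x = e k" by auto
  have "(\<Sum>i\<in>I. g (c *\<^sub>R x + y) (e i) *\<^sub>R e i) = (\<Sum>i\<in>I. (if k = i then c *\<^sub>R e i else 0) + g y (e i) *\<^sub>R e i)"
    by (rule sum.cong) (use assms(1) k in \<open>auto simp: ortho_def bilinear_ladd[OF bil] bilinear_lmul[OF bil] algebra_simps\<close>)
  also have "\<dots> = c *\<^sub>R x + y"
    using k assms(2) step by (simp add: sum.distrib)
  finally show ?case by simp
qed

lemma ortho_independent:
  assumes "ortho e I" "finite I"
  shows "inj_on e I" "independent (e ` I)"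
proof -
  show inj: "inj_on e I"
    using assms(1) by (intro inj_onI) (metis ortho_def zero_neq_one)
  show "independent (e ` I)"
    unfolding independent_explicit_finite_subsets
  proof (intro allI impI ballI)
    fix T u v assume T: "T \<subseteq> e ` I" "finite T" "(\<Sum>v\<in>T. u v *\<^sub>R v) = 0" "v \<in> T"
    have "g v (\<Sum>v\<in>T. u v *\<^sub>R v) = (\<Sum>w\<in>T. u w * g v w)" using g_sum_right[of v u "\<lambda>w. w" T] .
    also have "\<dots> = (\<Sum>w\<in>T. if w = v then u w else 0)"
    proof (rule sum.cong)
      fix w assume "w \<in> T"
      then obtain i j where ij: "i \<in> I" "j \<in> I" "v = e i" "w = e j" using T by blast
      then show "u w * g v w = (if w = v then u w else 0)"
        using assms(1) inj by (auto simp: ortho_def inj_on_def)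
    qed simp
    also have "\<dots> = u v" using T by simp
    finally show "u v = 0" using T bilinear_rzero[OF bil] by simp
  qed
qed

text \<open>Gram-Schmidt: fewer than \<open>CARD('n)\<close> vectors leave some \<open>v\<close>
  outside their span; \<open>w\<close> is \<open>v\<close> minus its projection and \<open>z\<close>
  is \<open>w\<close> normalised.\<close>

lemma ortho_exists_nat: "m \<le> CARD('n) \<Longrightarrow> \<exists>e :: nat \<Rightarrow> real^'n. ortho e {..<m}"
proof (induction m)
  case 0
  then show ?case by (simp add: ortho_def)
next
  case (Suc m)
  then obtain e :: "nat \<Rightarrow> real^'n" where e: "ortho e {..<m}" by auto
  have "dim (e ` {..<m}) \<le> card (e ` {..<m})" by (rule dim_le_card') simp
  also have "\<dots> \<le> m" using card_image_le[of "{..<m}" e] by simp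
  finally have "dim (e ` {..<m}) < DIM(real^'n)" using Suc.prems by simp
  then have "span (e ` {..<m}) \<noteq> UNIV" by (metis dim_UNIV dim_span less_irrefl)
  then obtain v where v: "v \<notin> span (e ` {..<m})" by auto
  define w where "w = v - (\<Sum>i<m. g v (e i) *\<^sub>R e i)"
  have w0: "w \<noteq> 0"
  proof
    assume "w = 0"
    then have "v = (\<Sum>i<m. g v (e i) *\<^sub>R e i)" by (simp add: w_def)
    then show False using v by (metis (no_types, lifting) imageI span_base span_scale span_sum)
  qed
  have we: "g w (e j) = 0" if "j < m" for j
  proof -
    have "g (\<Sum>i<m. g v (e i) *\<^sub>R e i) (e j) = (\<Sum>i<m. if j = i then g v (e i) else 0)"
      unfolding g_sum_left using e that by (intro sum.cong) (auto simp: ortho_def)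
    then show ?thesis using that by (simp add: w_def bilinear_lsub[OF bil])
  qed
  define z where "z = (1 / sqrt (g w w)) *\<^sub>R w"
  have "g z z = 1"
    using pos[OF w0] by (simp add: z_def bilinear_lmul[OF bil] bilinear_rmul[OF bil] divide_simps)
  moreover have "g z (e j) = 0" "g (e j) z = 0" if "j < m" for j
    using we[OF that] sym[of "e j"] by (simp_all add: z_def bilinear_lmul[OF bil])
  ultimately have "ortho (e(m := z)) {..<Suc m}"
    using e by (auto simp: ortho_def less_Suc_eq)
  then show ?case by blast
qed

lemma ortho_exists: "\<exists>e :: 'n \<Rightarrow> real^'n. ortho e UNIV"
proof -
  obtain e :: "nat \<Rightarrow> real^'n" where e: "ortho e {..<CARD('n)}" using ortho_exists_nat by blast
  obtain h :: "'n \<Rightarrow> nat" where h: "bij_betw h UNIV {0..<CARD('n)}"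
    using ex_bij_betw_finite_nat[of "UNIV :: 'n set"] by auto
  then have "ortho (e \<circ> h) UNIV"
  proof -
    have "h i < CARD('n)" "h i = h j \<longleftrightarrow> i = j" for i j
      using h by (auto simp: bij_betw_def inj_on_def)
    then show ?thesis using e by (simp add: ortho_def)
  qed
  then show ?thesis by blast
qed

lemma ortho_expand:
  fixes e :: "'n \<Rightarrow> real^'n"
  assumes "ortho e UNIV"
  shows "w = (\<Sum>i\<in>UNIV. g w (e i) *\<^sub>R e i)"
proof (rule ortho_expand_span[OF assms])
  have "card (e ` UNIV) = CARD('n)" using card_image ortho_independent[OF assms] by auto
  then have "UNIV \<subseteq> span (e ` UNIV)"
    using card_ge_dim_independent[OF subset_UNIV ortho_independent(2)[OF assms finite]] by simp
  then show "w \<in> span (range e)" by blast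
qed simp

definition gram :: "real^'n^'n" where
  "gram = (\<chi> i j. g (axis i 1) (axis j 1))"

definition frame_matrix :: "('n \<Rightarrow> real^'n) \<Rightarrow> real^'n^'n" where
  "frame_matrix e = (\<chi> k i. e i $ k)"

text \<open>This is the expansion of the standard basis vectors in the orthonormal frame, read
  entrywise: the frame matrix times its transpose inverts the Gram matrix. Its determinant shows at
  once that \<open>det gram\<close> is positive.\<close>

lemma frame_inverse:
  assumes "ortho e UNIV"
  shows "(frame_matrix e ** transpose (frame_matrix e)) ** gram = mat 1"
proof -
  have "((frame_matrix e ** transpose (frame_matrix e)) ** gram) $ k $ m = mat 1 $ k $ m" for k m
  proof -
    have "((frame_matrix e ** transpose (frame_matrix e)) ** gram) $ k $ m =
       (\<Sum>l\<in>UNIV. \<Sum>i\<in>UNIV. e i $ k * (e i $ l * g (axis l 1) (axis m 1)))"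
      by (simp add: matrix_matrix_mult_def frame_matrix_def transpose_def gram_def sum_distrib_right mult.assoc)
    also have "\<dots> = (\<Sum>i\<in>UNIV. e i $ k * (\<Sum>l\<in>UNIV. e i $ l * g (axis l 1) (axis m 1)))"
      by (subst sum.swap) (simp add: sum_distrib_left)
    also have "\<dots> = (\<Sum>i\<in>UNIV. e i $ k * g (axis m 1) (e i))"
    proof -
      have "(\<Sum>l\<in>UNIV. e i $ l * g (axis l 1) (axis m 1)) = g (axis m 1) (e i)" for i
        using g_sum_right[of "axis m 1" "\<lambda>l. e i $ l" "\<lambda>l. axis l 1" UNIV] basis_expansion[of "e i"] sym
        by (simp add: scalar_mult_eq_scaleR)
      then show ?thesis by simp
    qed
    also have "\<dots> = (\<Sum>i\<in>UNIV. g (axis m 1) (e i) *\<^sub>R e i) $ k" by (simp add: mult.commute)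
    also have "\<dots> = axis m 1 $ k" using ortho_expand[OF assms, of "axis m 1"] by simp
    finally show ?thesis by (auto simp: mat_def axis_def)
  qed
  then show ?thesis by (simp add: vec_eq_iff)
qed

lemma det_gram_pos: "det gram > 0"
proof -
  obtain e :: "'n \<Rightarrow> real^'n" where e: "ortho e UNIV" using ortho_exists by blast
  have "det (frame_matrix e) * det (frame_matrix e) * det gram = 1"
    using arg_cong[OF frame_inverse[OF e], of det] by (simp add: det_mul det_transpose)
  then show ?thesis
    by (metis mult.commute not_one_le_zero order.refl zero_less_mult_pos zero_le_square
        less_eq_real_def mult_eq_0_iff zero_less_one)
qed

text \<open>Expanding \<open>B\<close> in coordinates leaves the coefficients
  \<open>\<Sum>i. e i $ k * e i $ l\<close>, which are the entries of the inverse Gram matrix. The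
  frame has disappeared from the right-hand side.\<close>

lemma trace_frame:
  fixes e :: "'n \<Rightarrow> real^'n"
  assumes e: "ortho e UNIV" and B: "bilinear B"
  shows "(\<Sum>i\<in>UNIV. B (e i) (e i)) =
    (\<Sum>k\<in>UNIV. \<Sum>l\<in>UNIV. cramer_inv gram $ k $ l * B (axis k 1) (axis l 1))"
proof -
  let ?Q = "frame_matrix e ** transpose (frame_matrix e)"
  have "gram ** ?Q = mat 1" using frame_inverse[OF e] by (simp add: matrix_left_right_inverse)
  then have "cramer_inv gram = ?Q" by (rule cramer_inv_unique)
  then have Q: "cramer_inv gram $ k $ l = (\<Sum>i\<in>UNIV. e i $ k * e i $ l)" for k l
    by (simp add: matrix_matrix_mult_def frame_matrix_def transpose_def)
  have "(\<Sum>i\<in>UNIV. B (e i) (e i)) = (\<Sum>i\<in>UNIV. \<Sum>k\<in>UNIV. \<Sum>l\<in>UNIV. e i $ k * e i $ l * B (axis k 1) (axis l 1))"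
    by (intro sum.cong refl bilinear_expand[OF B])
  also have "\<dots> = (\<Sum>k\<in>UNIV. \<Sum>i\<in>UNIV. \<Sum>l\<in>UNIV. e i $ k * e i $ l * B (axis k 1) (axis l 1))"
    by (rule sum.swap)
  also have "\<dots> = (\<Sum>k\<in>UNIV. \<Sum>l\<in>UNIV. \<Sum>i\<in>UNIV. e i $ k * e i $ l * B (axis k 1) (axis l 1))"
    by (intro sum.cong sum.swap refl)
  finally show ?thesis by (simp add: Q sum_distrib_right)
qed

end

section \<open>Riemannian manifolds\<close>

locale metric_vb =
  fixes E :: "('m::{t2_space,second_countable_topology}, 'n::finite,
               'e::topological_space, 'r::finite) metric_bundle"
  assumes vb: "oriented_riemannian_vector_bundle E"
begin

lemma atlas: "oriented_smooth_atlas (atlas E)" and rmet: "riemannian_metric E"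
  and ovb: "oriented_vector_bundle E" and sfm: "smooth_fibre_metric E"
  and con: "connection E" and compat: "metric_compatible E"
  using vb by (auto simp: oriented_riemannian_vector_bundle_def oriented_riemannian_manifold_def)

lemma
  assumes "c \<in> atlas E"
  shows chart_open: "open (fst c)" "open (snd c ` fst c)"
    and chart_homeo: "homeomorphism (fst c) (snd c ` fst c) (snd c) (chart_inv c)"
  using atlas assms by (auto simp: oriented_smooth_atlas_def)

lemma chart_inv_chart [simp]: "c \<in> atlas E \<Longrightarrow> x \<in> fst c \<Longrightarrow> chart_inv c (snd c x) = x"
  using chart_homeo by (auto simp: homeomorphism_def)

lemma chart_chart_inv [simp]: "c \<in> atlas E \<Longrightarrow> y \<in> snd c ` fst c \<Longrightarrow> snd c (chart_inv c y) = y"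
  using chart_homeo by (auto simp: homeomorphism_def)

lemma chart_inv_in: "c \<in> atlas E \<Longrightarrow> U \<subseteq> fst c \<Longrightarrow> y \<in> snd c ` U \<Longrightarrow> chart_inv c y \<in> U"
  by (auto simp: subset_iff)

lemma continuous_on_chart: "c \<in> atlas E \<Longrightarrow> continuous_on (fst c) (snd c)"
  and continuous_on_chart_inv: "c \<in> atlas E \<Longrightarrow> continuous_on (snd c ` fst c) (chart_inv c)"
  using chart_homeo by (auto simp: homeomorphism_def)

lemma open_chart_image:
  assumes c: "c \<in> atlas E" and U: "open U" "U \<subseteq> fst c"
  shows "open (snd c ` U)"
proof -
  have "snd c ` U = chart_inv c -` U \<inter> snd c ` fst c"
    using U c by (auto simp: subset_iff)
  then show ?thesis
    using continuous_on_open_vimage[OF chart_open(2)[OF c]] continuous_on_chart_inv[OF c] U by (metis Int_commute)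
qed

lemma open_chart_vimage:
  assumes c: "c \<in> atlas E" and W: "open W" "W \<subseteq> snd c ` fst c"
  shows "open (chart_inv c ` W)"
proof -
  have "chart_inv c ` W = snd c -` W \<inter> fst c"
  proof (intro equalityI subsetI)
    fix x assume "x \<in> chart_inv c ` W"
    then show "x \<in> snd c -` W \<inter> fst c"
      using chart_inv_in[OF c order_refl] chart_chart_inv[OF c] W by auto
  next
    fix x assume "x \<in> snd c -` W \<inter> fst c"
    then show "x \<in> chart_inv c ` W" using chart_inv_chart[OF c, of x] by (auto intro!: image_eqI[of _ _ "snd c x"])
  qed
  then show ?thesis
    using continuous_on_open_vimage[OF chart_open(1)[OF c]] continuous_on_chart[OF c] W by (metis Int_commute)
qed

lemma chart_exists: "\<exists>c\<in>atlas E. x \<in> fst c"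
  using atlas unfolding oriented_smooth_atlas_def by blast

lemma chart_at: "chart_at E x \<in> atlas E" "x \<in> fst (chart_at E x)"
proof -
  have "chart_at E x \<in> atlas E \<and> x \<in> fst (chart_at E x)"
    unfolding chart_at_def by (rule someI_ex) (use chart_exists in blast)
  then show "chart_at E x \<in> atlas E" "x \<in> fst (chart_at E x)" by auto
qed

section \<open>Coordinate changes, tangent vectors and directional derivatives\<close>

lemma coord_change_has_derivative:
  assumes "c \<in> atlas E" "d \<in> atlas E" "x \<in> fst c" "x \<in> fst d"
  shows "((snd d \<circ> chart_inv c) has_derivative coord_change_deriv c d x) (at (snd c x))"
  unfolding coord_change_deriv_def
proof (rule smooth_on_has_derivative)
  show "smooth_on (snd d \<circ> chart_inv c) (snd c ` (fst c \<inter> fst d))"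
    using atlas assms unfolding oriented_smooth_atlas_def by blast
qed (use assms in auto)

lemma coord_change_linear:
  assumes "c \<in> atlas E" "d \<in> atlas E" "x \<in> fst c" "x \<in> fst d"
  shows "linear (coord_change_deriv c d x)"
  using coord_change_has_derivative[OF assms] has_derivative_linear by blast

text \<open>On the overlap of the charts \<open>f \<circ> chart_inv c\<close> factors through the
  coordinate change. With \<open>f\<close> a further chart map this yields the cocycle rule for
  \<open>coord_change_deriv\<close>.\<close>

lemma chart_chain_rule:
  fixes f :: "'m \<Rightarrow> 'b::real_normed_vector"
  assumes c: "c \<in> atlas E" "x \<in> fst c" and d: "d \<in> atlas E" "x \<in> fst d"
    and D: "((f \<circ> chart_inv d) has_derivative D) (at (snd d x))"
  shows "((f \<circ> chart_inv c) has_derivative (\<lambda>\<xi>. D (coord_change_deriv c d x \<xi>))) (at (snd c x))"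
proof -
  let ?S = "snd c ` (fst c \<inter> fst d)"
  have "((\<lambda>y. (f \<circ> chart_inv d) ((snd d \<circ> chart_inv c) y)) has_derivative
      (\<lambda>\<xi>. D (coord_change_deriv c d x \<xi>))) (at (snd c x))"
    by (rule has_derivative_compose[OF coord_change_has_derivative]) (use c d D in \<open>auto simp: o_def\<close>)
  then show ?thesis
  proof (rule has_derivative_transform_within_open)
    show "open ?S" by (rule open_chart_image[OF c(1) open_Int[OF chart_open(1)[OF c(1)] chart_open(1)[OF d(1)]] Int_lower1])
  qed (use c d in auto)
qed

lemma coord_change_compose:
  assumes "c \<in> atlas E" "d \<in> atlas E" "e \<in> atlas E" "x \<in> fst c" "x \<in> fst d" "x \<in> fst e"
  shows "coord_change_deriv d e x (coord_change_deriv c d x \<xi>) = coord_change_deriv c e x \<xi>"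
proof -
  have "((snd e \<circ> chart_inv c) has_derivative (\<lambda>\<xi>. coord_change_deriv d e x (coord_change_deriv c d x \<xi>))) (at (snd c x))"
    by (rule chart_chain_rule[OF _ _ _ _ coord_change_has_derivative]) (use assms in auto)
  from has_derivative_unique[OF this coord_change_has_derivative] assms
  show ?thesis by metis
qed

lemma coord_change_same:
  assumes "c \<in> atlas E" "x \<in> fst c"
  shows "coord_change_deriv c c x \<xi> = \<xi>"
proof -
  have "((\<lambda>y. y) has_derivative (\<lambda>\<xi>. \<xi>)) (at (snd c x))" by (rule has_derivative_ident)
  then have "((snd c \<circ> chart_inv c) has_derivative (\<lambda>\<xi>. \<xi>)) (at (snd c x))"
    by (rule has_derivative_transform_within_open[OF _ chart_open(2)[OF assms(1)]]) (use assms in auto)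
  from has_derivative_unique[OF this coord_change_has_derivative] assms
  show ?thesis by metis
qed

lemma coord_vec_tangent:
  assumes "c \<in> atlas E" "x \<in> fst c"
  shows "coord_vec E c x \<xi> \<in> tangent_space E x"
  using assms by (auto simp: tangent_space_def coord_vec_def coord_change_compose)

lemma coord_vec_coord [simp]:
  "c \<in> atlas E \<Longrightarrow> x \<in> fst c \<Longrightarrow> coord_vec E c x \<xi> c = \<xi>"
  by (simp add: coord_vec_def coord_change_same)

lemma tangent_coord_vec:
  assumes "c \<in> atlas E" "x \<in> fst c" "v \<in> tangent_space E x"
  shows "coord_vec E c x (v c) = v"
proof
  fix d
  show "coord_vec E c x (v c) d = v d"
  proof (cases "d \<in> atlas E \<and> x \<in> fst d")
    case True
    then have "v d = coord_change_deriv c d x (v c)" using assms unfolding tangent_space_def by blast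
    moreover have "coord_vec E c x (v c) d = coord_change_deriv c d x (v c)"
      using True by (simp add: coord_vec_def)
    ultimately show ?thesis by (simp only:)
  next
    case False
    then have "v d = 0" using assms unfolding tangent_space_def by blast
    moreover have "coord_vec E c x (v c) d = 0" using False by (auto simp: coord_vec_def)
    ultimately show ?thesis by simp
  qed
qed

lemma coord_vec_comb:
  assumes "c \<in> atlas E" "x \<in> fst c"
  shows "coord_vec E c x (a *\<^sub>R \<xi> + b *\<^sub>R \<eta>) = tvec_comb a (coord_vec E c x \<xi>) b (coord_vec E c x \<eta>)"
  using assms coord_change_linear[OF assms(1) _ assms(2)]
  by (auto simp: tvec_comb_def coord_vec_def fun_eq_iff linear_add linear_scale)

lemma smooth_fun_has_derivative:
  assumes "smooth_fun E f" "c \<in> atlas E" "x \<in> fst c"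
  shows "((f \<circ> chart_inv c) has_derivative frechet_derivative (f \<circ> chart_inv c) (at (snd c x))) (at (snd c x))"
  by (rule smooth_on_has_derivative) (use assms in \<open>auto simp: smooth_fun_def\<close>)

text \<open>Frees \<open>dir_deriv\<close> from the arbitrarily chosen \<open>chart_at\<close>: the
  chain rule and the transformation law of tangent vectors compensate each other.\<close>

lemma dir_deriv_chart:
  assumes f: "smooth_fun E f" and c: "c \<in> atlas E" "x \<in> fst c" and v: "v \<in> tangent_space E x"
  shows "dir_deriv E f x v = frechet_derivative (f \<circ> chart_inv c) (at (snd c x)) (v c)"
proof -
  let ?d = "chart_at E x"
  have "frechet_derivative (f \<circ> chart_inv c) (at (snd c x)) =
    (\<lambda>\<xi>. frechet_derivative (f \<circ> chart_inv ?d) (at (snd ?d x)) (coord_change_deriv c ?d x \<xi>))"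
    using chart_chain_rule[OF c chart_at smooth_fun_has_derivative[OF f chart_at]]
    by (metis frechet_derivative_at)
  moreover have "v ?d = coord_change_deriv c ?d x (v c)"
    using v c chart_at unfolding tangent_space_def by blast
  ultimately show ?thesis by (simp add: dir_deriv_def Let_def)
qed

lemma dir_deriv_has_derivative:
  assumes D: "((f \<circ> chart_inv (chart_at E x)) has_derivative D) (at (snd (chart_at E x) x))"
  shows "dir_deriv E f x v = D (v (chart_at E x))"
  using frechet_derivative_at[OF D] by (simp add: dir_deriv_def Let_def)

lemma dir_deriv_comb:
  assumes f: "smooth_fun E f" and v: "v \<in> tangent_space E x" "w \<in> tangent_space E x"
  shows "dir_deriv E f x (tvec_comb a v b w) = a * dir_deriv E f x v + b * dir_deriv E f x w"
proof -
  have "linear (frechet_derivative (f \<circ> chart_inv (chart_at E x)) (at (snd (chart_at E x) x)))"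
    using smooth_fun_has_derivative[OF f chart_at] has_derivative_linear by blast
  then show ?thesis
    by (simp add: dir_deriv_def Let_def tvec_comb_def linear_add linear_scale)
qed

section \<open>Orthonormal tangent frames and gradients\<close>

definition coord_metric :: "('m, 'n) chart \<Rightarrow> 'm \<Rightarrow> real^'n \<Rightarrow> real^'n \<Rightarrow> real" where
  "coord_metric c x \<xi> \<eta> = metric E x (coord_vec E c x \<xi>) (coord_vec E c x \<eta>)"

lemma metric_sym: "v \<in> tangent_space E x \<Longrightarrow> w \<in> tangent_space E x \<Longrightarrow> metric E x v w = metric E x w v"
  and metric_comb: "u \<in> tangent_space E x \<Longrightarrow> v \<in> tangent_space E x \<Longrightarrow> w \<in> tangent_space E x \<Longrightarrow>
     metric E x (tvec_comb a u b v) w = a * metric E x u w + b * metric E x v w"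
  and metric_pos: "v \<in> tangent_space E x \<Longrightarrow> v \<noteq> tvec_zero \<Longrightarrow> metric E x v v > 0"
  using rmet unfolding riemannian_metric_def by blast+

lemma coord_metric_form:
  assumes c: "c \<in> atlas E" "x \<in> fst c"
  shows "pos_form (coord_metric c x)"
proof -
  note t = coord_vec_tangent[OF c]
  have s: "coord_metric c x \<xi> \<eta> = coord_metric c x \<eta> \<xi>" for \<xi> \<eta>
    unfolding coord_metric_def by (rule metric_sym[OF t t])
  have l: "linear (\<lambda>\<xi>. coord_metric c x \<xi> \<eta>)" for \<eta>
    by (rule linearI_combination) (simp add: coord_metric_def coord_vec_comb[OF c] metric_comb t)
  moreover have "coord_metric c x \<xi> = (\<lambda>\<eta>. coord_metric c x \<eta> \<xi>)" for \<xi> using s by auto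
  ultimately have b: "bilinear (coord_metric c x)" unfolding bilinear_def by metis
  have p: "coord_metric c x \<xi> \<xi> > 0" if "\<xi> \<noteq> 0" for \<xi>
    unfolding coord_metric_def
  proof (rule metric_pos[OF t])
    show "coord_vec E c x \<xi> \<noteq> tvec_zero"
      using coord_vec_coord[OF c, of \<xi>] that by (auto simp: tvec_zero_def)
  qed
  show ?thesis by unfold_locales (use b s p in auto)
qed

lemma gram_eq: "c \<in> atlas E \<Longrightarrow> x \<in> fst c \<Longrightarrow> pos_form.gram (coord_metric c x) = gram_matrix E c x"
  by (simp add: pos_form.gram_def[OF coord_metric_form] gram_matrix_def coord_metric_def)

lemma metric_coord:
  assumes c: "c \<in> atlas E" "x \<in> fst c" and "v \<in> tangent_space E x" "w \<in> tangent_space E x"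
  shows "metric E x v w = coord_metric c x (v c) (w c)"
  using assms by (simp add: coord_metric_def tangent_coord_vec)

lemma orthonormal_frame_ortho:
  assumes c: "c \<in> atlas E" "x \<in> fst c" and e: "orthonormal_frame E x e"
  shows "pos_form.ortho (coord_metric c x) (\<lambda>i. e i c) UNIV"
  using e by (auto simp: pos_form.ortho_def[OF coord_metric_form[OF c]] orthonormal_frame_def
      metric_coord[OF c, symmetric])

text \<open>The same choice as in \<open>conn_norm_sq\<close>, so that the energy density is
  literally a sum over this frame.\<close>

definition frame :: "'m \<Rightarrow> 'n \<Rightarrow> ('m, 'n) tvec" where
  "frame x = (SOME e. orthonormal_frame E x e)"

lemma frame: "orthonormal_frame E x (frame x)"
  unfolding frame_def
proof (rule someI_ex[of "orthonormal_frame E x"])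
  let ?c = "chart_at E x"
  obtain e :: "'n \<Rightarrow> real^'n" where "pos_form.ortho (coord_metric ?c x) e UNIV"
    using pos_form.ortho_exists[OF coord_metric_form[OF chart_at]] by blast
  then have "orthonormal_frame E x (\<lambda>i. coord_vec E ?c x (e i))"
    using coord_vec_tangent[OF chart_at]
    by (simp add: orthonormal_frame_def pos_form.ortho_def[OF coord_metric_form[OF chart_at]] coord_metric_def)
  then show "\<exists>e. orthonormal_frame E x e" by blast
qed

lemma frame_tangent: "frame x i \<in> tangent_space E x"
  using frame by (auto simp: orthonormal_frame_def)

text \<open>The frame is chosen without any continuity; the inverse of the Gram matrix on the right-hand
  side shows that traces nevertheless depend continuously on the point.\<close>

lemma frame_trace:
  assumes c: "c \<in> atlas E" "x \<in> fst c"
    and B: "bilinear (\<lambda>\<xi> \<eta>. B (coord_vec E c x \<xi>) (coord_vec E c x \<eta>))"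
  shows "(\<Sum>i\<in>UNIV. B (frame x i) (frame x i)) =
    (\<Sum>k\<in>UNIV. \<Sum>l\<in>UNIV. cramer_inv (gram_matrix E c x) $ k $ l *
       B (coord_vec E c x (axis k 1)) (coord_vec E c x (axis l 1)))"
  using pos_form.trace_frame[OF coord_metric_form[OF c] orthonormal_frame_ortho[OF c frame] B]
  by (simp add: gram_eq[OF c] tangent_coord_vec[OF c frame_tangent])

text \<open>Riesz representation followed by Parseval: the gradient has the numbers
  \<open>dir_deriv E f x (frame x i)\<close> as its components in the orthonormal frame.\<close>

lemma grad_norm_sq_frame:
  assumes f: "smooth_fun E f"
  shows "grad_norm_sq E f x = (\<Sum>i\<in>UNIV. (dir_deriv E f x (frame x i))\<^sup>2)"
proof -
  let ?c = "chart_at E x"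
  interpret g: pos_form "coord_metric ?c x" by (rule coord_metric_form[OF chart_at])
  note o = orthonormal_frame_ortho[OF chart_at frame, of x]
  define L where "L = (\<lambda>\<xi>. dir_deriv E f x (coord_vec E ?c x \<xi>))"
  define e where "e = (\<lambda>i. frame x i ?c)"
  \<comment> \<open>The coordinates of the gradient in the chart \<open>?c\<close>.\<close>
  define \<zeta> where "\<zeta> = (\<Sum>i\<in>UNIV. L (e i) *\<^sub>R e i)"
  have Le: "L (e i) = dir_deriv E f x (frame x i)" for i
    by (simp add: L_def e_def tangent_coord_vec[OF chart_at frame_tangent])
  have lin: "linear L"
    by (rule linearI_combination)
      (simp add: L_def coord_vec_comb[OF chart_at] dir_deriv_comb[OF f] coord_vec_tangent[OF chart_at])
  have z: "coord_metric ?c x \<zeta> \<eta> = L \<eta>" for \<eta>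
  proof -
    have "L \<eta> = L (\<Sum>i\<in>UNIV. coord_metric ?c x \<eta> (e i) *\<^sub>R e i)"
      using g.ortho_expand[OF o, of \<eta>] by (simp add: e_def)
    also have "\<dots> = (\<Sum>i\<in>UNIV. coord_metric ?c x \<eta> (e i) * L (e i))"
      by (simp add: linear_sum[OF lin] linear_scale[OF lin])
    also have "\<dots> = coord_metric ?c x \<zeta> \<eta>"
      by (simp add: \<zeta>_def g.g_sum_left g.sym[of \<eta>] mult.commute)
    finally show ?thesis by simp
  qed
  have "gradient E f x = coord_vec E ?c x \<zeta>"
    unfolding gradient_def
  proof (rule the_equality)
    have "metric E x (coord_vec E ?c x \<zeta>) w = dir_deriv E f x w" if "w \<in> tangent_space E x" for w
      using that z[of "w ?c"] coord_vec_tangent[OF chart_at]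
      by (simp add: metric_coord[OF chart_at] chart_at L_def tangent_coord_vec[OF chart_at])
    then show "coord_vec E ?c x \<zeta> \<in> tangent_space E x \<and>
      (\<forall>w\<in>tangent_space E x. metric E x (coord_vec E ?c x \<zeta>) w = dir_deriv E f x w)"
      using coord_vec_tangent[OF chart_at] by blast
  next
    fix v assume v: "v \<in> tangent_space E x \<and> (\<forall>w\<in>tangent_space E x. metric E x v w = dir_deriv E f x w)"
    have "coord_metric ?c x (v ?c) \<eta> = L \<eta>" for \<eta>
    proof -
      have "metric E x v (coord_vec E ?c x \<eta>) = coord_metric ?c x (v ?c) \<eta>"
        using metric_coord[OF chart_at _ coord_vec_tangent[OF chart_at]] v chart_at by simp
      then show ?thesis using v coord_vec_tangent[OF chart_at] by (simp add: L_def)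
    qed
    \<comment> \<open>Two vectors representing the same linear form differ by a vector orthogonal to
      everything, in particular to itself; this is the uniqueness that \<open>THE\<close> asks
      for.\<close>
    then have "coord_metric ?c x (v ?c - \<zeta>) (v ?c - \<zeta>) = 0"
      using z by (simp add: bilinear_lsub[OF g.bil])
    then have "v ?c = \<zeta>" using g.pos[of "v ?c - \<zeta>"] by fastforce
    then show "v = coord_vec E ?c x \<zeta>" using tangent_coord_vec[OF chart_at, of v] v by metis
  qed
  then have "grad_norm_sq E f x = coord_metric ?c x \<zeta> \<zeta>" by (simp add: grad_norm_sq_def coord_metric_def)
  also have "\<dots> = L \<zeta>" by (rule z)
  also have "\<dots> = (\<Sum>i\<in>UNIV. L (e i) * L (e i))"
    by (simp add: \<zeta>_def linear_sum[OF lin] linear_scale[OF lin])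
  finally show ?thesis by (simp add: Le power2_eq_square)
qed

section \<open>Metric vector bundles\<close>

lemma triv_open: "b \<in> trivs E \<Longrightarrow> open (fst b)"
  and triv_homeo: "b \<in> trivs E \<Longrightarrow>
    homeomorphism (proj E -` fst b) (fst b \<times> UNIV) (triv_map E b) (\<lambda>(x, \<xi>). triv_inv E b x \<xi>)"
  using ovb by (auto simp: oriented_vector_bundle_def)

lemma triv_exists: "\<exists>b\<in>trivs E. x \<in> fst b"
  using ovb unfolding oriented_vector_bundle_def by blast

lemma triv_at: "triv_at E x \<in> trivs E" "x \<in> fst (triv_at E x)"
proof -
  have "triv_at E x \<in> trivs E \<and> x \<in> fst (triv_at E x)"
    unfolding triv_at_def by (rule someI_ex) (use triv_exists in blast)
  then show "triv_at E x \<in> trivs E" "x \<in> fst (triv_at E x)" by auto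
qed

lemma
  assumes "b \<in> trivs E" "x \<in> fst b"
  shows proj_triv_inv [simp]: "proj E (triv_inv E b x \<xi>) = x"
    and triv_triv_inv [simp]: "snd b (triv_inv E b x \<xi>) = \<xi>"
proof -
  have "triv_map E b ((\<lambda>(x, \<xi>). triv_inv E b x \<xi>) (x, \<xi>)) = (x, \<xi>)"
    using triv_homeo[OF assms(1)] assms(2) unfolding homeomorphism_def by blast
  then show "proj E (triv_inv E b x \<xi>) = x" "snd b (triv_inv E b x \<xi>) = \<xi>" by (auto simp: triv_map_def)
qed

lemma triv_inv_triv:
  assumes "b \<in> trivs E" "proj E e \<in> fst b"
  shows "triv_inv E b (proj E e) (snd b e) = e"
proof -
  have "(\<lambda>(x, \<xi>). triv_inv E b x \<xi>) (triv_map E b e) = e"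
    using triv_homeo[OF assms(1)] assms(2) unfolding homeomorphism_def by blast
  then show ?thesis by (auto simp: triv_map_def)
qed

lemma fibre_eqI:
  assumes "b \<in> trivs E" "proj E e \<in> fst b" "proj E e = proj E e'" "snd b e = snd b e'"
  shows "e = e'"
  using triv_inv_triv[of b e] triv_inv_triv[of b e'] assms by metis

lemma transition_exists:
  assumes "b \<in> trivs E" "b' \<in> trivs E"
  shows "\<exists>G. \<forall>e. proj E e \<in> fst b \<inter> fst b' \<longrightarrow> snd b' e = G (proj E e) *v snd b e"
  using ovb assms unfolding oriented_vector_bundle_def by blast

lemma
  assumes x: "proj E e = x" "proj E e' = x"
  shows proj_fibre_comb: "proj E (fibre_comb E a e a' e') = x"
    and triv_fibre_comb: "b \<in> trivs E \<Longrightarrow> x \<in> fst b \<Longrightarrow>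
      snd b (fibre_comb E a e a' e') = a *\<^sub>R snd b e + a' *\<^sub>R snd b e'"
proof -
  let ?t = "triv_at E x" and ?f = "fibre_comb E a e a' e'"
  have f: "proj E ?f = x" "snd ?t ?f = a *\<^sub>R snd ?t e + a' *\<^sub>R snd ?t e'"
    by (simp_all add: fibre_comb_def Let_def x triv_at)
  then show "proj E ?f = x" by simp
  assume b: "b \<in> trivs E" "x \<in> fst b"
  obtain G where G: "\<And>e. proj E e \<in> fst ?t \<inter> fst b \<Longrightarrow> snd b e = G (proj E e) *v snd ?t e"
    using transition_exists[OF triv_at(1) b(1)] by blast
  show "snd b ?f = a *\<^sub>R snd b e + a' *\<^sub>R snd b e'"
    using G[of ?f] G[of e] G[of e'] f x b triv_at(2)[of x]
    by (simp add: matrix_vector_right_distrib matrix_vector_mult_scaleR)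
qed

lemma proj_fibre_zero [simp]: "proj E (fibre_zero E x) = x"
  by (simp add: fibre_zero_def triv_at)

lemma triv_fibre_zero:
  assumes b: "b \<in> trivs E" "x \<in> fst b"
  shows "snd b (fibre_zero E x) = 0"
proof -
  let ?t = "triv_at E x"
  obtain G where G: "\<And>e. proj E e \<in> fst ?t \<inter> fst b \<Longrightarrow> snd b e = G (proj E e) *v snd ?t e"
    using transition_exists[OF triv_at(1) b(1)] by blast
  have "snd ?t (fibre_zero E x) = 0" by (simp add: fibre_zero_def triv_at)
  then show ?thesis using G[of "fibre_zero E x"] b triv_at(2)[of x] by simp
qed

lemma fibre_metric_sym: "proj E e = proj E e' \<Longrightarrow> fibre_metric E e e' = fibre_metric E e' e"
  and fibre_metric_pos: "e \<noteq> fibre_zero E (proj E e) \<Longrightarrow> fibre_metric E e e > 0"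
  and fibre_metric_comb_left: "proj E e = proj E e' \<Longrightarrow> proj E e' = proj E e'' \<Longrightarrow>
    fibre_metric E (fibre_comb E a e a' e') e'' = a * fibre_metric E e e'' + a' * fibre_metric E e' e''"
  using sfm unfolding smooth_fibre_metric_def by blast+

lemma fibre_metric_comb_right:
  assumes "proj E e = proj E e'" "proj E e' = proj E e''"
  shows "fibre_metric E e'' (fibre_comb E a e a' e') = a * fibre_metric E e'' e + a' * fibre_metric E e'' e'"
  using fibre_metric_comb_left[OF assms] fibre_metric_sym[of e'' "fibre_comb E a e a' e'"]
    fibre_metric_sym[of e'' e] fibre_metric_sym[of e'' e'] proj_fibre_comb[of e "proj E e" e' a a'] assms
  by simp

lemma triv_inv_comb:
  assumes b: "b \<in> trivs E" "x \<in> fst b"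
  shows "triv_inv E b x (a *\<^sub>R \<xi> + a' *\<^sub>R \<eta>) = fibre_comb E a (triv_inv E b x \<xi>) a' (triv_inv E b x \<eta>)"
  by (rule fibre_eqI[OF b(1)]) (use b in \<open>simp_all add: triv_fibre_comb proj_fibre_comb\<close>)

section \<open>The fibre metric in a trivialisation and patching of local smoothness\<close>

definition fibre_form :: "'m set \<times> ('e \<Rightarrow> real^'r) \<Rightarrow> 'm \<Rightarrow> real^'r \<Rightarrow> real^'r \<Rightarrow> real" where
  "fibre_form b x \<xi> \<eta> = fibre_metric E (triv_inv E b x \<xi>) (triv_inv E b x \<eta>)"

lemma fibre_form_bilinear:
  assumes b: "b \<in> trivs E" "x \<in> fst b"
  shows "bilinear (fibre_form b x)"
  unfolding bilinear_def
  by (intro conjI allI linearI_combination)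
     (simp_all add: fibre_form_def triv_inv_comb[OF b] fibre_metric_comb_left fibre_metric_comb_right b)

lemma fibre_metric_triv:
  assumes "b \<in> trivs E" "x \<in> fst b" "proj E e = x" "proj E e' = x"
  shows "fibre_metric E e e' = fibre_form b x (snd b e) (snd b e')"
  using triv_inv_triv[of b e] triv_inv_triv[of b e'] assms by (simp add: fibre_form_def)

text \<open>Smoothness of the fibre metric is postulated for constant coordinate vectors; expanding
  the bilinear form in the standard basis extends it to varying ones.\<close>

lemma smooth_fibre_metric_local:
  assumes c: "c \<in> atlas E" and b: "b \<in> trivs E"
    and st: "\<And>x. x \<in> fst c \<inter> fst b \<Longrightarrow> proj E (s x) = x \<and> proj E (t x) = x"
    and s: "smooth_on (\<lambda>y. snd b (s (chart_inv c y))) (snd c ` (fst c \<inter> fst b))"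
    and t: "smooth_on (\<lambda>y. snd b (t (chart_inv c y))) (snd c ` (fst c \<inter> fst b))"
  shows "smooth_on (\<lambda>y. fibre_metric E (s (chart_inv c y)) (t (chart_inv c y))) (snd c ` (fst c \<inter> fst b))"
proof -
  let ?V = "snd c ` (fst c \<inter> fst b)"
  have op: "open ?V" by (rule open_chart_image[OF c open_Int[OF chart_open(1)[OF c] triv_open[OF b]] Int_lower1])
  have h: "smooth_on (\<lambda>y. fibre_form b (chart_inv c y) \<xi> \<eta>) ?V" for \<xi> \<eta>
    using sfm c b by (simp add: smooth_fibre_metric_def fibre_form_def Let_def)
  have "smooth_on (\<lambda>y. \<Sum>i\<in>UNIV. \<Sum>j\<in>UNIV. snd b (s (chart_inv c y)) $ i * snd b (t (chart_inv c y)) $ j *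
      fibre_form b (chart_inv c y) (axis i 1) (axis j 1)) ?V"
    by (intro smooth_on_sum op smooth_on_mult smooth_on_component s t h)
  then show ?thesis
  proof (rule smooth_on_cong[OF op])
    fix y assume "y \<in> ?V"
    then have y: "chart_inv c y \<in> fst c \<inter> fst b" using chart_inv_in[OF c] by blast
    have fm: "fibre_metric E (s (chart_inv c y)) (t (chart_inv c y)) =
        fibre_form b (chart_inv c y) (snd b (s (chart_inv c y))) (snd b (t (chart_inv c y)))"
      using st[OF y] y by (intro fibre_metric_triv[OF b]) auto
    show "(\<Sum>i\<in>UNIV. \<Sum>j\<in>UNIV. snd b (s (chart_inv c y)) $ i * snd b (t (chart_inv c y)) $ j *
      fibre_form b (chart_inv c y) (axis i 1) (axis j 1)) = fibre_metric E (s (chart_inv c y)) (t (chart_inv c y))"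
      unfolding fm by (rule bilinear_expand[OF fibre_form_bilinear[OF b], symmetric]) (use y in auto)
  qed
qed

lemma chart_image_UN: "snd c ` fst c = (\<Union>b\<in>trivs E. snd c ` (fst c \<inter> fst b))"
  using triv_exists by blast

lemma open_chart_triv: "c \<in> atlas E \<Longrightarrow> b \<in> trivs E \<Longrightarrow> open (snd c ` (fst c \<inter> fst b))"
  using open_chart_image[OF _ open_Int Int_lower1] chart_open(1) triv_open by blast

lemma smooth_funI:
  assumes "\<And>c b. c \<in> atlas E \<Longrightarrow> b \<in> trivs E \<Longrightarrow> smooth_on (\<lambda>y. f (chart_inv c y)) (snd c ` (fst c \<inter> fst b))"
  shows "smooth_fun E f"
  unfolding smooth_fun_def chart_image_UN o_def
  by (intro ballI smooth_on_UN open_chart_triv assms)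

lemma continuous_localI:
  fixes f :: "'m \<Rightarrow> 'b::topological_space"
  assumes "\<And>c b. c \<in> atlas E \<Longrightarrow> b \<in> trivs E \<Longrightarrow>
    continuous_on (snd c ` (fst c \<inter> fst b)) (\<lambda>y. f (chart_inv c y))"
  shows "continuous_on UNIV f"
proof -
  have "isCont f x" for x
  proof -
    obtain c b where c: "c \<in> atlas E" "x \<in> fst c" and b: "b \<in> trivs E" "x \<in> fst b"
      using chart_exists triv_exists by blast
    let ?U = "fst c \<inter> fst b"
    have "continuous_on ?U (\<lambda>z. f (chart_inv c (snd c z)))"
      by (rule continuous_on_compose2[OF assms[OF c(1) b(1)]])
         (auto intro: continuous_on_subset[OF continuous_on_chart[OF c(1)]])
    then have "continuous_on ?U f" by (rule continuous_on_eq) (use c in auto)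
    moreover have "open ?U" using chart_open(1)[OF c(1)] triv_open[OF b(1)] by auto
    ultimately show ?thesis using c b by (simp add: continuous_on_eq_continuous_at)
  qed
  then show ?thesis by (simp add: continuous_on_eq_continuous_at)
qed

lemma smooth_fun_continuous: "smooth_fun E f \<Longrightarrow> continuous_on UNIV f"
  by (rule continuous_localI, rule continuous_on_subset[OF smooth_on_imp_continuous_on])
     (auto simp: smooth_fun_def o_def)

lemma dir_deriv_compose:
  fixes u :: "'m \<Rightarrow> real"
  assumes u: "smooth_fun E u" and h: "(h has_real_derivative h') (at (u x))"
  shows "dir_deriv E (\<lambda>z. h (u z)) x v = h' * dir_deriv E u x v"
proof -
  let ?c = "chart_at E x"
  let ?D = "frechet_derivative (u \<circ> chart_inv ?c) (at (snd ?c x))"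
  have "(h has_derivative (*) h') (at ((u \<circ> chart_inv ?c) (snd ?c x)))"
    using h chart_at by (simp add: has_field_derivative_def)
  from has_derivative_compose[OF smooth_fun_has_derivative[OF u chart_at] this]
  have "(((\<lambda>z. h (u z)) \<circ> chart_inv ?c) has_derivative (\<lambda>\<xi>. h' * ?D \<xi>)) (at (snd ?c x))"
    by (simp add: o_def)
  from dir_deriv_has_derivative[OF this] show ?thesis by (simp add: dir_deriv_def Let_def)
qed

lemma section_proj: "smooth_section E s \<Longrightarrow> proj E (s x) = x"
  by (simp add: smooth_section_def)

lemma section_smooth:
  "smooth_section E s \<Longrightarrow> c \<in> atlas E \<Longrightarrow> b \<in> trivs E \<Longrightarrow>
    smooth_on (\<lambda>y. snd b (s (chart_inv c y))) (snd c ` (fst c \<inter> fst b))"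
  by (simp add: smooth_section_def o_def)

section \<open>Length of sections and multiplication by functions\<close>

definition norm_sq :: "('m \<Rightarrow> 'e) \<Rightarrow> 'm \<Rightarrow> real" where
  "norm_sq s x = fibre_metric E (s x) (s x)"

lemma smooth_norm_sq: "smooth_section E s \<Longrightarrow> smooth_fun E (norm_sq s)"
  unfolding norm_sq_def by (intro smooth_funI smooth_fibre_metric_local) (auto intro: section_smooth section_proj)

lemma fibre_metric_zero: "fibre_metric E (fibre_zero E x) (fibre_zero E x) = 0"
  using fibre_metric_triv[OF triv_at, of "fibre_zero E x" x "fibre_zero E x"]
    triv_fibre_zero[OF triv_at] bilinear_lzero[OF fibre_form_bilinear[OF triv_at]] by simp

lemma fibre_metric_nonneg: "fibre_metric E e e \<ge> 0"
  using fibre_metric_pos[of e] fibre_metric_zero[of "proj E e"]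
  by (cases "e = fibre_zero E (proj E e)") (auto simp: less_imp_le)

lemma norm_sq_nonneg: "norm_sq s x \<ge> 0"
  by (simp add: norm_sq_def fibre_metric_nonneg)

lemma norm_sq_eq_0: "proj E (s x) = x \<Longrightarrow> norm_sq s x = 0 \<longleftrightarrow> s x = fibre_zero E x"
  by (metis fibre_metric_pos fibre_metric_zero norm_sq_def less_irrefl)

text \<open>The dummy summand with factor 0 gives the product exactly the form in which the Leibniz
  rule of \<open>connection\<close> is stated.\<close>

definition scale_section :: "('m \<Rightarrow> real) \<Rightarrow> ('m \<Rightarrow> 'e) \<Rightarrow> 'm \<Rightarrow> 'e" where
  "scale_section \<phi> s = (\<lambda>z. fibre_comb E (\<phi> z) (s z) 0 (s z))"

lemma scale_section_triv:
  assumes "\<And>x. proj E (s x) = x" "b \<in> trivs E" "x \<in> fst b"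
  shows "snd b (scale_section \<phi> s x) = \<phi> x *\<^sub>R snd b (s x)"
  using triv_fibre_comb[of "s x" x "s x" b] assms by (simp add: scale_section_def)

lemma proj_scale_section: "(\<And>x. proj E (s x) = x) \<Longrightarrow> proj E (scale_section \<phi> s x) = x"
  by (simp add: scale_section_def proj_fibre_comb)

lemma smooth_scale_section:
  assumes s: "smooth_section E s" and \<phi>: "smooth_fun E \<phi>"
  shows "smooth_section E (scale_section \<phi> s)"
  unfolding smooth_section_def
proof (intro conjI allI ballI)
  show "proj E (scale_section \<phi> s x) = x" for x
    using section_proj[OF s] by (simp add: proj_scale_section)
next
  fix c b assume c: "c \<in> atlas E" and b: "b \<in> trivs E"
  let ?V = "snd c ` (fst c \<inter> fst b)"
  have "smooth_on (\<lambda>y. \<phi> (chart_inv c y)) ?V"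
    by (rule smooth_on_subset[of _ "snd c ` fst c"]) (use \<phi> c in \<open>auto simp: smooth_fun_def o_def\<close>)
  then have "smooth_on (\<lambda>y. \<phi> (chart_inv c y) *\<^sub>R snd b (s (chart_inv c y))) ?V"
    by (intro smooth_on_scaleR open_chart_triv[OF c b] section_smooth[OF s c b])
  then show "smooth_on (snd b \<circ> scale_section \<phi> s \<circ> chart_inv c) ?V"
  proof (rule smooth_on_cong[OF open_chart_triv[OF c b]])
    fix y assume "y \<in> ?V"
    then have "chart_inv c y \<in> fst c \<inter> fst b" using chart_inv_in[OF c] by blast
    then show "\<phi> (chart_inv c y) *\<^sub>R snd b (s (chart_inv c y)) = (snd b \<circ> scale_section \<phi> s \<circ> chart_inv c) y"
      using scale_section_triv[of s b, OF section_proj[OF s] b] by simp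
  qed
qed

lemma norm_sq_scale:
  assumes "\<And>x. proj E (s x) = x"
  shows "norm_sq (scale_section \<phi> s) x = (\<phi> x)\<^sup>2 * norm_sq s x"
  using assms
  by (simp add: norm_sq_def scale_section_def fibre_metric_comb_left fibre_metric_comb_right
      proj_fibre_comb[of _ x] power2_eq_square)

lemma
  assumes "v \<in> tangent_space E x" "smooth_section E s"
  shows conn_proj: "proj E (conn E x v s) = x"
    and conn_scale: "smooth_fun E \<phi> \<Longrightarrow> conn E x v (scale_section \<phi> s) =
      fibre_comb E (dir_deriv E \<phi> x v) (s x) (\<phi> x) (conn E x v s)"
    and conn_comb: "w \<in> tangent_space E x \<Longrightarrow>
      conn E x (tvec_comb a v a' w) s = fibre_comb E a (conn E x v s) a' (conn E x w s)"
  using con assms unfolding connection_def scale_section_def by blast+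

lemma dir_deriv_norm_sq:
  assumes "v \<in> tangent_space E x" "smooth_section E s"
  shows "dir_deriv E (norm_sq s) x v = 2 * fibre_metric E (conn E x v s) (s x)"
proof -
  have "dir_deriv E (norm_sq s) x v = fibre_metric E (conn E x v s) (s x) + fibre_metric E (s x) (conn E x v s)"
    using compat assms unfolding metric_compatible_def norm_sq_def by blast
  then show ?thesis
    using fibre_metric_sym[of "s x" "conn E x v s"] conn_proj[OF assms] section_proj[OF assms(2)] by simp
qed

lemma half_norm_sq_eq: "half_norm_sq E s = (\<lambda>x. norm_sq s x / 2)"
  by (simp add: half_norm_sq_def norm_sq_def fun_eq_iff)

lemma smooth_half_norm_sq:
  assumes "smooth_section E s"
  shows "smooth_fun E (half_norm_sq E s)"
proof -
  have "smooth_on (\<lambda>y. (1/2) * norm_sq s (chart_inv c y)) (snd c ` fst c)" if "c \<in> atlas E" for c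
    using smooth_norm_sq[OF assms] that chart_open(2)[OF that]
    by (intro smooth_on_mult smooth_on_const) (auto simp: smooth_fun_def o_def)
  then show ?thesis by (simp add: smooth_fun_def half_norm_sq_eq o_def)
qed

lemma dir_deriv_half_norm_sq:
  assumes "v \<in> tangent_space E x" "smooth_section E s"
  shows "dir_deriv E (half_norm_sq E s) x v = fibre_metric E (conn E x v s) (s x)"
  using dir_deriv_compose[OF smooth_norm_sq[OF assms(2)], of "\<lambda>t. t / 2" "1/2" x v]
    dir_deriv_norm_sq[OF assms] by (simp add: half_norm_sq_eq DERIV_cdivide)

lemma conn_norm_sq_frame:
  "conn_norm_sq E s x = (\<Sum>i\<in>UNIV. fibre_metric E (conn E x (frame x i) s) (conn E x (frame x i) s))"
  by (simp add: conn_norm_sq_def Let_def frame_def)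

lemma grad_half_norm_sq_frame:
  assumes "smooth_section E s"
  shows "grad_norm_sq E (half_norm_sq E s) x = (\<Sum>i\<in>UNIV. (fibre_metric E (conn E x (frame x i) s) (s x))\<^sup>2)"
  by (simp add: grad_norm_sq_frame[OF smooth_half_norm_sq[OF assms]] dir_deriv_half_norm_sq[OF frame_tangent assms])

text \<open>Let \<open>\<beta> i\<close> be the product of the covariant derivative along
  \<open>frame x i\<close> with \<open>s x\<close>, that is, the derivative of \<open>F\<close>. By
  the Leibniz rule the new covariant derivative is \<open>2 h' \<beta> i\<close> times
  \<open>s x\<close> plus \<open>h u\<close> times the old one. Expanding its square gives the first
  formula. The second differentiates \<open>F = (h u)^2 u / 2\<close>, where \<open>u\<close> has
  derivative \<open>2 \<beta> i\<close>.\<close>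

lemma
  assumes s: "smooth_section E s" and \<phi>: "smooth_fun E (\<lambda>z. h (norm_sq s z))"
    and h: "(h has_real_derivative h') (at (norm_sq s x))"
  defines "s' \<equiv> scale_section (\<lambda>z. h (norm_sq s z)) s" and "u \<equiv> norm_sq s x"
  shows conn_norm_sq_scale: "conn_norm_sq E s' x =
      (h u)\<^sup>2 * conn_norm_sq E s x + 4 * h' * (h u + h' * u) * grad_norm_sq E (half_norm_sq E s) x"
    and grad_norm_sq_scale: "grad_norm_sq E (half_norm_sq E s') x =
      ((h u)\<^sup>2 + 2 * h u * h' * u)\<^sup>2 * grad_norm_sq E (half_norm_sq E s) x"
proof -
  have s': "smooth_section E s'" unfolding s'_def by (rule smooth_scale_section[OF s \<phi>])
  define \<beta> where "\<beta> = (\<lambda>i. fibre_metric E (conn E x (frame x i) s) (s x))"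
  have pr: "proj E (s x) = x" "proj E (conn E x (frame x i) s) = x" for i
    using section_proj[OF s] conn_proj[OF frame_tangent s] by auto
  have sy: "fibre_metric E (s x) (conn E x (frame x i) s) = \<beta> i" for i
    using fibre_metric_sym[of "s x" "conn E x (frame x i) s"] pr by (simp add: \<beta>_def)
  have d: "dir_deriv E (\<lambda>z. h (norm_sq s z)) x (frame x i) = h' * (2 * \<beta> i)" for i
    by (simp add: dir_deriv_compose[OF smooth_norm_sq[OF s] h] dir_deriv_norm_sq[OF frame_tangent s] \<beta>_def)
  have c: "conn E x (frame x i) s' = fibre_comb E (h' * (2 * \<beta> i)) (s x) (h u) (conn E x (frame x i) s)" for i
    unfolding s'_def conn_scale[OF frame_tangent s \<phi>] d u_def ..
  have "fibre_metric E (conn E x (frame x i) s') (conn E x (frame x i) s') =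
     (h u)\<^sup>2 * fibre_metric E (conn E x (frame x i) s) (conn E x (frame x i) s) + 4 * h' * (h u + h' * u) * (\<beta> i)\<^sup>2" for i
  proof -
    have "fibre_metric E (s x) (s x) = u" by (simp add: u_def norm_sq_def)
    then show ?thesis unfolding c
      by (simp add: fibre_metric_comb_left fibre_metric_comb_right proj_fibre_comb[of _ x] pr sy \<beta>_def[symmetric]
        flip: fun_cong[OF \<beta>_def]) (simp add: power2_eq_square algebra_simps)
  qed
  then show "conn_norm_sq E s' x =
      (h u)\<^sup>2 * conn_norm_sq E s x + 4 * h' * (h u + h' * u) * grad_norm_sq E (half_norm_sq E s) x"
    by (simp add: conn_norm_sq_frame grad_half_norm_sq_frame[OF s] \<beta>_def sum.distrib sum_distrib_left)
  have "fibre_metric E (conn E x (frame x i) s') (s' x) = ((h u)\<^sup>2 + 2 * h u * h' * u) * \<beta> i" for i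
  proof -
    let ?k = "\<lambda>t. (h t)\<^sup>2 * t / 2"
    have "(?k has_real_derivative (h u)\<^sup>2 / 2 + h u * h' * u) (at (norm_sq s x))"
      using h by (auto intro!: derivative_eq_intros simp: u_def power2_eq_square)
    from dir_deriv_compose[OF smooth_norm_sq[OF s] this, of "frame x i"]
    have "dir_deriv E (half_norm_sq E s') x (frame x i) = ((h u)\<^sup>2 / 2 + h u * h' * u) * (2 * \<beta> i)"
      by (simp add: half_norm_sq_eq s'_def norm_sq_scale[OF section_proj[OF s]] dir_deriv_norm_sq[OF frame_tangent s] \<beta>_def)
    then show ?thesis
      by (simp add: dir_deriv_half_norm_sq[OF frame_tangent s'] algebra_simps)
  qed
  then show "grad_norm_sq E (half_norm_sq E s') x =
      ((h u)\<^sup>2 + 2 * h u * h' * u)\<^sup>2 * grad_norm_sq E (half_norm_sq E s) x"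
    by (simp add: grad_half_norm_sq_frame[OF s] grad_half_norm_sq_frame[OF s'] \<beta>_def sum_distrib_left power_mult_distrib)
qed

section \<open>Continuity of the energy densities\<close>

lemma conn_smooth_local:
  assumes "smooth_section E s" "c \<in> atlas E" "b \<in> trivs E"
  shows "smooth_on (\<lambda>y. snd b (conn E (chart_inv c y) (coord_vec E c (chart_inv c y) \<xi>) s)) (snd c ` (fst c \<inter> fst b))"
  using con assms unfolding connection_def Let_def by blast

lemma gram_det_pos: "c \<in> atlas E \<Longrightarrow> x \<in> fst c \<Longrightarrow> det (gram_matrix E c x) > 0"
  using pos_form.det_gram_pos[OF coord_metric_form] gram_eq by metis

lemma gram_continuous:
  assumes c: "c \<in> atlas E"
  shows "continuous_on (snd c ` fst c) (\<lambda>y. gram_matrix E c (chart_inv c y) $ i $ j)"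
  using rmet c unfolding riemannian_metric_def gram_matrix_def Let_def
  by (simp add: smooth_on_imp_continuous_on)

text \<open>In a chart the trace is the expression of \<open>frame_trace\<close>, whose coefficients
  are continuous because the Gram matrix is continuous with nonzero determinant.\<close>

lemma trace_continuous:
  fixes B :: "'m \<Rightarrow> ('m, 'n) tvec \<Rightarrow> ('m, 'n) tvec \<Rightarrow> real"
  assumes B: "\<And>c x. c \<in> atlas E \<Longrightarrow> x \<in> fst c \<Longrightarrow> bilinear (\<lambda>\<xi> \<eta>. B x (coord_vec E c x \<xi>) (coord_vec E c x \<eta>))"
    and cont: "\<And>c b \<xi> \<eta>. c \<in> atlas E \<Longrightarrow> b \<in> trivs E \<Longrightarrow> continuous_on (snd c ` (fst c \<inter> fst b))
      (\<lambda>y. B (chart_inv c y) (coord_vec E c (chart_inv c y) \<xi>) (coord_vec E c (chart_inv c y) \<eta>))"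
  shows "continuous_on UNIV (\<lambda>x. \<Sum>i\<in>UNIV. B x (frame x i) (frame x i))"
proof (rule continuous_localI)
  fix c b assume c: "c \<in> atlas E" and b: "b \<in> trivs E"
  let ?V = "snd c ` (fst c \<inter> fst b)"
  have V: "chart_inv c y \<in> fst c" if "y \<in> ?V" for y using that chart_inv_in[OF c, of "fst c \<inter> fst b"] by blast
  have "continuous_on ?V (\<lambda>y. \<Sum>k\<in>UNIV. \<Sum>l\<in>UNIV. cramer_inv (gram_matrix E c (chart_inv c y)) $ k $ l *
       B (chart_inv c y) (coord_vec E c (chart_inv c y) (axis k 1)) (coord_vec E c (chart_inv c y) (axis l 1)))"
  proof (intro continuous_on_sum continuous_on_mult cont c b continuous_on_cramer_inv)
    show "continuous_on ?V (\<lambda>y. gram_matrix E c (chart_inv c y) $ i $ j)" for i j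
      by (rule continuous_on_subset[OF gram_continuous[OF c]]) auto
    show "det (gram_matrix E c (chart_inv c y)) \<noteq> 0" if "y \<in> ?V" for y
      using gram_det_pos[OF c V[OF that]] by simp
  qed
  then show "continuous_on ?V (\<lambda>y. \<Sum>i\<in>UNIV. B (chart_inv c y) (frame (chart_inv c y) i) (frame (chart_inv c y) i))"
    by (rule continuous_on_eq) (use frame_trace[OF c V B[OF c V]] in simp)
qed

lemma
  assumes s: "smooth_section E s"
  shows conn_norm_sq_continuous: "continuous_on UNIV (conn_norm_sq E s)"
    and grad_norm_sq_continuous: "continuous_on UNIV (grad_norm_sq E (half_norm_sq E s))"
proof -
  note t = coord_vec_tangent
  have cc: "conn E x (coord_vec E c x (a *\<^sub>R \<xi> + a' *\<^sub>R \<eta>)) s =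
    fibre_comb E a (conn E x (coord_vec E c x \<xi>) s) a' (conn E x (coord_vec E c x \<eta>) s)"
    if "c \<in> atlas E" "x \<in> fst c" for c x a \<xi> a' \<eta>
    using that by (simp add: coord_vec_comb conn_comb[OF t s t])
  have "continuous_on UNIV (\<lambda>x. \<Sum>i\<in>UNIV. fibre_metric E (conn E x (frame x i) s) (conn E x (frame x i) s))"
  proof (rule trace_continuous[where B = "\<lambda>x v w. fibre_metric E (conn E x v s) (conn E x w s)"])
    fix c x assume c: "c \<in> atlas E" "x \<in> fst c"
    show "bilinear (\<lambda>\<xi> \<eta>. fibre_metric E (conn E x (coord_vec E c x \<xi>) s) (conn E x (coord_vec E c x \<eta>) s))"
      unfolding bilinear_def
      by (intro conjI allI linearI_combination)
        (simp_all add: cc[OF c] fibre_metric_comb_left fibre_metric_comb_right conn_proj[OF t[OF c] s])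
  next
    fix c b \<xi> \<eta> assume c: "c \<in> atlas E" and b: "b \<in> trivs E"
    show "continuous_on (snd c ` (fst c \<inter> fst b)) (\<lambda>y. fibre_metric E
      (conn E (chart_inv c y) (coord_vec E c (chart_inv c y) \<xi>) s) (conn E (chart_inv c y) (coord_vec E c (chart_inv c y) \<eta>) s))"
      by (rule smooth_on_imp_continuous_on, rule smooth_fibre_metric_local[OF c b])
        (use conn_proj[OF t[OF c] s] conn_smooth_local[OF s c b] in auto)
  qed
  then show "continuous_on UNIV (conn_norm_sq E s)" by (simp add: conn_norm_sq_frame[abs_def])
  \<comment> \<open>The square is written as a product to exhibit it as the diagonal of a bilinear
    form in two tangent vectors.\<close>
  have "continuous_on UNIV (\<lambda>x. \<Sum>i\<in>UNIV. fibre_metric E (conn E x (frame x i) s) (s x) * fibre_metric E (conn E x (frame x i) s) (s x))"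
  proof (rule trace_continuous[where B = "\<lambda>x v w. fibre_metric E (conn E x v s) (s x) * fibre_metric E (conn E x w s) (s x)"])
    fix c x assume c: "c \<in> atlas E" "x \<in> fst c"
    show "bilinear (\<lambda>\<xi> \<eta>. fibre_metric E (conn E x (coord_vec E c x \<xi>) s) (s x) * fibre_metric E (conn E x (coord_vec E c x \<eta>) s) (s x))"
      unfolding bilinear_def
      by (intro conjI allI linearI_combination)
        (simp_all add: cc[OF c] fibre_metric_comb_left conn_proj[OF t[OF c] s] section_proj[OF s] algebra_simps)
  next
    fix c b \<xi> \<eta> assume c: "c \<in> atlas E" and b: "b \<in> trivs E"
    have "continuous_on (snd c ` (fst c \<inter> fst b)) (\<lambda>y. fibre_metric E
      (conn E (chart_inv c y) (coord_vec E c (chart_inv c y) \<xi>) s) (s (chart_inv c y)))" for \<xi>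
      by (rule smooth_on_imp_continuous_on, rule smooth_fibre_metric_local[OF c b])
        (use conn_proj[OF t[OF c] s] conn_smooth_local[OF s c b] section_proj[OF s] section_smooth[OF s c b] in auto)
    then show "continuous_on (snd c ` (fst c \<inter> fst b)) (\<lambda>y. fibre_metric E
      (conn E (chart_inv c y) (coord_vec E c (chart_inv c y) \<xi>) s) (s (chart_inv c y)) *
      fibre_metric E (conn E (chart_inv c y) (coord_vec E c (chart_inv c y) \<eta>) s) (s (chart_inv c y)))"
      by (intro continuous_on_mult)
  qed
  then show "continuous_on UNIV (grad_norm_sq E (half_norm_sq E s))"
    by (simp add: grad_half_norm_sq_frame[OF s, abs_def] power2_eq_square)
qed

lemma conn_norm_sq_nonneg: "conn_norm_sq E s x \<ge> 0"
  by (simp add: conn_norm_sq_frame sum_nonneg fibre_metric_nonneg)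

lemma grad_norm_sq_nonneg: "smooth_section E s \<Longrightarrow> grad_norm_sq E (half_norm_sq E s) x \<ge> 0"
  by (simp add: grad_half_norm_sq_frame sum_nonneg)

end

section \<open>Integration over a compact manifold\<close>

text \<open>Dominated convergence for difference quotients: \<open>f'\<close> is bounded on the
  compact set \<open>{-1..1} \<times> UNIV\<close>, the mean value inequality passes the bound on to
  the quotients, and a constant is integrable for a finite measure.\<close>

lemma has_real_derivative_integral_compact:
  fixes f f' :: "real \<Rightarrow> 'a::topological_space \<Rightarrow> real"
  assumes "finite_measure M" and sets: "sets M = sets borel" and comp: "compact (UNIV :: 'a set)"
    and cont: "\<And>t. continuous_on UNIV (f t)"
    and der: "\<And>t x. ((\<lambda>t. f t x) has_real_derivative f' t x) (at t)"
    and cont': "continuous_on ({-1..1} \<times> UNIV) (\<lambda>(t, x). f' t x)"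
  shows "((\<lambda>t. LINT x|M. f t x) has_real_derivative (LINT x|M. f' 0 x)) (at 0)"
proof -
  interpret finite_measure M by fact
  have meas: "h \<in> borel_measurable M" if "continuous_on UNIV h" for h :: "'a \<Rightarrow> real"
    using borel_measurable_continuous_onI[OF that] sets measurable_cong_sets by blast
  have int: "integrable M h" if h: "continuous_on UNIV h" for h :: "'a \<Rightarrow> real"
  proof -
    have "bounded (range h)" using compact_continuous_image[OF h comp] compact_imp_bounded by blast
    then obtain C where "\<And>x. norm (h x) \<le> C" by (auto simp: bounded_iff)
    then show ?thesis using integrable_const_bound[of h C] meas[OF h] by simp
  qed
  have "compact ({-1..1::real} \<times> (UNIV :: 'a set))" by (intro compact_Times comp) simp
  from compact_imp_bounded[OF compact_continuous_image[OF cont' this]]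
  obtain C where "\<And>z. z \<in> {-1..1} \<times> UNIV \<Longrightarrow> norm ((\<lambda>(t, x). f' t x) z) \<le> C"
    unfolding bounded_iff by blast
  then have C: "\<bar>f' t x\<bar> \<le> C" if "\<bar>t\<bar> \<le> 1" for t x using that by (force simp: abs_le_iff)
  then have C0: "0 \<le> C" using abs_ge_zero order_trans by (metis abs_zero zero_le_one)
  have lip: "\<bar>(f t x - f 0 x) / t\<bar> \<le> C" if "\<bar>t\<bar> < 1" for t x
  proof (cases "t = 0")
    case False
    have "norm (f t x - f 0 x) \<le> C * norm (t - 0)"
    proof (rule field_differentiable_bound[of "{-1..1}"])
      show "((\<lambda>t. f t x) has_field_derivative f' s x) (at s within {-1..1})" for s
        using der has_field_derivative_at_within by blast
    qed (use that C in auto)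
    then show ?thesis using False by (simp add: field_simps)
  qed (simp add: C0)
  have cont0: "continuous_on UNIV (f' 0)"
  proof -
    have "continuous_on UNIV (\<lambda>x::'a. (0::real, x))" by (intro continuous_intros)
    from continuous_on_compose2[OF cont' this] show ?thesis by (simp add: image_subset_iff)
  qed
  have "((\<lambda>t. ((LINT x|M. f t x) - (LINT x|M. f 0 x)) / (t - 0)) \<longlongrightarrow> (LINT x|M. f' 0 x)) (at 0)"
    unfolding tendsto_at_iff_sequentially
  proof (intro allI impI)
    fix X :: "nat \<Rightarrow> real" assume X: "\<forall>i. X i \<in> UNIV - {0}" "X \<longlonglongrightarrow> 0"
    define s where "s i x = (if \<bar>X i\<bar> < 1 then (f (X i) x - f 0 x) / X i else 0)" for i x
    have ev: "eventually (\<lambda>i. \<bar>X i\<bar> < 1) sequentially"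
      using order_tendstoD[OF tendsto_rabs[OF X(2)], of 1] by simp
    have "(\<lambda>i. LINT x|M. s i x) \<longlonglongrightarrow> (LINT x|M. f' 0 x)"
    proof (rule integral_dominated_convergence[where w = "\<lambda>_. C"])
      show "f' 0 \<in> borel_measurable M" by (rule meas[OF cont0])
      show "s i \<in> borel_measurable M" for i
        unfolding s_def[abs_def] divide_inverse
        by (rule meas, cases "\<bar>X i\<bar> < 1") (simp_all add: cont continuous_on_diff continuous_on_mult_right)
      show "AE x in M. (\<lambda>i. s i x) \<longlonglongrightarrow> f' 0 x"
      proof (rule AE_I2)
        fix x
        have "((\<lambda>t. (f t x - f 0 x) / (t - 0)) \<longlongrightarrow> f' 0 x) (at 0)"
          using der[of x 0] by (simp add: has_field_derivative_iff)
        then have "(\<lambda>i. (f (X i) x - f 0 x) / X i) \<longlonglongrightarrow> f' 0 x"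
          using X unfolding tendsto_at_iff_sequentially o_def by auto
        then show "(\<lambda>i. s i x) \<longlonglongrightarrow> f' 0 x"
          by (rule Lim_transform_eventually) (use ev in \<open>auto simp: s_def elim: eventually_mono\<close>)
      qed
      show "AE x in M. norm (s i x) \<le> C" for i
        using lip C0 by (auto simp: s_def)
    qed simp
    then show "((\<lambda>t. ((LINT x|M. f t x) - (LINT x|M. f 0 x)) / (t - 0)) \<circ> X) \<longlonglongrightarrow> (LINT x|M. f' 0 x)"
    proof (rule Lim_transform_eventually)
      show "eventually (\<lambda>i. (LINT x|M. s i x) = ((\<lambda>t. ((LINT x|M. f t x) - (LINT x|M. f 0 x)) / (t - 0)) \<circ> X) i) sequentially"
        using ev by eventually_elim (simp add: s_def int cont)
    qed
  qed
  then show ?thesis by (simp add: has_field_derivative_iff)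
qed

locale compact_metric_vb = metric_vb E
  for E :: "('m::{t2_space,second_countable_topology}, 'n::finite,
               'e::topological_space, 'r::finite) metric_bundle" +
  fixes vol :: "'m measure"
  assumes comp: "compact (UNIV :: 'm set)" and vol: "is_riemannian_volume E vol"
begin

lemma vol_sets: "sets vol = sets borel"
  using vol by (simp add: is_riemannian_volume_def)

lemma vol_space: "space vol = UNIV"
  using sets_eq_imp_space_eq[OF vol_sets] by simp

lemma emeasure_vol_chart:
  assumes c: "c \<in> atlas E" and W: "open W" "W \<subseteq> snd c ` fst c"
  shows "emeasure vol (chart_inv c ` W) =
    (\<integral>\<^sup>+y. ennreal (sqrt (det (gram_matrix E c (chart_inv c y)))) * indicator W y \<partial>lborel)"
proof -
  have eq: "snd c ` chart_inv c ` W = W" using chart_chart_inv[OF c] W by force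
  have "chart_inv c ` W \<in> sets borel" using open_chart_vimage[OF c W] by simp
  moreover have "chart_inv c ` W \<subseteq> fst c" using chart_inv_in[OF c order_refl] W by blast
  ultimately have "emeasure vol (chart_inv c ` W) = (\<integral>\<^sup>+y. ennreal (sqrt (det (gram_matrix E c (chart_inv c y)))) *
      indicator (snd c ` chart_inv c ` W) y \<partial>lborel)"
    using vol c unfolding is_riemannian_volume_def by blast
  then show ?thesis unfolding eq .
qed

lemma chart_ball:
  assumes "open U" "x \<in> U"
  obtains c r where "c \<in> atlas E" "x \<in> fst c" "r > 0" "cball (snd c x) r \<subseteq> snd c ` (fst c \<inter> U)"
proof -
  obtain c where c: "c \<in> atlas E" "x \<in> fst c" using chart_exists by blast
  have "open (snd c ` (fst c \<inter> U))"
    by (rule open_chart_image[OF c(1) open_Int[OF chart_open(1)[OF c(1)] assms(1)] Int_lower1])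
  moreover have "snd c x \<in> snd c ` (fst c \<inter> U)" using c assms by blast
  ultimately show ?thesis using that[OF c] open_contains_cball by metis
qed

lemma gram_det_continuous:
  assumes c: "c \<in> atlas E" and S: "S \<subseteq> snd c ` fst c"
  shows "continuous_on S (\<lambda>y. sqrt (det (gram_matrix E c (chart_inv c y))))"
  by (intro continuous_on_real_sqrt continuous_on_det continuous_on_subset[OF gram_continuous[OF c] S])

text \<open>The volume density is bounded on closed coordinate balls, so the open balls have finite
  volume, and finitely many cover the compact manifold.\<close>

lemma finite_vol: "finite_measure vol"
proof -
  have "\<exists>U. open U \<and> x \<in> U \<and> emeasure vol U < \<infinity>" for x
  proof -
    obtain c r where c: "c \<in> atlas E" "x \<in> fst c" and r: "r > 0" "cball (snd c x) r \<subseteq> snd c ` fst c"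
      using chart_ball[OF open_UNIV UNIV_I, of x] by (metis Int_UNIV_right)
    let ?B = "ball (snd c x) r" and ?s = "\<lambda>y. sqrt (det (gram_matrix E c (chart_inv c y)))"
    have B: "?B \<subseteq> snd c ` fst c" using r ball_subset_cball by blast
    have "bounded (?s ` cball (snd c x) r)"
      by (rule compact_imp_bounded, rule compact_continuous_image[OF gram_det_continuous[OF c(1) r(2)]]) simp
    then obtain K where K: "\<And>y. y \<in> cball (snd c x) r \<Longrightarrow> \<bar>?s y\<bar> \<le> K"
      unfolding bounded_iff by (metis image_eqI real_norm_def)
    have "emeasure vol (chart_inv c ` ?B) = (\<integral>\<^sup>+y. ennreal (?s y) * indicator ?B y \<partial>lborel)"
      by (rule emeasure_vol_chart[OF c(1) open_ball B])
    also have "\<dots> \<le> (\<integral>\<^sup>+y. ennreal K * indicator ?B y \<partial>lborel)"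
      by (intro nn_integral_mono) (auto simp: indicator_def intro!: ennreal_leI abs_le_D1[OF K])
    also have "\<dots> = ennreal K * emeasure lborel ?B" by (rule nn_integral_cmult_indicator) simp
    also have "\<dots> < \<infinity>" using emeasure_lborel_ball_finite[of "snd c x" r] by (simp add: ennreal_mult_less_top)
    finally have "emeasure vol (chart_inv c ` ?B) < \<infinity>" .
    moreover have "x \<in> chart_inv c ` ?B" using c r by (intro image_eqI[of _ _ "snd c x"]) auto
    ultimately show ?thesis using open_chart_vimage[OF c(1) open_ball B] by blast
  qed
  then have "\<forall>x. \<exists>U. open U \<and> x \<in> U \<and> emeasure vol U < \<infinity>" by blast
  from choice[OF this] obtain U where U: "\<And>x. open (U x)" "\<And>x. x \<in> U x" "\<And>x. emeasure vol (U x) < \<infinity>"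
    by blast
  obtain I where I: "finite I" "UNIV \<subseteq> (\<Union>x\<in>I. U x)"
    by (rule compactE_image[OF comp, of UNIV U]) (use U in blast)+
  have "emeasure vol UNIV \<le> (\<Sum>x\<in>I. emeasure vol (U x))"
    using I U emeasure_subadditive_finite[of I U vol] vol_sets by (simp add: top.extremum_unique image_subset_iff)
  also have "\<dots> < \<infinity>" using I U by simp
  finally show ?thesis by (intro finite_measureI) (simp add: vol_space)
qed

sublocale vol: finite_measure vol by (rule finite_vol)

text \<open>An open set contains a coordinate ball, on whose closure the volume density attains a
  positive minimum.\<close>

lemma vol_open_pos:
  assumes "open U" "U \<noteq> {}"
  shows "emeasure vol U > 0"
proof -
  obtain x where "x \<in> U" using assms by auto
  then obtain c r where c: "c \<in> atlas E" "x \<in> fst c" and r: "r > 0" "cball (snd c x) r \<subseteq> snd c ` (fst c \<inter> U)"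
    using chart_ball[OF assms(1)] by metis
  let ?B = "ball (snd c x) r" and ?s = "\<lambda>y. sqrt (det (gram_matrix E c (chart_inv c y)))"
  have B: "?B \<subseteq> snd c ` (fst c \<inter> U)" using r ball_subset_cball by blast
  then have B': "?B \<subseteq> snd c ` fst c" by blast
  have r': "cball (snd c x) r \<subseteq> snd c ` fst c" using r by blast
  obtain y0 where y0: "y0 \<in> cball (snd c x) r" "\<And>y. y \<in> cball (snd c x) r \<Longrightarrow> ?s y0 \<le> ?s y"
    using continuous_attains_inf[OF compact_cball _ gram_det_continuous[OF c(1) r']] r by fastforce
  have "?s y0 > 0" using gram_det_pos[OF c(1) chart_inv_in[OF c(1) order_refl, of y0]] y0(1) r' by auto
  moreover have "emeasure lborel ?B > 0"
    using content_ball_pos[OF r(1), of "snd c x"] by (auto simp: measure_def zero_less_iff_neq_zero)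
  ultimately have "0 < ennreal (?s y0) * emeasure lborel ?B" by (simp add: ennreal_zero_less_mult_iff)
  also have "\<dots> = (\<integral>\<^sup>+y. ennreal (?s y0) * indicator ?B y \<partial>lborel)"
    by (rule nn_integral_cmult_indicator[symmetric]) simp
  also have "\<dots> \<le> (\<integral>\<^sup>+y. ennreal (?s y) * indicator ?B y \<partial>lborel)"
    using y0 by (intro nn_integral_mono) (auto simp: indicator_def intro!: ennreal_leI)
  also have "\<dots> = emeasure vol (chart_inv c ` ?B)"
    by (rule emeasure_vol_chart[OF c(1) open_ball B', symmetric])
  also have "\<dots> \<le> emeasure vol U"
    by (rule emeasure_mono) (use chart_inv_in[OF c(1), of "fst c \<inter> U"] B assms vol_sets in auto)
  finally show ?thesis .
qed

lemma vol_integrable: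
  fixes h :: "'m \<Rightarrow> real"
  assumes h: "continuous_on UNIV h"
  shows "integrable vol h"
proof -
  have "h \<in> borel_measurable vol"
    using borel_measurable_continuous_onI[OF h] vol_sets measurable_cong_sets by blast
  moreover have "bounded (range h)" using compact_continuous_image[OF h comp] compact_imp_bounded by blast
  then obtain C where "\<And>x. norm (h x) \<le> C" by (auto simp: bounded_iff)
  ultimately show ?thesis using vol.integrable_const_bound[of h C] by simp
qed

text \<open>The integrand vanishes almost everywhere; the set where it does not is open by
  continuity, and a nonempty open set has positive volume.\<close>

lemma integral_zero_imp_zero:
  fixes h :: "'m \<Rightarrow> real"
  assumes h: "continuous_on UNIV h" "\<And>x. h x \<ge> 0" and 0: "(LINT x|vol. h x) = 0"
  shows "h x = 0"
proof (rule ccontr)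
  assume "h x \<noteq> 0"
  then have ne: "{x. h x \<noteq> 0} \<noteq> {}" by blast
  have op: "open {x. h x \<noteq> 0}" using h(1) by (intro open_Collect_neq) auto
  have "AE x in vol. h x = 0"
    using integral_nonneg_eq_0_iff_AE[OF vol_integrable[OF h(1)]] h(2) 0 by simp
  then have "emeasure vol {x. h x \<noteq> 0} = 0"
    using AE_iff_measurable[of "{x. h x \<noteq> 0}" vol "\<lambda>x. h x = 0"] op vol_sets vol_space by simp
  then show False using vol_open_pos[OF op ne] by simp
qed

lemma vol_derivative:
  assumes "\<And>t. continuous_on UNIV (f t)"
    and "\<And>t x. ((\<lambda>t. f t x) has_real_derivative f' t x) (at t)"
    and "continuous_on ({-1..1} \<times> UNIV) (\<lambda>(t, x). f' t x)"
  shows "((\<lambda>t. LINT x|vol. f t x) has_real_derivative (LINT x|vol. f' 0 x)) (at 0)"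
  by (rule has_real_derivative_integral_compact[OF finite_vol vol_sets comp assms])

section \<open>The radial variation\<close>

definition radial_factor :: "('m \<Rightarrow> 'e) \<Rightarrow> real \<Rightarrow> real \<Rightarrow> 'm \<Rightarrow> real" where
  "radial_factor s a t z = 1 + t * (1 + norm_sq s z) powr a"

definition radial_variation :: "('m \<Rightarrow> 'e) \<Rightarrow> real \<Rightarrow> real \<Rightarrow> 'm \<Rightarrow> 'e" where
  "radial_variation s a t = scale_section (radial_factor s a t) s"

lemma one_plus_norm_sq_pos: "1 + norm_sq s x > 0"
  using norm_sq_nonneg[of s x] by linarith

lemma smooth_norm_sq_powr:
  assumes s: "smooth_section E s" and c: "c \<in> atlas E"
  shows "smooth_on (\<lambda>y. (1 + norm_sq s (chart_inv c y)) powr a) (snd c ` fst c)"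
proof (rule smooth_on_powr[OF chart_open(2)[OF c]])
  show "smooth_on (\<lambda>y. 1 + norm_sq s (chart_inv c y)) (snd c ` fst c)"
    using smooth_norm_sq[OF s] c chart_open(2)[OF c]
    by (intro smooth_on_add smooth_on_const) (auto simp: smooth_fun_def o_def)
qed (rule one_plus_norm_sq_pos)

lemma smooth_radial_factor:
  assumes s: "smooth_section E s"
  shows "smooth_fun E (radial_factor s a t)"
  unfolding smooth_fun_def o_def radial_factor_def
  by (intro ballI smooth_on_add smooth_on_const smooth_on_mult smooth_norm_sq_powr[OF s]) (auto intro: chart_open)

lemma radial_variation_0:
  assumes s: "smooth_section E s"
  shows "radial_variation s a 0 = s"
proof
  fix x
  have p: "proj E (s x) = x" using section_proj[OF s] .
  show "radial_variation s a 0 x = s x"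
  proof (rule fibre_eqI[OF triv_at(1)[of x]])
    show "snd (triv_at E x) (radial_variation s a 0 x) = snd (triv_at E x) (s x)"
      using scale_section_triv[OF section_proj[OF s] triv_at]
      by (simp add: radial_variation_def radial_factor_def)
  qed (use p triv_at(2)[of x] in \<open>simp_all add: radial_variation_def proj_scale_section[OF section_proj[OF s]]\<close>)
qed

lemma smooth_radial_variation:
  assumes s: "smooth_section E s"
  shows "smooth_variation E s (radial_variation s a)"
  unfolding smooth_variation_def
proof (intro conjI exI[of _ 1] ballI allI)
  show "radial_variation s a 0 = s" by (rule radial_variation_0[OF s])
  show "(0::real) < 1" by simp
  show "proj E (radial_variation s a t x) = x" for t x
    unfolding radial_variation_def by (rule proj_scale_section[OF section_proj[OF s]])
next
  fix c b assume c: "c \<in> atlas E" and b: "b \<in> trivs E"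
  let ?V = "snd c ` (fst c \<inter> fst b)"
  let ?S = "{-1<..<1::real} \<times> ?V"
  have V: "open ?V" by (rule open_chart_triv[OF c b])
  then have S: "open ?S" by (intro open_Times) auto
  \<comment> \<open>Joint smoothness in \<open>(t, y)\<close> comes from pulling back along the
    linear projections: \<open>t\<close> is a coordinate, and all other ingredients depend on
    \<open>y\<close> alone.\<close>
  have lift: "smooth_on (\<lambda>z. f (snd z)) ?S" if "smooth_on f ?V" for f :: "real^'n \<Rightarrow> 'z::real_normed_vector"
    by (rule smooth_on_subset[OF smooth_on_comp_linear[OF bounded_linear_snd V that]]) auto
  have "smooth_on (\<lambda>z. (1 + fst z * (1 + norm_sq s (chart_inv c (snd z))) powr a) *\<^sub>R snd b (s (chart_inv c (snd z)))) ?S"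
    by (intro smooth_on_scaleR smooth_on_add smooth_on_mult S smooth_on_const smooth_on_bounded_linear[OF bounded_linear_fst]
        lift[OF section_smooth[OF s c b]] lift[OF smooth_on_subset[OF smooth_norm_sq_powr[OF s c]]]) auto
  then show "smooth_on (\<lambda>(t, y). snd b (radial_variation s a t (chart_inv c y))) ?S"
  proof (rule smooth_on_cong[OF S])
    fix z assume "z \<in> ?S"
    then have "chart_inv c (snd z) \<in> fst c \<inter> fst b" using chart_inv_in[OF c, of "fst c \<inter> fst b" "snd z"] by auto
    then show "(1 + fst z * (1 + norm_sq s (chart_inv c (snd z))) powr a) *\<^sub>R snd b (s (chart_inv c (snd z))) =
       (case z of (t, y) \<Rightarrow> snd b (radial_variation s a t (chart_inv c y)))"
      using scale_section_triv[OF section_proj[OF s] b]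
      by (simp add: radial_variation_def radial_factor_def split_def)
  qed
qed

end

section \<open>First variation of the energy in radial directions\<close>

text \<open>All quantities are frozen at one point of the manifold: \<open>w\<close> stands for
  \<open>(1 + u) powr a\<close> and \<open>w'\<close> for its derivative in \<open>u\<close>, so
  \<open>R\<close> is the rescaled density with \<open>h = 1 + t w\<close> and
  \<open>h' = t w'\<close>. As \<open>N t \<ge> 1\<close>, the power is differentiable for every
  \<open>t\<close>, also where \<open>1 + t w\<close> vanishes.\<close>

lemma radial_energy_density_derivative:
  fixes u w w' A B p q :: real
  assumes u: "u \<ge> 0"
  defines "N \<equiv> \<lambda>t. 1 + (1 + t * w)\<^sup>2 * u"
    and "R \<equiv> \<lambda>t. (1 + t * w)\<^sup>2 * A + 4 * (t * w') * (1 + t * w + t * w' * u) * B +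
       q * (((1 + t * w)\<^sup>2 + 2 * (1 + t * w) * (t * w') * u)\<^sup>2 * B)"
    and "R' \<equiv> \<lambda>t. 2 * (1 + t * w) * w * A + 4 * w' * (1 + t * w + t * w' * u) * B + 4 * (t * w') * (w + w' * u) * B +
       q * (2 * ((1 + t * w)\<^sup>2 + 2 * (1 + t * w) * (t * w') * u) *
         (2 * (1 + t * w) * w + 2 * w * (t * w') * u + 2 * (1 + t * w) * w' * u) * B)"
  shows "((\<lambda>t. N t powr (-p) * R t) has_real_derivative
    (-p * N t powr (-p - 1) * (2 * (1 + t * w) * w * u) * R t + N t powr (-p) * R' t)) (at t)"
proof -
  have N0: "N t > 0" unfolding N_def using u by (simp add: add_pos_nonneg)
  have N: "(N has_real_derivative 2 * (1 + t * w) * w * u) (at t)"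
    unfolding N_def by (auto intro!: derivative_eq_intros)
  have R: "(R has_real_derivative R' t) (at t)"
    unfolding R_def R'_def
    by (rule derivative_eq_intros refl | simp)+ (simp add: algebra_simps power2_eq_square)
  have P: "((\<lambda>t. N t powr (-p)) has_real_derivative (-p) * N t powr (-p - 1) * (2 * (1 + t * w) * w * u)) (at t)"
    using DERIV_fun_powr[OF N N0, of "-p"] by simp
  show ?thesis using DERIV_mult[OF P R] by (simp add: algebra_simps)
qed

context compact_metric_vb begin

text \<open>At \<open>t = 0\<close> the weight contributes \<open>-2 p w u (A + q B)\<close> and the
  density \<open>2 w A + 4 w' B + 4 q (w + w' u) B\<close>, the latter with one more factor
  \<open>1 + u\<close>. Inserting \<open>w\<close> and \<open>w'\<close> and dividing by 2 gives the
  integrand.\<close>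

lemma harmonic_identity:
  assumes harm: "harmonic_section E vol p q s"
  defines "A \<equiv> conn_norm_sq E s" and "B \<equiv> grad_norm_sq E (half_norm_sq E s)" and "u \<equiv> norm_sq s"
  shows "(LINT x|vol. (1 + u x) powr (a - p - 1) *
    (A x * (1 + (1 - p) * u x) + B x * (2 * a + 2 * q + q * (2 + 2 * a - p) * u x))) = 0"
proof -
  have s: "smooth_section E s" using harm by (simp add: harmonic_section_def)
  have u0: "u x \<ge> 0" for x by (simp add: u_def norm_sq_nonneg)
  define w where "w x = (1 + u x) powr a" for x
  define w' where "w' x = a * (1 + u x) powr (a - 1)" for x
  define N where "N t x = 1 + (1 + t * w x)\<^sup>2 * u x" for t x
  define R where "R t x = (1 + t * w x)\<^sup>2 * A x + 4 * (t * w' x) * (1 + t * w x + t * w' x * u x) * B x +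
       q * (((1 + t * w x)\<^sup>2 + 2 * (1 + t * w x) * (t * w' x) * u x)\<^sup>2 * B x)" for t x
  define R' where "R' t x = 2 * (1 + t * w x) * w x * A x + 4 * w' x * (1 + t * w x + t * w' x * u x) * B x +
       4 * (t * w' x) * (w x + w' x * u x) * B x +
       q * (2 * ((1 + t * w x)\<^sup>2 + 2 * (1 + t * w x) * (t * w' x) * u x) *
         (2 * (1 + t * w x) * w x + 2 * w x * (t * w' x) * u x + 2 * (1 + t * w x) * w' x * u x) * B x)" for t x
  define f where "f t x = N t x powr (-p) * R t x" for t x
  define f' where "f' t x = -p * N t x powr (-p - 1) * (2 * (1 + t * w x) * w x * u x) * R t x + N t x powr (-p) * R' t x" for t x
  have N0: "N t x \<noteq> 0" for t x
    using u0[of x] by (metis N_def add_pos_nonneg less_irrefl mult_nonneg_nonneg zero_le_power2 zero_less_one)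
  have u1: "1 + u x \<noteq> 0" for x using u0[of x] by linarith
  have cu: "continuous_on UNIV u" unfolding u_def by (rule smooth_fun_continuous[OF smooth_norm_sq[OF s]])
  have cA: "continuous_on UNIV A" "continuous_on UNIV B"
    unfolding A_def B_def by (rule conn_norm_sq_continuous[OF s] grad_norm_sq_continuous[OF s])+
  have cw: "continuous_on UNIV w" "continuous_on UNIV w'"
    unfolding w_def w'_def using u1 by (auto intro!: continuous_intros cu)
  have density: "1 / (1 + fibre_metric E (radial_variation s a t x) (radial_variation s a t x)) powr p *
     (conn_norm_sq E (radial_variation s a t) x + q * grad_norm_sq E (half_norm_sq E (radial_variation s a t)) x) = f t x" for t x
  proof -
    let ?h = "\<lambda>r. 1 + t * (1 + r) powr a"
    have rv: "radial_variation s a t = scale_section (\<lambda>z. ?h (norm_sq s z)) s"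
      by (simp add: radial_variation_def radial_factor_def[abs_def])
    have sm: "smooth_fun E (\<lambda>z. ?h (norm_sq s z))"
      using smooth_radial_factor[OF s] by (simp add: radial_factor_def[abs_def])
    have h: "(?h has_real_derivative t * w' x) (at (norm_sq s x))"
      using one_plus_norm_sq_pos[of s x]
      by (auto intro!: derivative_eq_intros DERIV_fun_powr simp: w'_def u_def)
    have "fibre_metric E (radial_variation s a t x) (radial_variation s a t x) = (1 + t * w x)\<^sup>2 * u x"
      using norm_sq_scale[OF section_proj[OF s]] by (simp add: norm_sq_def[symmetric] rv w_def u_def)
    moreover have "conn_norm_sq E (radial_variation s a t) x =
        (1 + t * w x)\<^sup>2 * A x + 4 * (t * w' x) * (1 + t * w x + t * w' x * u x) * B x"
      unfolding rv conn_norm_sq_scale[OF s sm h] by (simp add: A_def B_def u_def w_def)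
    moreover have "grad_norm_sq E (half_norm_sq E (radial_variation s a t)) x =
        ((1 + t * w x)\<^sup>2 + 2 * (1 + t * w x) * (t * w' x) * u x)\<^sup>2 * B x"
      unfolding rv grad_norm_sq_scale[OF s sm h] by (simp add: B_def u_def w_def)
    ultimately show ?thesis by (simp add: f_def N_def R_def powr_minus_divide)
  qed
  have "((\<lambda>t. LINT x|vol. f t x) has_real_derivative (LINT x|vol. f' 0 x)) (at 0)"
  proof (rule vol_derivative)
    show "continuous_on UNIV (f t)" for t
      unfolding f_def[abs_def] R_def using N0 unfolding N_def
      by (intro continuous_intros cu cA cw) auto
    show "((\<lambda>t. f t x) has_real_derivative f' t x) (at t)" for t x
      unfolding f_def f'_def N_def R_def R'_def by (rule radial_energy_density_derivative[OF u0])
    have l: "continuous_on ({-1..1::real} \<times> UNIV) (\<lambda>z. g (snd z))" if "continuous_on UNIV g" for g :: "'m \<Rightarrow> real"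
      by (rule continuous_on_compose2[OF that continuous_on_snd[OF continuous_on_id]]) auto
    show "continuous_on ({-1..1} \<times> UNIV) (\<lambda>(t, x). f' t x)"
      unfolding f'_def split_def R_def R'_def using N0 unfolding N_def
      by (intro continuous_intros l[OF cu] l[OF cA(1)] l[OF cA(2)] l[OF cw(1)] l[OF cw(2)]) auto
  qed
  moreover have "((\<lambda>t. vertical_energy E vol p q (radial_variation s a t)) has_real_derivative 0) (at 0)"
    using harm smooth_radial_variation[OF s] by (simp add: harmonic_section_def)
  then have "((\<lambda>t. 1 / 2 * (LINT x|vol. f t x)) has_real_derivative 0) (at 0)"
    unfolding vertical_energy_def density .
  ultimately have "1 / 2 * (LINT x|vol. f' 0 x) = 0"
    using DERIV_unique DERIV_cmult by blast
  moreover have "f' 0 x = 2 * ((1 + u x) powr (a - p - 1) *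
    (A x * (1 + (1 - p) * u x) + B x * (2 * a + 2 * q + q * (2 + 2 * a - p) * u x)))" for x
  proof -
    \<comment> \<open>Every power is rewritten through \<open>(1 + u x) powr (-p - 1)\<close> and
      \<open>(1 + u x) powr (a - 1)\<close>, after which the claim is a polynomial identity.\<close>
    have pw: "(1 + u x) powr (-p) = (1 + u x) powr (-p - 1) * (1 + u x)"
      "w x = (1 + u x) powr (a - 1) * (1 + u x)"
      "(1 + u x) powr (a - p - 1) = (1 + u x) powr (-p - 1) * (1 + u x) powr (a - 1) * (1 + u x)"
      using u0[of x] powr_add[of "1 + u x" "-p - 1" 1] powr_add[of "1 + u x" "a - 1" 1]
        powr_add[of "1 + u x" "-p - 1" "a - 1"] powr_add[of "1 + u x" "-p - 1 + (a - 1)" 1]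
      by (simp_all add: w_def algebra_simps)
    show ?thesis
      unfolding f'_def N_def R_def R'_def w'_def by (simp add: pw) (simp add: algebra_simps power2_eq_square)
  qed
  ultimately show ?thesis by simp
qed

end

context metric_vb begin

section \<open>Sections of constant length and the Euler class\<close>

text \<open>The squared gradient norm is a sum of squares over the frame, each the square of half
  the derivative of \<open>norm_sq s\<close>; all vanish, and the frame spans.\<close>

lemma grad_norm_sq_zero_derivative:
  assumes s: "smooth_section E s" and B: "grad_norm_sq E (half_norm_sq E s) x = 0"
    and c: "c \<in> atlas E" "x \<in> fst c"
  shows "((norm_sq s \<circ> chart_inv c) has_derivative (\<lambda>\<xi>. 0)) (at (snd c x))"
proof -
  interpret g: pos_form "coord_metric c x" by (rule coord_metric_form[OF c])
  let ?D = "frechet_derivative (norm_sq s \<circ> chart_inv c) (at (snd c x))"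
  note D = smooth_fun_has_derivative[OF smooth_norm_sq[OF s] c]
  have lin: "linear ?D" using D has_derivative_linear by blast
  have "fibre_metric E (conn E x (frame x i) s) (s x) = 0" for i
    using B by (simp add: grad_half_norm_sq_frame[OF s] sum_nonneg_eq_0_iff)
  then have "?D (frame x i c) = 0" for i
    using dir_deriv_chart[OF smooth_norm_sq[OF s] c frame_tangent, of i] dir_deriv_norm_sq[OF frame_tangent s, of x i]
    by simp
  then have "?D \<xi> = 0" for \<xi>
    by (subst g.ortho_expand[OF orthonormal_frame_ortho[OF c frame], of \<xi>])
      (simp add: linear_sum[OF lin] linear_scale[OF lin])
  then have "?D = (\<lambda>\<xi>. 0)" by auto
  with D show ?thesis by simp
qed

text \<open>A vanishing derivative makes the length constant on coordinate balls, which are convex,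
  and connectedness joins the local constants.\<close>

lemma norm_sq_constant:
  assumes s: "smooth_section E s" and conn: "connected (UNIV :: 'm set)"
    and B: "\<And>x. grad_norm_sq E (half_norm_sq E s) x = 0"
  shows "norm_sq s x = norm_sq s y"
proof -
  have loc: "eventually (\<lambda>z. norm_sq s x = norm_sq s z) (at x within UNIV)" for x
  proof -
    obtain c where c: "c \<in> atlas E" "x \<in> fst c" using chart_exists by blast
    obtain r where r: "r > 0" "ball (snd c x) r \<subseteq> snd c ` fst c"
      using chart_open(2)[OF c(1)] c(2) open_contains_ball by (metis imageI)
    let ?f = "norm_sq s \<circ> chart_inv c" and ?B = "ball (snd c x) r"
    have "\<exists>k. \<forall>y\<in>?B. ?f y = k"
    proof (rule has_derivative_zero_constant)
      fix y assume y: "y \<in> ?B"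
      then have "chart_inv c y \<in> fst c" "snd c (chart_inv c y) = y"
        using r chart_inv_in[OF c(1) order_refl] chart_chart_inv[OF c(1)] by auto
      then show "(?f has_derivative (\<lambda>h. 0)) (at y within ?B)"
        using grad_norm_sq_zero_derivative[OF s B c(1), of "chart_inv c y"] has_derivative_at_withinI by metis
    qed simp
    then obtain k where k: "\<And>y. y \<in> ?B \<Longrightarrow> ?f y = k" by blast
    have *: "norm_sq s z = k" if z: "z \<in> chart_inv c ` ?B" for z using k z by auto
    have x: "x \<in> chart_inv c ` ?B" using c r by (intro image_eqI[of _ _ "snd c x"]) auto
    have "open (chart_inv c ` ?B)" by (rule open_chart_vimage[OF c(1) open_ball r(2)])
    then have "eventually (\<lambda>z. z \<in> chart_inv c ` ?B) (at x)"
      using x eventually_at_topological by blast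
    then show ?thesis by (rule eventually_mono) (use * x in auto)
  qed
  show ?thesis by (rule connected_local_const[OF conn]) (use loc in auto)
qed

section \<open>The homotopy from the zero section\<close>

lemma section_triv_continuous:
  assumes s: "smooth_section E s" and b: "b \<in> trivs E"
  shows "continuous_on (fst b) (\<lambda>z. snd b (s z))"
proof -
  have "isCont (\<lambda>z. snd b (s z)) x" if x: "x \<in> fst b" for x
  proof -
    obtain c where c: "c \<in> atlas E" "x \<in> fst c" using chart_exists by blast
    let ?U = "fst c \<inter> fst b"
    have "continuous_on ?U (\<lambda>z. snd b (s (chart_inv c (snd c z))))"
      by (rule continuous_on_compose2[OF smooth_on_imp_continuous_on[OF section_smooth[OF s c(1) b]]])
         (auto intro: continuous_on_subset[OF continuous_on_chart[OF c(1)]])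
    then have "continuous_on ?U (\<lambda>z. snd b (s z))" by (rule continuous_on_eq) (use c in auto)
    moreover have "open ?U" using chart_open(1)[OF c(1)] triv_open[OF b] by auto
    ultimately show ?thesis using c x by (simp add: continuous_on_eq_continuous_at)
  qed
  then show ?thesis using triv_open[OF b] by (simp add: continuous_on_eq_continuous_at)
qed

text \<open>The topology of the total space is accessible only through trivialisations; in one of
  them the map is \<open>(t, z) \<mapsto> (z, t s(z))\<close>.\<close>

lemma scale_section_continuous:
  assumes s: "smooth_section E s"
  shows "continuous_on UNIV (\<lambda>(t, z). scale_section (\<lambda>_. t) s z)"
proof -
  have "isCont (\<lambda>(t, z). scale_section (\<lambda>_. t) s z) p" for p :: "real \<times> 'm"
  proof -
    obtain b where b: "b \<in> trivs E" "snd p \<in> fst b" using triv_exists by blast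
    let ?S = "(UNIV :: real set) \<times> fst b"
    have inv: "continuous_on (fst b \<times> UNIV) (\<lambda>(x, \<xi>). triv_inv E b x \<xi>)"
      using triv_homeo[OF b(1)] by (simp add: homeomorphism_def)
    have "continuous_on ?S (\<lambda>p. snd b (s (snd p)))"
      by (rule continuous_on_compose2[OF section_triv_continuous[OF s b(1)] continuous_on_snd[OF continuous_on_id]]) auto
    then have "continuous_on ?S (\<lambda>p. (snd p, fst p *\<^sub>R snd b (s (snd p))))"
      by (intro continuous_intros)
    from continuous_on_compose2[OF inv this]
    have "continuous_on ?S (\<lambda>p. triv_inv E b (snd p) (fst p *\<^sub>R snd b (s (snd p))))"
      by (simp add: image_subset_iff mem_Times_iff)
    then have "continuous_on ?S (\<lambda>(t, z). scale_section (\<lambda>_. t) s z)"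
    proof (rule continuous_on_eq)
      fix q assume q: "q \<in> ?S"
      let ?e = "scale_section (\<lambda>_. fst q) s (snd q)"
      have "proj E ?e = snd q" by (rule proj_scale_section[OF section_proj[OF s]])
      moreover have "snd b ?e = fst q *\<^sub>R snd b (s (snd q))"
        using scale_section_triv[OF section_proj[OF s] b(1)] q by auto
      ultimately show "triv_inv E b (snd q) (fst q *\<^sub>R snd b (s (snd q))) = (case q of (t, z) \<Rightarrow> scale_section (\<lambda>_. t) s z)"
        using triv_inv_triv[OF b(1), of ?e] q by (auto simp: split_def)
    qed
    moreover have "open ?S" using triv_open[OF b(1)] by (intro open_Times) auto
    ultimately show ?thesis
      using continuous_on_eq_continuous_at[of ?S] b(2) by (metis UNIV_I mem_Times_iff)
  qed
  then show ?thesis by (simp add: continuous_on_eq_continuous_at)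
qed

lemma zero_section_homotopic:
  assumes s: "smooth_section E s"
  shows "homotopic_with (\<lambda>h. True) euclidean euclidean (fibre_zero E) s"
  unfolding homotopic_with_def
proof (intro exI conjI allI ballI)
  let ?h = "\<lambda>(t, z). scale_section (\<lambda>_. t) s z"
  have "continuous_on ({0..1} \<times> UNIV) ?h"
    by (rule continuous_on_subset[OF scale_section_continuous[OF s]]) auto
  then show "continuous_map (prod_topology (top_of_set {0..1}) euclidean) euclidean ?h"
    using prod_topology_subtopology_eu[of "{0..1::real}" "UNIV :: 'm set"] by simp
  have eq: "e = e'" if "proj E e = x" "proj E e' = x" "snd (triv_at E x) e = snd (triv_at E x) e'" for e e' x
    by (rule fibre_eqI[OF triv_at(1)[of x]]) (use that triv_at(2)[of x] in auto)
  show "?h (0, x) = fibre_zero E x" for x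
    using proj_scale_section[OF section_proj[OF s]]
    by (auto intro!: eq[of _ x] simp: scale_section_triv[OF section_proj[OF s] triv_at] triv_fibre_zero[OF triv_at])
  show "?h (1, x) = s x" for x
    using proj_scale_section[OF section_proj[OF s]] section_proj[OF s]
    by (auto intro!: eq[of _ x] simp: scale_section_triv[OF section_proj[OF s] triv_at])
qed simp

lemma euler_class_nowhere_zero_section:
  assumes s: "smooth_section E s" and nz: "\<And>x. s x \<noteq> fibre_zero E x" and \<chi>: "is_euler_class E \<chi>E"
  shows "\<chi>E = \<one>\<^bsub>cohomology_group CARD('r) (euclidean :: 'm topology)\<^esub>"
proof -
  \<comment> \<open>The rank is positive because index types are nonempty, so the homotopy lemma
    applies in degree \<open>Suc k\<close>.\<close>
  obtain k where k: "CARD('r) = Suc k" using gr0_implies_Suc[OF zero_less_card_finite] by blast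
  obtain u where u: "thom_cocycle E u" and e: "\<chi>E = cohomology_class CARD('r) euclidean {}
       (cochain_pullback CARD('r) euclidean (fibre_zero E) u)"
    using \<chi> by (auto simp: is_euler_class_def)
  have "cochain_pullback (Suc k) euclidean (fibre_zero E) u \<in> coboundaries (Suc k) euclidean {}"
  proof (rule cochain_pullback_homotopic[OF zero_section_homotopic[OF s]])
    show "u \<in> cocycles (Suc k) euclidean (nonzero_part E)"
      using u by (simp add: thom_cocycle_def k)
    show "s ` topspace euclidean \<subseteq> nonzero_part E"
      using nz section_proj[OF s] by (auto simp: nonzero_part_def)
  qed
  then show ?thesis unfolding e k by (rule cohomology_class_coboundary)
qed

lemma grad_norm_sq_not_identically_zero:
  assumes s: "smooth_section E s" and conn: "connected (UNIV :: 'm set)" and \<chi>: "is_euler_class E \<chi>E"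
    and ne: "\<chi>E \<noteq> \<one>\<^bsub>cohomology_group CARD('r) (euclidean :: 'm topology)\<^esub>" and nt: "\<exists>x. s x \<noteq> fibre_zero E x"
  shows "\<exists>x. grad_norm_sq E (half_norm_sq E s) x \<noteq> 0"
proof (rule ccontr)
  assume "\<not> ?thesis"
  then have const: "norm_sq s x = norm_sq s y" for x y using norm_sq_constant[OF s conn] by blast
  then have "s x \<noteq> fibre_zero E x" for x
    using nt norm_sq_eq_0[of s] section_proj[OF s] by metis
  then show False using euler_class_nowhere_zero_section[OF s _ \<chi>] ne by blast
qed

end

context compact_metric_vb begin

section \<open>Harmonic sections\<close>

lemma harmonic_imp_grad_zero:
  assumes harm: "harmonic_section E vol p q s"
    and A: "\<And>x. 1 + (1 - p) * norm_sq s x \<ge> 0"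
    and B: "\<And>x. 2 * a + 2 * q + q * (2 + 2 * a - p) * norm_sq s x > 0"
  shows "grad_norm_sq E (half_norm_sq E s) x = 0"
proof -
  have s: "smooth_section E s" using harm by (simp add: harmonic_section_def)
  let ?u = "norm_sq s" and ?A = "conn_norm_sq E s" and ?B = "grad_norm_sq E (half_norm_sq E s)"
  let ?a = "\<lambda>x. ?A x * (1 + (1 - p) * ?u x)"
  let ?b = "\<lambda>x. ?B x * (2 * a + 2 * q + q * (2 + 2 * a - p) * ?u x)"
  have a0: "?a x \<ge> 0" for x using A conn_norm_sq_nonneg by simp
  have b0: "?b x \<ge> 0" for x using B[of x] grad_norm_sq_nonneg[OF s, of x] by simp
  have u1: "1 + ?u x \<noteq> 0" for x using one_plus_norm_sq_pos[of s x] by linarith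
  have "(1 + ?u x) powr (a - p - 1) * (?a x + ?b x) = 0"
  proof (rule integral_zero_imp_zero)
    show "continuous_on UNIV (\<lambda>x. (1 + ?u x) powr (a - p - 1) * (?a x + ?b x))"
      using u1 by (intro continuous_intros smooth_fun_continuous[OF smooth_norm_sq[OF s]]
          conn_norm_sq_continuous[OF s] grad_norm_sq_continuous[OF s]) auto
    show "0 \<le> (1 + ?u x) powr (a - p - 1) * (?a x + ?b x)" for x
      using a0[of x] b0[of x] by simp
  qed (rule harmonic_identity[OF harm])
  then have "?b x = 0" using u1 a0[of x] b0[of x] by (simp add: add_nonneg_eq_0_iff)
  then show ?thesis using B[of x] by simp
qed

lemma harmonic_unique:
  assumes q: "harmonic_section E vol p q s" and q': "harmonic_section E vol p q' s" and ne: "q \<noteq> q'"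
  shows "grad_norm_sq E (half_norm_sq E s) x = 0"
proof -
  have s: "smooth_section E s" using q by (simp add: harmonic_section_def)
  let ?u = "norm_sq s" and ?A = "conn_norm_sq E s" and ?B = "grad_norm_sq E (half_norm_sq E s)"
  \<comment> \<open>The integrand of \<open>harmonic_identity\<close> for \<open>a = p / 2\<close>,
    left unsimplified so that it matches literally. In the difference for \<open>q\<close> and
    \<open>q'\<close> the terms without \<open>q\<close> cancel, among them all those with
    \<open>?A\<close>.\<close>
  define I where "I q x = (1 + ?u x) powr (p / 2 - p - 1) *
    (?A x * (1 + (1 - p) * ?u x) + ?B x * (2 * (p / 2) + 2 * q + q * (2 + 2 * (p / 2) - p) * ?u x))" for q x
  have u1: "1 + ?u x \<noteq> 0" for x using one_plus_norm_sq_pos[of s x] by linarith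
  have cI: "continuous_on UNIV (I q)" for q
    unfolding I_def using u1 by (intro continuous_intros smooth_fun_continuous[OF smooth_norm_sq[OF s]]
          conn_norm_sq_continuous[OF s] grad_norm_sq_continuous[OF s]) auto
  have zero: "(LINT x|vol. I q x) = 0" "(LINT x|vol. I q' x) = 0"
    unfolding I_def by (rule harmonic_identity[OF q] harmonic_identity[OF q'])+
  have diff: "I q x - I q' x = 2 * (q - q') * ((1 + ?u x) powr (p / 2 - p - 1) * (1 + ?u x) * ?B x)" for x
    unfolding I_def by (simp add: algebra_simps)
  have "(LINT x|vol. I q x - I q' x) = 0"
    using Bochner_Integration.integral_diff[OF vol_integrable[OF cI] vol_integrable[OF cI]] zero by simp
  then have 0: "(LINT x|vol. (1 + ?u x) powr (p / 2 - p - 1) * (1 + ?u x) * ?B x) = 0"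
    using ne unfolding diff by simp
  have "(1 + ?u x) powr (p / 2 - p - 1) * (1 + ?u x) * ?B x = 0"
  proof (rule integral_zero_imp_zero[OF _ _ 0])
    show "continuous_on UNIV (\<lambda>x. (1 + ?u x) powr (p / 2 - p - 1) * (1 + ?u x) * ?B x)"
      using u1 by (intro continuous_intros smooth_fun_continuous[OF smooth_norm_sq[OF s]]
          grad_norm_sq_continuous[OF s]) auto
    show "0 \<le> (1 + ?u x) powr (p / 2 - p - 1) * (1 + ?u x) * ?B x" for x
      using one_plus_norm_sq_pos[of s x] grad_norm_sq_nonneg[OF s, of x] by simp
  qed
  then show ?thesis using u1[of x] by simp
qed

text \<open>A supremum of reals bounds its members only if they are bounded above, which compactness
  provides.\<close>

lemma norm_sq_le_sup_norm:
  assumes s: "smooth_section E s"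
  shows "sqrt (norm_sq s x) \<le> section_sup_norm E s"
  unfolding section_sup_norm_def norm_sq_def
proof (rule cSUP_upper)
  have "continuous_on UNIV (\<lambda>x. sqrt (norm_sq s x))"
    by (intro continuous_intros smooth_fun_continuous[OF smooth_norm_sq[OF s]])
  then have "compact (range (\<lambda>x. sqrt (norm_sq s x)))" by (rule compact_continuous_image[OF _ comp])
  then show "bdd_above (range (\<lambda>x. sqrt (fibre_metric E (s x) (s x))))"
    unfolding norm_sq_def by (intro bounded_imp_bdd_above compact_imp_bounded)
qed simp

text \<open>This is the sup norm bound in the form \<open>1 + (1 - p) u \<ge> 0\<close>.\<close>

lemma norm_sq_bound:
  assumes s: "smooth_section E s" and p: "1 < p" and le: "section_sup_norm E s \<le> 1 / sqrt (p - 1)"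
  shows "(p - 1) * norm_sq s x \<le> 1"
proof -
  have "sqrt (norm_sq s x) \<le> 1 / sqrt (p - 1)" using norm_sq_le_sup_norm[OF s, of x] le by linarith
  then have "sqrt (p - 1) * sqrt (norm_sq s x) \<le> 1" using p by (simp add: field_simps)
  then have "sqrt ((p - 1) * norm_sq s x) \<le> sqrt 1" by (simp only: real_sqrt_mult real_sqrt_one)
  then show ?thesis by (simp only: real_sqrt_le_iff)
qed

end

theorem theoremB:
  fixes E :: "('m::{t2_space,second_countable_topology}, 'n::finite,
               'e::topological_space, 'r::finite) metric_bundle"
    and vol :: "'m measure"
    and \<chi>E :: "'m cochain set"
    and \<sigma> :: "'m \<Rightarrow> 'e"
  assumes "oriented_riemannian_vector_bundle E"
    and "connected (UNIV :: 'm set)"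
    and "compact (UNIV :: 'm set)"
    and "is_riemannian_volume E vol"
    and "is_euler_class E \<chi>E"
    and "\<chi>E \<noteq> \<one>\<^bsub>cohomology_group CARD('r) (euclidean :: 'm topology)\<^esub>"
    and "smooth_section E \<sigma>"
    and "\<exists>x. \<sigma> x \<noteq> fibre_zero E x"
  shows "(\<forall>p. \<exists>\<^sub>\<le>\<^sub>1 q. harmonic_section E vol p q \<sigma>) \<and>
    (\<forall>p q. harmonic_section E vol p q \<sigma> \<longrightarrow>
       (-4 \<le> p \<and> p \<le> -1 \<longrightarrow> q < -1 - p) \<and>
       (-1 \<le> p \<and> p \<le> 1 \<longrightarrow> q < 0) \<and>
       (1 < p \<and> p \<le> 2 \<and> section_sup_norm E \<sigma> \<le> 1 / sqrt (p - 1) \<longrightarrow> q < 0) \<and>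
       (2 \<le> p \<and> section_sup_norm E \<sigma> \<le> 1 / sqrt (p - 1) \<longrightarrow> q < 1 - p / 2))"
proof -
  interpret compact_metric_vb E vol by unfold_locales (fact assms)+
  let ?u = "norm_sq \<sigma>"
  have u0: "?u x \<ge> 0" for x by (rule norm_sq_nonneg)
  obtain x0 where x0: "grad_norm_sq E (half_norm_sq E \<sigma>) x0 \<noteq> 0"
    using grad_norm_sq_not_identically_zero[OF assms(7,2,5,6,8)] by blast
  \<comment> \<open>For \<open>a = 1\<close> the gradient coefficient is
    \<open>2 + 2 q + q (4 - p) u\<close>, which is at least 2 once \<open>q \<ge> 0\<close>; the
    summand \<open>2 a\<close> keeps it positive even for \<open>q = 0\<close>.\<close>
  have low: "q < 0" if h: "harmonic_section E vol p q \<sigma>" and p: "p \<le> 1" for p q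
  proof (rule ccontr)
    assume "\<not> q < 0"
    then have q: "q \<ge> 0" by simp
    have "grad_norm_sq E (half_norm_sq E \<sigma>) x0 = 0"
    proof (rule harmonic_imp_grad_zero[OF h, of 1])
      fix x
      show "0 \<le> 1 + (1 - p) * ?u x" using p u0[of x] by simp
      have "0 \<le> q * (2 + 2 * 1 - p) * ?u x" using p q u0[of x] by simp
      then show "0 < 2 * 1 + 2 * q + q * (2 + 2 * 1 - p) * ?u x" using q by linarith
    qed
    then show False using x0 by simp
  qed
  have high: "\<not> (\<forall>x. p + 2 * q * (1 + ?u x) > 0)"
    if h: "harmonic_section E vol p q \<sigma>" and p: "1 < p" and le: "section_sup_norm E \<sigma> \<le> 1 / sqrt (p - 1)" for p q
  proof
    assume pos: "\<forall>x. p + 2 * q * (1 + ?u x) > 0"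
    have "grad_norm_sq E (half_norm_sq E \<sigma>) x0 = 0"
    proof (rule harmonic_imp_grad_zero[OF h, of "p / 2"])
      fix x
      show "0 \<le> 1 + (1 - p) * ?u x"
        using norm_sq_bound[OF assms(7) p le, of x] by (simp add: algebra_simps)
      show "0 < 2 * (p / 2) + 2 * q + q * (2 + 2 * (p / 2) - p) * ?u x"
        using pos by (simp add: algebra_simps)
    qed
    then show False using x0 by simp
  qed
  show ?thesis
  proof (intro conjI allI impI)
    show "\<exists>\<^sub>\<le>\<^sub>1 q. harmonic_section E vol p q \<sigma>" for p
      using harmonic_unique x0 unfolding Uniq_def by metis
  next
    fix p q assume h: "harmonic_section E vol p q \<sigma>"
    \<comment> \<open>Here \<open>p \<le> -1\<close> gives \<open>0 \<le> -1 - p\<close>.\<close>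
    show "q < -1 - p" if "-4 \<le> p \<and> p \<le> -1" using low[OF h] that by simp
    show "q < 0" if "-1 \<le> p \<and> p \<le> 1" using low[OF h] that by simp
    show "q < 0" if p: "1 < p \<and> p \<le> 2 \<and> section_sup_norm E \<sigma> \<le> 1 / sqrt (p - 1)"
    proof (rule ccontr)
      assume "\<not> q < 0"
      then have "2 * q * (1 + ?u x) \<ge> 0" for x using u0[of x] by simp
      \<comment> \<open>At \<open>q = 0\<close> the strict sign comes from \<open>p\<close>
        alone.\<close>
      then have "p + 2 * q * (1 + ?u x) > 0" for x using p by (smt (verit))
      then show False using high[OF h] p by blast
    qed
    show "q < 1 - p / 2" if p: "2 \<le> p \<and> section_sup_norm E \<sigma> \<le> 1 / sqrt (p - 1)"
    proof (rule ccontr)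
      assume "\<not> q < 1 - p / 2"
      then have q: "2 * q \<ge> 2 - p" by simp
      \<comment> \<open>The borderline \<open>2 q = 2 - p\<close> gives
        \<open>p + (2 - p) (1 + u) = 2 - (p - 2) u\<close>, and \<open>(p - 1) u \<le> 1\<close>
        bounds this below by \<open>1 + u\<close>.\<close>
      have "p + 2 * q * (1 + ?u x) > 0" for x
      proof -
        have "(2 - p) * (1 + ?u x) \<le> 2 * q * (1 + ?u x)" using q u0[of x] by (intro mult_right_mono) auto
        moreover have "(p - 1) * ?u x \<le> 1" using norm_sq_bound[OF assms(7)] p by simp
        ultimately show ?thesis using u0[of x] by (simp add: algebra_simps)
      qed
      then show False using high[OF h] p by simp
    qed
  qed
qed

end
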